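(* Let $(x,\Phi)$ be a minimizer of the Crisanti–Sommers functional $\mathscr C$ with constraint $Q$, and let $\mu_P$ be the measure with $\mu_P([0,t])=x(t)$. If $$2\langle\vec\beta_2\otimes\vec\beta_2,\Phi'(0)^{\circ2}\rangle\ne\langle\hat\Phi(0)^{-1}\Phi'(0),\hat\Phi(0)^{-1}\Phi'(0)\rangle$$ and $0\in\mathrm{supp}\,\mu_P$, then there exists $\hat q>0$ such that $\mu_P([0,\hat q])=\mu_P(\{0\})$.
   Context: Fix $m\ge1$. For each $p\ge2$ let $\vec\beta_p\in\mathbb R^m$, with $\vec\beta_p=0$ for odd $p$ and $\sum_{p\ge2}2^p\vec\beta_p(j)^2<\infty$ for every $1\le j\le m$; let $\vec h\in\mathbb R^m$. (The inverse temperature is absorbed into $\xi$ and $\vec h$.) $\odot$ is the entrywise product, $A^{\circ p}$ the entrywise $p$-th power, $|A|$ the determinant, and $\langle A,B\rangle=\mathrm{Trace}(AB)$, which is the Frobenius inner product on symmetric matrices; in particular $\langle\hat\Phi^{-1}\Phi',\hat\Phi^{-1}\Phi'\rangle=\langle\hat\Phi^{-1}\Phi'\hat\Phi^{-1},\Phi'\rangle$. $\vec\beta_p\otimes\vec\beta_p=(\vec\beta_p(i)\vec\beta_p(j))_{i,j}$, $\xi(A)=\sum_p(\vec\beta_p\otimes\vec\beta_p)\odot A^{\circ p}$, $\xi'(A)=\sum_pp(\vec\beta_p\otimes\vec\beta_p)\odot A^{\circ(p-1)}$. $\mathbb S^m_+$ is the set of symmetric positive semidefinite $m\times m$ matrices.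 $Q\in\mathbb S^m_+$ has entries in $[-1,1]$ and diagonal entries $1$. Admissible pairs $(x,\Phi)$: $x:[0,m]\to[0,1]$ is right-continuous and nondecreasing with $x(0^-)=0$, $x(m)=1$, with associated probability measure $\mu_P([0,t])=x(t)$ (an atom at $0$ of mass $x(0)$ is allowed); $\Phi\in\mathscr M$, i.e. $\Phi:[0,m]\to\mathbb S^m_+$ is a continuously differentiable, Lipschitz, monotone (Loewner-nondecreasing) path with Lipschitz derivative, $\Phi(0)=0$, $\Phi(m)=Q$, and $\mathrm{Trace}(\Phi(t))=t$ for $t\in\mathrm{supp}\,\mu_P$; and $|Q-\Phi(t_x)|>0$ where $t_x=\inf\{t:x(t)=1\}$. Put $\hat\Phi(t)=\int_t^mx(s)\Phi'(s)ds$. For $\hat T\in(t_x,m)$ with $|Q-\Phi(\hat T)|>0$ (the value does not depend on $\hat T$), $$\mathscr C(x,\Phi)=\tfrac12\Big[\int_0^mx(t)\langle\xi'(\Phi(t))+\vec h\vec h^T,\Phi'(t)\rangle dt+\log|\Phi(m)-\Phi(\hat T)|+\int_0^{\hat T}\langle\hat\Phi(t)^{-1},\Phi'(t)\rangle dt\Big].$$ A minimizer is a pair minimizing $\mathscr C$ over all admissible pairs. *)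

theory Defs
  imports "HOL-Analysis.Analysis"
begin

text \<open>
  Matrices are of type \<open>real^'n^'n\<close>, and \<open>m = CARD('n)\<close>.  On this type the library operations
  \<open>*\<close> and \<open>^\<close> act entrywise, so they are the Hadamard product \<open>A \<odot> B\<close> and the
  Hadamard power \<open>A\<^sup>\<circ>\<^sup>p\<close>; the matrix product is \<open>**\<close>.
\<close>

lemma hadamard_mult_component: "((A :: real^'n^'n) * B) $ i $ j = A $ i $ j * B $ i $ j"
  by simp

lemma hadamard_power_component: "((A :: real^'n^'n) ^ p) $ i $ j = (A $ i $ j) ^ p"
  by (induction p) simp_all

definition outer :: "real^'n \<Rightarrow> real^'n \<Rightarrow> real^'n^'n" where
  "outer u v = (\<chi> i j. u $ i * v $ j)"

definition trace_prod :: "real^'n^'n \<Rightarrow> real^'n^'n \<Rightarrow> real" where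
  "trace_prod A B = trace (A ** B)"

definition psd :: "real^'n^'n \<Rightarrow> bool" where
  "psd A \<longleftrightarrow> transpose A = A \<and> (\<forall>v. 0 \<le> v \<bullet> (A *v v))"

definition xi_deriv :: "(nat \<Rightarrow> real^'n) \<Rightarrow> real^'n^'n \<Rightarrow> real^'n^'n" where
  "xi_deriv \<beta> A = (\<Sum>\<^sub>\<infinity>p\<in>{2..}. real p *\<^sub>R (outer (\<beta> p) (\<beta> p) * A ^ (p - 1)))"

definition order_cdf :: "real \<Rightarrow> (real \<Rightarrow> real) \<Rightarrow> bool" where
  "order_cdf T x \<longleftrightarrow>
     x \<in> {0..T} \<rightarrow> {0..1} \<and> mono_on {0..T} x \<and>
     (\<forall>t\<in>{0..<T}. continuous (at_right t) x) \<and> x T = 1"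

text \<open>
  The distribution function is extended by \<open>0\<close> to the left (the convention \<open>x(0\<^sup>-) = 0\<close>, so
  that \<open>x 0\<close> is the mass of an atom at \<open>0\<close>) and by \<open>1\<close> to the right of its interval.
\<close>

definition order_measure :: "real \<Rightarrow> (real \<Rightarrow> real) \<Rightarrow> real measure" where
  "order_measure T x = interval_measure (\<lambda>t. if t < 0 then 0 else if t \<le> T then x t else 1)"

definition msupport :: "'a::topological_space measure \<Rightarrow> 'a set" where
  "msupport M = {t. \<forall>U. open U \<longrightarrow> t \<in> U \<longrightarrow> emeasure M U > 0}"

lemma emeasure_order_measure:
  assumes "order_cdf T x" "0 \<le> t" "t \<le> T"
  shows "emeasure (order_measure T x) {0..t} = ennreal (x t)"
proof -
  define F where "F = (\<lambda>t. if t < 0 then 0 else if t \<le> T then x t else 1)"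
  let ?M = "interval_measure F"
  have x01: "0 \<le> x s" "x s \<le> 1" if "0 \<le> s" "s \<le> T" for s
    using assms(1) that by (auto simp: order_cdf_def Pi_iff)
  have mono: "F a \<le> F b" if "a \<le> b" for a b
    using assms(1) x01[of a] x01[of b] that
    by (auto simp: order_cdf_def F_def mono_on_def)
  have cont: "continuous (at_right a) F" for a
  proof -
    consider "a < 0" | "0 \<le> a" "a < T" | "T \<le> a" "0 \<le> a" by linarith
    then show ?thesis
    proof cases
      case 1
      have "\<forall>\<^sub>F s in at_right a. F s = 0"
        using 1 by (auto simp: eventually_at_right_field F_def intro!: exI[of _ 0])
      then have "(F \<longlongrightarrow> 0) (at_right a)" by (rule tendsto_eventually)
      then show ?thesis using 1 by (simp add: continuous_within F_def)
    next
      case 2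
      then have "(x \<longlongrightarrow> x a) (at_right a)"
        using assms(1) by (auto simp: order_cdf_def continuous_within)
      moreover have "\<forall>\<^sub>F s in at_right a. x s = F s"
        using 2 by (auto simp: eventually_at_right_field F_def intro!: exI[of _ T])
      ultimately have "(F \<longlongrightarrow> x a) (at_right a)" by (rule Lim_transform_eventually)
      then show ?thesis using 2 by (simp add: continuous_within F_def)
    next
      case 3
      have Fa: "F a = 1" using 3 assms(1) by (auto simp: F_def order_cdf_def)
      have "\<forall>\<^sub>F s in at_right a. F s = 1"
        using 3 by (auto simp: eventually_at_right_field F_def intro!: exI[of _ "a + 1"])
      then have "(F \<longlongrightarrow> 1) (at_right a)" by (rule tendsto_eventually)
      then show ?thesis using Fa by (simp add: continuous_within)
    qed
  qed
  have "emeasure ?M {-1<..- inverse (real (Suc n))} = 0" for n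
    using emeasure_interval_measure_Ioc_eq[of F "-1" "- inverse (real (Suc n))"] mono cont
    by (auto simp: F_def)
  then have "(\<Union>n. {-1<..- inverse (real (Suc n))}) \<in> null_sets ?M"
    by (intro null_sets_UN) auto
  moreover have "(\<Union>n. {-1<..- inverse (real (Suc n))}) = {-1<..<0}" (is "?L = ?R")
  proof
    show "?L \<subseteq> ?R"
    proof
      fix s assume "s \<in> ?L"
      then obtain n where n: "-1 < s" "s \<le> - inverse (real (Suc n))" by auto
      have "inverse (real (Suc n)) > 0" by simp
      with n(2) have "s < 0" by linarith
      with n(1) show "s \<in> ?R" by simp
    qed
    show "?R \<subseteq> ?L"
    proof
      fix s :: real assume s: "s \<in> ?R"
      then obtain n where "inverse (real (Suc n)) < - s" using reals_Archimedean[of "- s"] by auto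
      then have "s \<le> - inverse (real (Suc n))" by linarith
      with s show "s \<in> ?L" by auto
    qed
  qed
  ultimately have "{-1<..<0} \<in> null_sets ?M" by simp
  then have "emeasure ?M ({0..t} \<union> {-1<..<0}) = emeasure ?M {0..t}"
    by (intro emeasure_Un_null_set) auto
  moreover have "{0..t} \<union> {-1<..<0} = {-1<..t}" using assms(2) by auto
  moreover have "emeasure ?M {-1<..t} = ennreal (x t)"
    using emeasure_interval_measure_Ioc_eq[of F "-1" t] mono cont assms by (simp add: F_def)
  ultimately show ?thesis by (simp add: order_measure_def F_def)
qed

text \<open>One-sided at the endpoints of the interval.\<close>

definition path_deriv :: "(real \<Rightarrow> real^'n^'n) \<Rightarrow> real \<Rightarrow> real^'n^'n" where
  "path_deriv \<Phi> t = vector_derivative \<Phi> (at t within {0..real CARD('n)})"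

definition C1_monotone_path :: "real^'n^'n \<Rightarrow> (real \<Rightarrow> real^'n^'n) \<Rightarrow> bool" where
  "C1_monotone_path Q \<Phi> \<longleftrightarrow>
     (\<forall>t\<in>{0..real CARD('n)}. psd (\<Phi> t)) \<and>
     (\<forall>t\<in>{0..real CARD('n)}. \<Phi> differentiable (at t within {0..real CARD('n)})) \<and>
     continuous_on {0..real CARD('n)} (path_deriv \<Phi>) \<and>
     (\<exists>L. L-lipschitz_on {0..real CARD('n)} \<Phi>) \<and>
     (\<exists>L. L-lipschitz_on {0..real CARD('n)} (path_deriv \<Phi>)) \<and>
     (\<forall>s t. 0 \<le> s \<longrightarrow> s \<le> t \<longrightarrow> t \<le> real CARD('n) \<longrightarrow> psd (\<Phi> t - \<Phi> s)) \<and>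
     \<Phi> 0 = 0 \<and> \<Phi> (real CARD('n)) = Q"

definition t_top :: "real \<Rightarrow> (real \<Rightarrow> real) \<Rightarrow> real" where
  "t_top T x = Inf {t \<in> {0..T}. x t = 1}"

definition admissible :: "real^'n^'n \<Rightarrow> (real \<Rightarrow> real) \<Rightarrow> (real \<Rightarrow> real^'n^'n) \<Rightarrow> bool" where
  "admissible Q x \<Phi> \<longleftrightarrow>
     order_cdf (real CARD('n)) x \<and> C1_monotone_path Q \<Phi> \<and>
     (\<forall>t \<in> msupport (order_measure (real CARD('n)) x). trace (\<Phi> t) = t) \<and>
     det (Q - \<Phi> (t_top (real CARD('n)) x)) > 0"

definition hat_path :: "(real \<Rightarrow> real) \<Rightarrow> (real \<Rightarrow> real^'n^'n) \<Rightarrow> real \<Rightarrow> real^'n^'n" where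
  "hat_path x \<Phi> t = integral {t..real CARD('n)} (\<lambda>s. x s *\<^sub>R path_deriv \<Phi> s)"

definition crisanti_sommers_at ::
  "(nat \<Rightarrow> real^'n) \<Rightarrow> real^'n \<Rightarrow> real \<Rightarrow> (real \<Rightarrow> real) \<Rightarrow> (real \<Rightarrow> real^'n^'n) \<Rightarrow> real" where
  "crisanti_sommers_at \<beta> h T x \<Phi> = 1/2 *
     (integral {0..real CARD('n)}
        (\<lambda>t. x t * trace_prod (xi_deriv \<beta> (\<Phi> t) + outer h h) (path_deriv \<Phi> t))
      + ln (det (\<Phi> (real CARD('n)) - \<Phi> T))
      + integral {0..T} (\<lambda>t. trace_prod (matrix_inv (hat_path x \<Phi> t)) (path_deriv \<Phi> t)))"

text \<open>
  For an admissible pair a suitable cutoff exists, because \<open>det (Q - \<Phi> t)\<close> is positive at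
  \<open>t_top\<close> and vanishes at the right endpoint, and the value does not depend on the cutoff, because
  \<open>hat_path x \<Phi> t = Q - \<Phi> t\<close> to the right of \<open>t_top\<close>.
\<close>

definition crisanti_sommers ::
  "(nat \<Rightarrow> real^'n) \<Rightarrow> real^'n \<Rightarrow> real^'n^'n \<Rightarrow> (real \<Rightarrow> real) \<Rightarrow> (real \<Rightarrow> real^'n^'n) \<Rightarrow> real" where
  "crisanti_sommers \<beta> h Q x \<Phi> = crisanti_sommers_at \<beta> h
     (SOME T. T \<in> {t_top (real CARD('n)) x<..<real CARD('n)} \<and> det (Q - \<Phi> T) > 0) x \<Phi>"

definition cs_minimizer ::
  "(nat \<Rightarrow> real^'n) \<Rightarrow> real^'n \<Rightarrow> real^'n^'n \<Rightarrow> (real \<Rightarrow> real) \<Rightarrow> (real \<Rightarrow> real^'n^'n) \<Rightarrow> bool" where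
  "cs_minimizer \<beta> h Q x \<Phi> \<longleftrightarrow> admissible Q x \<Phi> \<and>
     (\<forall>y \<Psi>. admissible Q y \<Psi> \<longrightarrow> crisanti_sommers \<beta> h Q x \<Phi> \<le> crisanti_sommers \<beta> h Q y \<Psi>)"

end

theory Submission
  imports Defs
begin

text \<open>
  The first variation of the functional in a direction \<open>\<Delta>\<close> of the path is
  \<open>- 1/2 * \<integral> \<langle>F t, \<Delta> t\<rangle> d\<mu>\<close>, where \<open>F = \<xi>'(\<Phi>) + h h\<^sup>T - \<integral>\<^sub>0\<^sup>t H\<^sup>-\<^sup>1 \<Phi>' H\<^sup>-\<^sup>1\<close> with \<open>H\<close> the hat path.  Such a
  direction destroys the condition on the trace, but a change of time, under which the functional is
  invariant, restores it; this moves \<open>x\<close> as well.  Put \<open>f t u = \<langle>F t, \<Phi>' u\<rangle>\<close>.  If an increment of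
  \<open>\<Phi>\<close> is moved from time \<open>u\<close> to a time close to \<open>0\<close>, minimality says that \<open>\<integral> f t u d\<mu>(t) \<le> 0\<close> over
  the times in between; if it is moved to a later time, the inequality is reversed.

  Since \<open>F 0 = h h\<^sup>T\<close>, the derivative of \<open>f\<close> in \<open>t\<close> at \<open>t = u = 0\<close> is the difference \<open>D\<close> of the two sides
  of the nondegeneracy condition.  If \<open>D > 0\<close>, then \<open>f t u > f 0 u = h \<bullet> (\<Phi>' u h) \<ge> 0\<close> for small \<open>t > 0\<close>,
  and moving increments earlier lowers the functional.  If \<open>D < 0\<close>, then \<open>f\<close> decreases in \<open>t\<close>, so that
  \<open>f t u > 0\<close> for \<open>t < u\<close> when \<open>f u u \<ge> 0\<close>, and \<open>f t u < 0\<close> for \<open>t > u\<close> when \<open>f u u < 0\<close>: moving the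
  increment at \<open>u\<close> earlier, respectively later, lowers the functional.  Both need mass on the
  corresponding side of \<open>u\<close> arbitrarily close to \<open>0\<close>, which is available unless \<open>x\<close> is constant
  near \<open>0\<close>.
\<close>

subsection \<open>Integration against monotone weights\<close>

text \<open>Two constraints dictate the choice of directions. A competitor has to stay
  Loewner-nondecreasing, and the velocity \<Phi>' may be singular, so an arbitrary symmetric matrix
  cannot be subtracted from it; taking away a fraction of \<Phi>' itself is always allowed. What is
  taken away has to be given back elsewhere, because \<Phi> ends at Q. In general such a transport
  cannot be run backwards, so minimality yields inequalities only, and these are played against the
  sign of f.

  The other obstacle is that x is merely monotone. The hat path H and its inverse need not be
  differentiable at the jumps of x, so identities such as (H^-1)' = x H^-1 \<Phi>' H^-1 are
  available only in integrated form. They come from exact difference identities: the resolvent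
  identity for H^-1 and divided differences for \<xi>'. The same identities pull the factor e out of
  the change of the functional exactly, so that nothing is differentiated under an integral.\<close>

lemma integral_mono_weight_deriv_neg:
  fixes x w w' :: "real \<Rightarrow> real"
  assumes x: "mono_on {0..T} x"
    and w: "\<And>t. t \<in> {0..T} \<Longrightarrow> (w has_real_derivative w' t) (at t within {0..T})"
    and w0: "w 0 = 0" and wT: "w T = 0"
    and nonneg: "\<And>t. t \<in> {0..T} \<Longrightarrow> 0 \<le> w t"
    and pq: "0 \<le> p" "p \<le> q" "q \<le> T"
    and pos: "\<And>t. t \<in> {p..q} \<Longrightarrow> 0 < w t"
    and jump: "x p < x q"
  shows "integral {0..T} (\<lambda>t. x t * w' t) < 0"
proof -
  have ftc: "(w' has_integral (w b - w a)) {a..b}" if "0 \<le> a" "a \<le> b" "b \<le> T" for a b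
    by (rule fundamental_theorem_of_calculus)
       (use that in \<open>auto intro!: has_vector_derivative_within_subset[OF _ subset_refl]
          simp flip: has_real_derivative_iff_has_vector_derivative
          intro: DERIV_subset[OF w]\<close>)
  have smv: "\<exists>c\<in>{a..b}. ((\<lambda>t. x t * w' t) has_integral
      (x a * (w c - w a) + x b * (w b - w c))) {a..b}" if "0 \<le> a" "a \<le> b" "b \<le> T" for a b
  proof -
    have "x s \<le> x t" if "a \<le> s" "s \<le> t" "t \<le> b" for s t
      using x that \<open>0 \<le> a\<close> \<open>b \<le> T\<close> by (auto simp: mono_on_def)
    with second_mean_value_theorem_full[OF has_integral_integrable[OF ftc[OF that]] that(2), of x]
    obtain c where c: "c \<in> {a..b}" "((\<lambda>t. x t * w' t) has_integral
        (x a * integral {a..c} w' + x b * integral {c..b} w')) {a..b}"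
      by blast
    moreover have "integral {a..c} w' = w c - w a" "integral {c..b} w' = w b - w c"
      using c(1) that by (auto intro!: integral_unique ftc)
    ultimately show ?thesis by auto
  qed
  \<comment> \<open>The integral is minus the Stieltjes integral of \<open>w\<close> against
    \<open>x\<close>. The second mean value theorem on the three pieces cut at \<open>p\<close> and
    \<open>q\<close> takes its place: after Abel summation the increment of \<open>x\<close> over
    each piece meets one value of \<open>-w\<close>, and the middle product is strictly
    negative.\<close>
  obtain c1 where c1: "c1 \<in> {0..p}" "((\<lambda>t. x t * w' t) has_integral
      (x 0 * (w c1 - w 0) + x p * (w p - w c1))) {0..p}"
    using smv[of 0 p] pq by auto
  obtain c2 where c2: "c2 \<in> {p..q}" "((\<lambda>t. x t * w' t) has_integral
      (x p * (w c2 - w p) + x q * (w q - w c2))) {p..q}"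
    using smv[of p q] pq by auto
  obtain c3 where c3: "c3 \<in> {q..T}" "((\<lambda>t. x t * w' t) has_integral
      (x q * (w c3 - w q) + x T * (w T - w c3))) {q..T}"
    using smv[of q T] pq by auto
  have "integral {0..T} (\<lambda>t. x t * w' t) =
      x 0 * w c1 + x p * (w p - w c1) + x p * (w c2 - w p) + x q * (w q - w c2)
      + x q * (w c3 - w q) - x T * w c3"
    using has_integral_combine[OF _ _ has_integral_combine[OF _ _ c1(2) c2(2)] c3(2)] pq w0 wT
    by (simp add: has_integral_iff)
  also have "\<dots> = (x 0 - x p) * w c1 + (x p - x q) * w c2 + (x q - x T) * w c3"
    by (simp add: algebra_simps)
  also have "(x 0 - x p) * w c1 \<le> 0"
    using monotone_onD[OF x, of 0 p] nonneg[of c1] c1(1) pq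
    by (intro mult_nonpos_nonneg) auto
  also have "(x q - x T) * w c3 \<le> 0"
    using monotone_onD[OF x, of q T] nonneg[of c3] c3(1) pq
    by (intro mult_nonpos_nonneg) auto
  also have "(x p - x q) * w c2 < 0"
    using pos[of c2] c2(1) jump by (intro mult_neg_pos) auto
  finally show ?thesis by simp
qed

text \<open>
  The fundamental theorem of calculus of the library tolerates finitely many exceptional points only,
  while the weight \<open>x\<close> may jump countably often.
\<close>

lemma integral_eq_diff_if_quadratic_error:
  fixes g \<phi> :: "real \<Rightarrow> 'a::banach"
  assumes "a \<le> b" and int: "\<phi> integrable_on {a..b}"
    and err: "\<And>s t. a \<le> s \<Longrightarrow> s \<le> t \<Longrightarrow> t \<le> b \<Longrightarrow>
      norm (g t - g s - integral {s..t} \<phi>) \<le> C * (t - s)\<^sup>2"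
  shows "integral {a..b} \<phi> = g b - g a"
proof -
  \<comment> \<open>Neither \<open>g\<close> nor the indefinite integral of \<phi> need have a
    derivative everywhere, but the irregularities cancel in the difference, whose derivative is 0 at
    every point.\<close>
  define D where "D t = g t - integral {a..t} \<phi>" for t
  have diff: "norm (D t - D s) \<le> C * (t - s)\<^sup>2" if "s \<in> {a..b}" "t \<in> {a..b}" for s t
  proof -
    have *: "norm (D t - D s) \<le> C * (t - s)\<^sup>2" if "a \<le> s" "s \<le> t" "t \<le> b" for s t
    proof -
      have "integral {a..s} \<phi> + integral {s..t} \<phi> = integral {a..t} \<phi>"
        by (intro Henstock_Kurzweil_Integration.integral_combine) (use that integrable_subinterval_real[OF int, of a t] in auto)
      then have "D t - D s = g t - g s - integral {s..t} \<phi>"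
        by (simp add: D_def algebra_simps)
      then show ?thesis using err[OF that] by simp
    qed
    show ?thesis
      using *[of s t] *[of t s] that by (cases "s \<le> t") (auto simp: norm_minus_commute power2_commute)
  qed
  have "(D has_vector_derivative 0) (at t within {a..b})" if t: "t \<in> {a..b}" for t
    unfolding has_vector_derivative_def has_derivative_within
  proof (intro conjI)
    have lim: "((\<lambda>s. \<bar>C\<bar> * \<bar>s - t\<bar>) \<longlongrightarrow> 0) (at t within {a..b})"
      by (auto intro!: tendsto_eq_intros)
    show "((\<lambda>y. (1 / norm (y - t)) *\<^sub>R (D y - (D t + (y - t) *\<^sub>R 0))) \<longlongrightarrow> 0) (at t within {a..b})"
    proof (rule Lim_null_comparison[OF _ lim])
      have "norm ((1 / norm (y - t)) *\<^sub>R (D y - (D t + (y - t) *\<^sub>R 0))) \<le> \<bar>C\<bar> * \<bar>y - t\<bar>"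
        if y: "y \<in> {a..b}" "y \<noteq> t" for y
      proof -
        have "norm (D y - D t) \<le> C * (y - t)\<^sup>2" by (rule diff[OF t y(1)])
        also have "\<dots> \<le> \<bar>C\<bar> * \<bar>y - t\<bar> * \<bar>y - t\<bar>"
          by (simp add: power2_eq_square mult.assoc mult_right_mono)
        finally have "norm (D y - D t) / \<bar>y - t\<bar> \<le> \<bar>C\<bar> * \<bar>y - t\<bar>"
          using y(2) by (simp add: pos_divide_le_eq)
        then show ?thesis by simp
      qed
      then show "\<forall>\<^sub>F y in at t within {a..b}.
          norm ((1 / norm (y - t)) *\<^sub>R (D y - (D t + (y - t) *\<^sub>R 0))) \<le> \<bar>C\<bar> * \<bar>y - t\<bar>"
        by (auto simp: eventually_at_filter)
    qed
  qed (simp add: bounded_linear_scaleR_left)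
  then have "((\<lambda>_. 0) has_integral (D b - D a)) {a..b}"
    by (intro fundamental_theorem_of_calculus \<open>a \<le> b\<close>)
  then have "D b = D a" using has_integral_0 has_integral_unique by (metis eq_iff_diff_eq_0)
  then show ?thesis by (simp add: D_def algebra_simps)
qed

lemma norm_integral_le_const:
  fixes f :: "real \<Rightarrow> 'a::euclidean_space"
  assumes "s \<le> t" "f integrable_on {s..t}" "\<And>u. u \<in> {s..t} \<Longrightarrow> norm (f u) \<le> B"
  shows "norm (integral {s..t} f) \<le> B * (t - s)"
  using integral_norm_bound_integral[OF assms(2) integrable_const_ivl[of B] assms(3)] assms(1)
  by (simp add: mult.commute)

lemma integral_by_parts_bilinear:
  fixes B :: "'a::euclidean_space \<Rightarrow> 'b::euclidean_space \<Rightarrow> 'c::euclidean_space"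
    and g \<phi> :: "real \<Rightarrow> 'a" and G \<gamma> :: "real \<Rightarrow> 'b"
  assumes B: "bounded_bilinear B" and "0 \<le> T"
    and \<phi>: "\<phi> integrable_on {0..T}" and \<phi>_bound: "\<And>t. t \<in> {0..T} \<Longrightarrow> norm (\<phi> t) \<le> M"
    and g: "\<And>s t. 0 \<le> s \<Longrightarrow> s \<le> t \<Longrightarrow> t \<le> T \<Longrightarrow> integral {s..t} \<phi> = g t - g s"
    and G: "\<And>t. t \<in> {0..T} \<Longrightarrow> (G has_vector_derivative \<gamma> t) (at t within {0..T})"
    and \<gamma>: "continuous_on {0..T} \<gamma>"
    and int1: "(\<lambda>t. B (\<phi> t) (G t)) integrable_on {0..T}"
  shows "integral {0..T} (\<lambda>t. B (\<phi> t) (G t) + B (g t) (\<gamma> t)) = B (g T) (G T) - B (g 0) (G 0)"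
proof -
  interpret bounded_bilinear B by fact
  obtain K where K: "0 < K" "\<And>a b. norm (B a b) \<le> norm a * norm b * K"
    using pos_bounded by blast
  have "bounded (\<gamma> ` {0..T})"
    by (intro compact_imp_bounded compact_continuous_image \<gamma>) simp
  then obtain L where L: "\<And>t. t \<in> {0..T} \<Longrightarrow> norm (\<gamma> t) \<le> L"
    unfolding bounded_iff by blast
  have M0: "0 \<le> M" using \<phi>_bound[of 0] \<open>0 \<le> T\<close> order_trans[OF norm_ge_zero] by simp
  have L0: "0 \<le> L" using L[of 0] \<open>0 \<le> T\<close> order_trans[OF norm_ge_zero] by simp
  have G_int: "(\<gamma> has_integral (G t - G s)) {s..t}" if "0 \<le> s" "s \<le> t" "t \<le> T" for s t
    using that by (intro fundamental_theorem_of_calculus)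
      (auto intro: has_vector_derivative_within_subset[OF G])
  have G_lip: "norm (G t - G s) \<le> L * (t - s)" if "0 \<le> s" "s \<le> t" "t \<le> T" for s t
    using norm_integral_le_const[of s t \<gamma> L] G_int[OF that] L that by (auto simp: has_integral_iff)
  have \<phi>_sub: "\<phi> integrable_on {s..t}" if "0 \<le> s" "t \<le> T" for s t
    by (rule integrable_subinterval_real[OF \<phi>]) (use that in auto)
  have g_lip: "norm (g t - g s) \<le> M * (t - s)" if "0 \<le> s" "s \<le> t" "t \<le> T" for s t
    using norm_integral_le_const[of s t \<phi> M] g[OF that] \<phi>_sub \<phi>_bound that by auto
  have "M-lipschitz_on {0..T} g"
    by (rule lipschitz_on_leI) (use g_lip M0 in \<open>auto simp: dist_norm norm_minus_commute\<close>)
  then have g_cont: "continuous_on {0..T} g" by (rule lipschitz_on_continuous_on)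
  have int2: "(\<lambda>t. B (g t) (\<gamma> t)) integrable_on {0..T}"
    by (intro integrable_continuous_real continuous_on g_cont \<gamma>)
  show ?thesis
  proof (rule integral_eq_diff_if_quadratic_error[where C = "2 * (M * L * K)", OF \<open>0 \<le> T\<close> integrable_add[OF int1 int2]])
    fix s t assume st: "0 \<le> s" "s \<le> t" "t \<le> T"
    have i1: "(\<lambda>u. B (\<phi> u) (G u)) integrable_on {s..t}"
      by (rule integrable_subinterval_real[OF int1]) (use st in auto)
    have i2: "(\<lambda>u. B (g u) (\<gamma> u)) integrable_on {s..t}"
      by (rule integrable_subinterval_real[OF int2]) (use st in auto)
    have i3: "((\<lambda>u. B (\<phi> u) (G t)) has_integral B (g t - g s) (G t)) {s..t}"
      using has_integral_linear[OF integrable_integral[OF \<phi>_sub[OF st(1,3)]] bounded_linear_left[of "G t"]]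
        g[OF st] by (simp add: o_def)
    have i4: "((\<lambda>u. B (g s) (\<gamma> u)) has_integral B (g s) (G t - G s)) {s..t}"
      using has_integral_linear[OF G_int[OF st] bounded_linear_right[of "g s"]] by (simp add: o_def)
    have e1: "((\<lambda>u. B (\<phi> u) (G t - G u)) has_integral
        (B (g t - g s) (G t) - integral {s..t} (\<lambda>u. B (\<phi> u) (G u)))) {s..t}"
      using has_integral_diff[OF i3 integrable_integral[OF i1]] by (simp add: diff_right)
    have e2: "((\<lambda>u. B (g s - g u) (\<gamma> u)) has_integral
        (B (g s) (G t - G s) - integral {s..t} (\<lambda>u. B (g u) (\<gamma> u)))) {s..t}"
      using has_integral_diff[OF i4 integrable_integral[OF i2]] by (simp add: diff_left)
    have n1: "norm (B (g t - g s) (G t) - integral {s..t} (\<lambda>u. B (\<phi> u) (G u))) \<le> (M * L * K * (t - s)) * (t - s)"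
    proof -
      have "norm (B (\<phi> u) (G t - G u)) \<le> M * L * K * (t - s)" if u: "u \<in> {s..t}" for u
      proof -
        have "norm (G t - G u) \<le> L * (t - s)"
          using G_lip[of u t] u st mult_left_mono[OF _ L0, of "t - u" "t - s"] by auto
        then have "norm (\<phi> u) * norm (G t - G u) \<le> M * (L * (t - s))"
          using \<phi>_bound[of u] u st M0 by (intro mult_mono) auto
        then show ?thesis
          using K(2)[of "\<phi> u" "G t - G u"] K(1)
            mult_right_mono[of "norm (\<phi> u) * norm (G t - G u)" "M * (L * (t - s))" K]
          by (auto simp: mult_ac intro: order_trans)
      qed
      from norm_integral_le_const[OF st(2) has_integral_integrable[OF e1] this]
      show ?thesis using integral_unique[OF e1] by simp
    qed
    have n2: "norm (B (g s) (G t - G s) - integral {s..t} (\<lambda>u. B (g u) (\<gamma> u))) \<le> (M * L * K * (t - s)) * (t - s)"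
    proof -
      have "norm (B (g s - g u) (\<gamma> u)) \<le> M * L * K * (t - s)" if u: "u \<in> {s..t}" for u
      proof -
        have "norm (g s - g u) \<le> M * (t - s)"
          using g_lip[of s u] u st mult_left_mono[OF _ M0, of "u - s" "t - s"]
          by (auto simp: norm_minus_commute)
        then have "norm (g s - g u) * norm (\<gamma> u) \<le> M * (t - s) * L"
          using L[of u] u st M0 by (intro mult_mono) auto
        then show ?thesis
          using K(2)[of "g s - g u" "\<gamma> u"] K(1)
            mult_right_mono[of "norm (g s - g u) * norm (\<gamma> u)" "M * (t - s) * L" K]
          by (auto simp: mult_ac intro: order_trans)
      qed
      from norm_integral_le_const[OF st(2) has_integral_integrable[OF e2] this]
      show ?thesis using integral_unique[OF e2] by simp
    qed
    have "B (g t) (G t) - B (g s) (G s) - integral {s..t} (\<lambda>u. B (\<phi> u) (G u) + B (g u) (\<gamma> u)) =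
        (B (g t - g s) (G t) - integral {s..t} (\<lambda>u. B (\<phi> u) (G u))) +
        (B (g s) (G t - G s) - integral {s..t} (\<lambda>u. B (g u) (\<gamma> u)))"
      by (simp add: integral_add[OF i1 i2] diff_left diff_right)
    also have "norm \<dots> \<le> (M * L * K * (t - s)) * (t - s) + (M * L * K * (t - s)) * (t - s)"
      using n1 n2 by (rule norm_triangle_le[OF add_mono])
    also have "\<dots> = 2 * (M * L * K) * (t - s)\<^sup>2" by (simp add: power2_eq_square algebra_simps)
    finally show "norm (B (g t) (G t) - B (g s) (G s) -
        integral {s..t} (\<lambda>u. B (\<phi> u) (G u) + B (g u) (\<gamma> u))) \<le> 2 * (M * L * K) * (t - s)\<^sup>2" .
  qed
qed

lemma mono_on_times_continuous_absolutely_integrable: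
  fixes x :: "real \<Rightarrow> real" and f :: "real \<Rightarrow> 'a::euclidean_space"
  assumes x: "mono_on {a..b} x" and f: "continuous_on {a..b} f"
  shows "(\<lambda>t. x t *\<^sub>R f t) absolutely_integrable_on {a..b}"
proof (rule absolutely_integrable_bounded_measurable_product[where h = "(*\<^sub>R)" and f = x and g = f])
  show "bilinear ((*\<^sub>R) :: real \<Rightarrow> 'a \<Rightarrow> 'a)"
    using bilinear_conv_bounded_bilinear bounded_bilinear_scaleR by blast
  show "x \<in> borel_measurable (lebesgue_on {a..b})"
    using integrable_mono_on[OF x] by (rule borel_measurable_integrable)
  have "x ` {a..b} \<subseteq> {x a..x b}" using x by (auto simp: mono_on_def)
  then show "bounded (x ` {a..b})" using bounded_closed_interval bounded_subset by blast
  show "f absolutely_integrable_on {a..b}"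
    using f by (rule absolutely_integrable_continuous_real)
qed auto

lemma mono_on_times_continuous_integrable:
  fixes x :: "real \<Rightarrow> real" and f :: "real \<Rightarrow> 'a::euclidean_space"
  assumes "mono_on {a..b} x" "continuous_on {a..b} f"
  shows "(\<lambda>t. x t *\<^sub>R f t) integrable_on {a..b}"
  using mono_on_times_continuous_absolutely_integrable[OF assms]
  by (rule absolutely_integrable_on_def[THEN iffD1, THEN conjunct1])

text \<open>The weight may jump, so the integrand is not jointly continuous. Since \<open>x\<close>
  is bounded by 1, uniform closeness of \<open>f e\<close> to \<open>f e0\<close> on the compact
  interval is enough.\<close>

lemma mono_weighted_integral_continuous_on_param:
  fixes x :: "real \<Rightarrow> real" and f :: "real \<Rightarrow> real \<Rightarrow> real"
  assumes x: "mono_on {a..b} x" and x01: "x ` {a..b} \<subseteq> {0..1}" and "a \<le> b"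
    and f: "continuous_on (U \<times> {a..b}) (\<lambda>(e, t). f e t)"
  shows "continuous_on U (\<lambda>e. integral {a..b} (\<lambda>t. x t * f e t))"
  unfolding continuous_on_iff
proof (intro ballI allI impI)
  fix e0 \<delta> :: real assume "e0 \<in> U" "0 < \<delta>"
  \<comment> \<open>The summand 1 makes the final estimate strict and covers the case a = b.\<close>
  define \<delta>' where "\<delta>' = \<delta> / (b - a + 1)"
  have "0 < \<delta>'" using \<open>0 < \<delta>\<close> \<open>a \<le> b\<close> by (simp add: \<delta>'_def)
  obtain X where X: "e0 \<in> X" "open X"
    "\<And>e t. e \<in> X \<inter> U \<Longrightarrow> t \<in> {a..b} \<Longrightarrow> \<bar>f e t - f e0 t\<bar> \<le> \<delta>'"
    using continuous_on_prod_compactE[OF f compact_Icc \<open>e0 \<in> U\<close> \<open>0 < \<delta>'\<close>]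
    unfolding dist_norm by (metis case_prod_conv real_norm_def)
  obtain r where r: "0 < r" "ball e0 r \<subseteq> X" using X(1,2) openE by blast
  have int: "(\<lambda>t. x t * f e t) integrable_on {a..b}" if "e \<in> U" for e
  proof -
    have "continuous_on {a..b} (\<lambda>t. (\<lambda>(e, t). f e t) (e, t))"
      by (rule continuous_on_compose2[OF f]) (use that in \<open>auto intro!: continuous_intros\<close>)
    then show ?thesis using mono_on_times_continuous_integrable[OF x, of "f e"] by simp
  qed
  have "dist (integral {a..b} (\<lambda>t. x t * f e t)) (integral {a..b} (\<lambda>t. x t * f e0 t)) < \<delta>"
    if "e \<in> U" "dist e e0 < r" for e
  proof -
    have "e \<in> X \<inter> U" using that r by (auto simp: dist_commute)
    have "norm (integral {a..b} (\<lambda>t. x t * f e t - x t * f e0 t)) \<le> \<delta>' * (b - a)"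
    proof (rule norm_integral_le_const[OF \<open>a \<le> b\<close>])
      fix t assume t: "t \<in> {a..b}"
      have "\<bar>x t\<bar> * \<bar>f e t - f e0 t\<bar> \<le> 1 * \<delta>'"
        using image_subset_iff[THEN iffD1, OF x01] t X(3)[OF \<open>e \<in> X \<inter> U\<close> t]
        by (intro mult_mono) auto
      then show "norm (x t * f e t - x t * f e0 t) \<le> \<delta>'"
        by (simp add: abs_mult flip: right_diff_distrib)
    qed (intro integrable_diff int that \<open>e0 \<in> U\<close>)
    also have "\<dots> < \<delta>" using \<open>0 < \<delta>\<close> \<open>a \<le> b\<close> by (simp add: \<delta>'_def field_simps)
    finally show ?thesis
      by (simp add: dist_norm integral_diff[OF int[OF that(1)] int[OF \<open>e0 \<in> U\<close>]])
  qed
  then show "\<exists>d>0. \<forall>e\<in>U. dist e e0 < d \<longrightarrow>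
      dist (integral {a..b} (\<lambda>t. x t * f e t)) (integral {a..b} (\<lambda>t. x t * f e0 t)) < \<delta>"
    using r(1) by blast
qed

lemma integral_reparametrize:
  fixes f :: "real \<Rightarrow> 'a::euclidean_space" and R :: "real \<Rightarrow> real"
  assumes "a \<le> b"
    and R: "\<And>t. t \<in> {a..b} \<Longrightarrow> (R has_real_derivative R' t) (at t within {a..b})"
    and pos: "\<And>t. t \<in> {a..b} \<Longrightarrow> 0 \<le> R' t"
    and inj: "inj_on R {a..b}" and img: "R ` {a..b} = {c..d}"
    and f: "f absolutely_integrable_on {c..d}"
  shows "integral {a..b} (\<lambda>t. R' t *\<^sub>R f (R t)) = integral {c..d} f"
proof -
  have "integral {a..b} (\<lambda>t. \<bar>R' t\<bar> *\<^sub>R f (R t)) = integral {c..d} f"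
    using has_absolute_integral_change_of_variables_real[OF _ R inj, of f "integral {c..d} f"] f img
    by auto
  also have "integral {a..b} (\<lambda>t. \<bar>R' t\<bar> *\<^sub>R f (R t)) = integral {a..b} (\<lambda>t. R' t *\<^sub>R f (R t))"
    by (rule integral_cong) (use pos in auto)
  finally show ?thesis .
qed

subsection \<open>Symmetric matrices\<close>

lemma trace_prod_sum: "trace_prod A B = (\<Sum>i\<in>UNIV. \<Sum>j\<in>UNIV. A $ i $ j * B $ j $ i)"
  by (simp add: trace_prod_def trace_def matrix_matrix_mult_def)

lemma bounded_bilinear_trace_prod:
  "bounded_bilinear (trace_prod :: real^'n^'n \<Rightarrow> real^'n^'n \<Rightarrow> real)"
proof -
  have "bilinear (trace_prod :: real^'n^'n \<Rightarrow> real^'n^'n \<Rightarrow> real)"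
    by (auto simp: bilinear_def trace_prod_sum algebra_simps sum.distrib sum_distrib_left
        intro!: linearI)
  then show ?thesis by (simp add: bilinear_conv_bounded_bilinear)
qed

lemma bounded_bilinear_matrix_mult:
  "bounded_bilinear ((**) :: real^'n^'n \<Rightarrow> real^'n^'n \<Rightarrow> real^'n^'n)"
proof -
  have "bilinear ((**) :: real^'n^'n \<Rightarrow> real^'n^'n \<Rightarrow> real^'n^'n)"
    by (auto simp: bilinear_def matrix_matrix_mult_def vec_eq_iff algebra_simps sum.distrib
        sum_distrib_left intro!: linearI)
  then show ?thesis by (simp add: bilinear_conv_bounded_bilinear)
qed

lemmas continuous_on_matrix_mult [continuous_intros] =
  bounded_bilinear.continuous_on[OF bounded_bilinear_matrix_mult]

lemmas continuous_on_trace_prod [continuous_intros] =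
  bounded_bilinear.continuous_on[OF bounded_bilinear_trace_prod]

lemma trace_prod_commute: "trace_prod A B = trace_prod B (A :: real^'n^'n)"
  unfolding trace_prod_def by (rule trace_mul_sym)

lemma trace_prod_assoc: "trace_prod (A ** B) C = trace_prod A (B ** (C :: real^'n^'n))"
  by (simp add: trace_prod_def matrix_mul_assoc)

lemma trace_prod_rotate: "trace_prod (A ** B) C = trace_prod B (C ** (A :: real^'n^'n))"
  by (metis trace_prod_assoc trace_prod_commute)

lemma bounded_linear_trace: "bounded_linear (trace :: real^'n^'n \<Rightarrow> real)"
  by (intro linear_conv_bounded_linear[THEN iffD1] linearI)
     (simp_all add: trace_def sum.distrib sum_distrib_left)

lemma inner_matrix_vector_sum:
  "v \<bullet> (A *v v) = (\<Sum>i\<in>UNIV. \<Sum>j\<in>UNIV. v $ i * v $ j * (A :: real^'n^'n) $ i $ j)"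
  by (simp add: inner_vec_def matrix_vector_mult_def sum_distrib_left mult_ac)

lemma trace_prod_outer: "trace_prod (outer h h) A = h \<bullet> (A *v (h :: real^'n))"
proof -
  have "trace_prod (outer h h) A = (\<Sum>i\<in>UNIV. \<Sum>j\<in>UNIV. h $ i * h $ j * A $ j $ i)"
    by (simp add: trace_prod_sum outer_def)
  also have "\<dots> = h \<bullet> (A *v h)"
    unfolding inner_matrix_vector_sum by (subst sum.swap) (simp add: mult_ac)
  finally show ?thesis .
qed

lemma bounded_linear_quadratic_form: "bounded_linear (\<lambda>A :: real^'n^'n. v \<bullet> (A *v v))"
  by (intro linear_conv_bounded_linear[THEN iffD1] linearI)
     (simp_all add: matrix_vector_mult_add_rdistrib inner_add_right scaleR_matrix_vector_assoc[symmetric])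

lemma bounded_linear_transpose: "bounded_linear (transpose :: real^'n^'n \<Rightarrow> real^'n^'n)"
  by (intro linear_conv_bounded_linear[THEN iffD1] linearI)
     (simp_all add: transpose_def vec_eq_iff)

lemma psd_quadratic_form: "psd A \<Longrightarrow> 0 \<le> v \<bullet> (A *v v)"
  by (simp add: psd_def)

lemma psd_add: "psd A \<Longrightarrow> psd B \<Longrightarrow> psd (A + B)"
  by (simp add: psd_def linear_add[OF bounded_linear.linear[OF bounded_linear_transpose]]
      linear_add[OF bounded_linear.linear[OF bounded_linear_quadratic_form]])

lemma psd_scaleR: "psd A \<Longrightarrow> 0 \<le> r \<Longrightarrow> psd (r *\<^sub>R A)"
  by (simp add: psd_def linear_cmul[OF bounded_linear.linear[OF bounded_linear_transpose]]
      linear_cmul[OF bounded_linear.linear[OF bounded_linear_quadratic_form]])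

lemma psd_integral:
  fixes f :: "real \<Rightarrow> real^'n^'n"
  assumes f: "f integrable_on S" and psd: "\<And>t. t \<in> S \<Longrightarrow> psd (f t)"
  shows "psd (integral S f)"
  unfolding psd_def
proof (intro conjI allI)
  have "transpose (integral S f) = integral S (\<lambda>t. transpose (f t))"
    using integral_linear[OF f bounded_linear_transpose] by (simp add: o_def)
  also have "\<dots> = integral S f"
    by (rule integral_cong) (use psd in \<open>auto simp: psd_def\<close>)
  finally show "transpose (integral S f) = integral S f" .
  fix v
  have "integral S (\<lambda>t. v \<bullet> (f t *v v)) = v \<bullet> (integral S f *v v)"
    using integral_linear[OF f bounded_linear_quadratic_form] by (simp add: o_def)
  moreover have "0 \<le> integral S (\<lambda>t. v \<bullet> (f t *v v))"
    using integrable_linear[OF f bounded_linear_quadratic_form[of v]] psd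
    by (intro integral_nonneg) (auto simp: o_def psd_def)
  ultimately show "0 \<le> v \<bullet> (integral S f *v v)" by simp
qed

text \<open>Evaluate the form at the sum and at the difference of two basis vectors. The bound keeps
  the entries of the path inside [-1, 1], where the power series of \<xi>' is evaluated.\<close>

lemma psd_entry_bound:
  fixes A :: "real^'n^'n"
  assumes "psd A"
  shows "\<bar>A $ i $ j\<bar> \<le> (A $ i $ i + A $ j $ j) / 2"
proof -
  have sym: "A $ j $ i = A $ i $ j"
    using arg_cong[of _ _ "\<lambda>M. M $ i $ j", OF conjunct1[OF assms[unfolded psd_def]]]
    by (simp add: transpose_def)
  have *: "axis a 1 \<bullet> (A *v axis b 1) = A $ a $ b" for a b
    by (simp add: inner_axis' matrix_vector_mul_component column_def matrix_vector_mult_basis)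
  have "0 \<le> (axis i 1 + s *\<^sub>R axis j 1) \<bullet> (A *v (axis i 1 + s *\<^sub>R axis j 1))" for s
    using assms by (rule psd_quadratic_form)
  then have "0 \<le> A $ i $ i + s * (A $ i $ j + A $ j $ i) + s * s * A $ j $ j" for s
    by (simp add: matrix_vector_right_distrib inner_add_left inner_add_right * algebra_simps)
  from this[of 1] this[of "-1"] show ?thesis using sym by auto
qed

lemma det_nonzero_imp_inverse:
  fixes A :: "real^'n^'n"
  assumes "det A \<noteq> 0"
  shows "A ** matrix_inv A = mat 1" "matrix_inv A ** A = mat 1"
proof -
  have "\<exists>A'. A ** A' = mat 1 \<and> A' ** A = mat 1"
    using assms by (metis invertible_def invertible_det_nz)
  then have "A ** matrix_inv A = mat 1 \<and> matrix_inv A ** A = mat 1"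
    unfolding matrix_inv_def by (rule someI_ex)
  then show "A ** matrix_inv A = mat 1" "matrix_inv A ** A = mat 1" by auto
qed

text \<open>The resolvent identity. It is exact, which replaces the derivative of the inverse both
  in time and in the perturbation parameter.\<close>

lemma matrix_inv_diff:
  fixes A B :: "real^'n^'n"
  assumes "det A \<noteq> 0" "det B \<noteq> 0"
  shows "matrix_inv B - matrix_inv A = - (matrix_inv B ** (B - A) ** matrix_inv A)"
  using det_nonzero_imp_inverse[OF assms(1)] det_nonzero_imp_inverse[OF assms(2)]
  by (simp add: bounded_bilinear.diff_left[OF bounded_bilinear_matrix_mult]
      bounded_bilinear.diff_right[OF bounded_bilinear_matrix_mult] matrix_mul_assoc[symmetric])

lemma continuous_on_det [continuous_intros]:
  fixes M :: "'a::topological_space \<Rightarrow> real^'n^'n"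
  assumes "continuous_on S M"
  shows "continuous_on S (\<lambda>z. det (M z))"
  unfolding det_def by (intro continuous_intros assms)

text \<open>Quotients of determinants make the continuity of the inverse immediate.\<close>

lemma matrix_inv_cramer:
  fixes A :: "real^'n^'n"
  assumes "det A \<noteq> 0"
  shows "matrix_inv A = (\<chi> i k. det (\<chi> a b. if b = i then axis k 1 $ a else A $ a $ b) / det A)"
proof -
  have "A *v column k (matrix_inv A) = axis k 1" for k
  proof -
    have "A *v column k (matrix_inv A) = (A ** matrix_inv A) *v axis k 1"
      unfolding matrix_vector_mul_assoc[symmetric] by (simp only: matrix_vector_mult_basis)
    then show ?thesis by (simp add: det_nonzero_imp_inverse(1)[OF assms])
  qed
  then have "column k (matrix_inv A) =
      (\<chi> i. det (\<chi> a b. if b = i then axis k 1 $ a else A $ a $ b) / det A)" for k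
    using cramer[OF assms, THEN iffD1] by blast
  then show ?thesis by (simp add: vec_eq_iff column_def)
qed

lemma continuous_on_matrix_inv:
  fixes M :: "'a::topological_space \<Rightarrow> real^'n^'n"
  assumes M: "continuous_on S M" and det: "\<And>z. z \<in> S \<Longrightarrow> det (M z) \<noteq> 0"
  shows "continuous_on S (\<lambda>z. matrix_inv (M z))"
proof -
  have entry: "continuous_on S (\<lambda>z. if b = i then axis k 1 $ a else M z $ a $ b)" for a b i k
    by (cases "b = i") (auto intro!: continuous_intros M)
  have "continuous_on S (\<lambda>z. \<chi> i k. det (\<chi> a b. if b = i then axis k 1 $ a else M z $ a $ b) / det (M z))"
    by (intro continuous_on_vec_lambda continuous_on_divide continuous_on_det entry M ballI det)
  then show ?thesis
    by (rule continuous_on_eq) (simp add: matrix_inv_cramer[OF det])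
qed

text \<open>If \<open>A *v v\<close> were nonzero, a small step from \<open>v\<close> in the
  direction of \<open>- (A *v v)\<close> would make the form negative: the first-order term is
  negative, and the other one is of second order.\<close>

lemma psd_form_zero_imp_kernel:
  fixes A :: "real^'n^'n"
  assumes A: "psd A" and v: "v \<bullet> (A *v v) = 0"
  shows "A *v v = 0"
proof (rule ccontr)
  assume nz: "A *v v \<noteq> 0"
  define w where "w = A *v v"
  define c where "c = w \<bullet> (A *v w)"
  have c: "0 \<le> c" using A by (simp add: c_def psd_def)
  have w: "0 < w \<bullet> w" using nz by (simp add: w_def)
  have "v \<bullet> (A *v w) = w \<bullet> w"
    using dot_lmul_matrix[of v A w] transpose_matrix_vector[of A v] A
    by (metis psd_def w_def)
  then have expand: "(v - r *\<^sub>R w) \<bullet> (A *v (v - r *\<^sub>R w)) = r * r * c - 2 * r * (w \<bullet> w)" for r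
    using v by (simp add: matrix_vector_mult_diff_distrib inner_diff_left inner_diff_right
        c_def w_def[symmetric] algebra_simps)
  \<comment> \<open>The minimum of the quadratic polynomial in \<open>r\<close> is at (w \<bullet>
    w) / c; the summand 1 avoids division by zero and still gives r * c \<le> w \<bullet> w.\<close>
  define r where "r = (w \<bullet> w) / (c + 1)"
  have r: "0 < r" using w c by (simp add: r_def)
  have "0 \<le> r * (r * c - 2 * (w \<bullet> w))"
    using psd_quadratic_form[OF A, of "v - r *\<^sub>R w"] unfolding expand by (simp add: algebra_simps)
  then have "2 * (w \<bullet> w) \<le> r * c" using r by (simp add: zero_le_mult_iff)
  also have "r * c \<le> w \<bullet> w" using c w by (simp add: r_def field_simps)
  finally show False using w by simp
qed

text \<open>A kernel vector of \<open>B\<close> makes the two nonnegative forms of \<open>A\<close>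
  and \<open>B - A\<close> sum to 0, so it lies in the kernel of \<open>A\<close>.\<close>

lemma det_nonzero_if_ge_psd:
  fixes A B :: "real^'n^'n"
  assumes A: "psd A" "det A \<noteq> 0" and BA: "psd (B - A)"
  shows "det B \<noteq> 0"
proof -
  have "v = 0" if "B *v v = 0" for v
  proof -
    have "v \<bullet> (A *v v) + v \<bullet> ((B - A) *v v) = 0"
      using that by (simp add: matrix_vector_mult_diff_rdistrib inner_diff_right)
    then have "v \<bullet> (A *v v) = 0"
      using psd_quadratic_form[OF A(1), of v] psd_quadratic_form[OF BA, of v] by linarith
    then have "A *v v = 0" by (rule psd_form_zero_imp_kernel[OF A(1)])
    then have "matrix_inv A *v (A *v v) = 0" by simp
    then show ?thesis
      by (simp add: matrix_vector_mul_assoc det_nonzero_imp_inverse[OF A(2)])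
  qed
  then show ?thesis
    by (metis invertible_det_nz invertible_left_inverse matrix_left_invertible_ker)
qed

subsection \<open>The series of the covariance function\<close>

lemma has_sum_vec:
  fixes f :: "'a \<Rightarrow> ('b::real_normed_vector)^'n"
  assumes "\<And>i. ((\<lambda>p. f p $ i) has_sum (M $ i)) A"
  shows "(f has_sum M) A"
  unfolding has_sum_def
  by (rule vec_tendstoI) (use assms in \<open>simp add: has_sum_def\<close>)

text \<open>Coefficients of an entry of \<xi>' as a power series in the corresponding entry of the
  argument, indexed by the exponent n = p - 1. The exponent 0 would belong to p = 1, which is not in
  the sum.\<close>

definition xi_coeff :: "(nat \<Rightarrow> real^'n) \<Rightarrow> 'n \<Rightarrow> 'n \<Rightarrow> nat \<Rightarrow> real" where
  "xi_coeff \<beta> i j n = (if n = 0 then 0 else real (Suc n) * (\<beta> (Suc n) $ i * \<beta> (Suc n) $ j))"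

text \<open>The hypothesis bounds the product of two entries of \<open>\<beta> p\<close> by a
  constant times 2^-p, so the radius of convergence is at least 2. Evaluating at 3/2 puts the closed
  interval [-1, 1] inside the disc of convergence, as differentiability at its ends requires. The
  factor p is absorbed by the differentiated geometric series of ratio 3/4.\<close>

lemma summable_xi_coeff:
  fixes \<beta> :: "nat \<Rightarrow> real^'n"
  assumes "\<And>j. (\<lambda>p. 2 ^ p * (\<beta> p $ j)\<^sup>2) summable_on {2..}"
  shows "summable (\<lambda>n. xi_coeff \<beta> i j n * (3/2) ^ n)"
proof -
  define C where "C j = infsum (\<lambda>p. 2 ^ p * (\<beta> p $ j)\<^sup>2) {2..}" for j
  have C: "2 ^ p * (\<beta> p $ j)\<^sup>2 \<le> C j" if "2 \<le> p" for p j
    using finite_sum_le_infsum[OF assms[of j], of "{p}"] that by (simp add: C_def)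
  have geo: "summable (\<lambda>n. (C i + C j) / 4 * (real (Suc n) * (3/4) ^ n))"
    using geometric_deriv_sums[of "3/4 :: real"] by (intro summable_mult) (auto simp: sums_iff)
  show ?thesis
  proof (rule summable_comparison_test'[OF geo, of 1])
    fix n :: nat assume "1 \<le> n"
    have "2 ^ Suc n * (2 * \<bar>\<beta> (Suc n) $ i * \<beta> (Suc n) $ j\<bar>)
        \<le> 2 ^ Suc n * ((\<beta> (Suc n) $ i)\<^sup>2 + (\<beta> (Suc n) $ j)\<^sup>2)"
      using sum_squares_bound[of "\<bar>\<beta> (Suc n) $ i\<bar>" "\<bar>\<beta> (Suc n) $ j\<bar>"]
      by (intro mult_left_mono) (auto simp: abs_mult)
    also have "\<dots> \<le> C i + C j"
      using C[of "Suc n" i] C[of "Suc n" j] \<open>1 \<le> n\<close> by (simp add: distrib_left)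
    finally have b: "4 * 2 ^ n * \<bar>\<beta> (Suc n) $ i * \<beta> (Suc n) $ j\<bar> \<le> C i + C j" by simp
    have "\<bar>\<beta> (Suc n) $ i * \<beta> (Suc n) $ j\<bar> * (3/2) ^ n
        = (4 * 2 ^ n * \<bar>\<beta> (Suc n) $ i * \<beta> (Suc n) $ j\<bar>) / 4 * (3/4) ^ n"
      by (simp add: power_divide field_simps flip: power_mult_distrib)
    also have "\<dots> \<le> (C i + C j) / 4 * (3/4) ^ n"
      using b by (intro mult_right_mono) auto
    finally have "real (Suc n) * (\<bar>\<beta> (Suc n) $ i * \<beta> (Suc n) $ j\<bar> * (3/2) ^ n)
        \<le> real (Suc n) * ((C i + C j) / 4 * (3/4) ^ n)"
      by (rule mult_left_mono) simp
    then show "norm (xi_coeff \<beta> i j n * (3/2) ^ n) \<le> (C i + C j) / 4 * (real (Suc n) * (3/4) ^ n)"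
      using \<open>1 \<le> n\<close> by (simp add: xi_coeff_def abs_mult mult_ac)
  qed
qed

text \<open>\<open>infsum\<close> takes the default value 0 on families that are not summable, so
  convergence has to be shown together with the value. This is done entry by entry, after the shift
  p = n + 1.\<close>

lemma xi_deriv_component:
  fixes \<beta> :: "nat \<Rightarrow> real^'n" and A :: "real^'n^'n"
  assumes "\<And>j. (\<lambda>p. 2 ^ p * (\<beta> p $ j)\<^sup>2) summable_on {2..}" and A: "\<And>i j. \<bar>A $ i $ j\<bar> \<le> 1"
  shows "xi_deriv \<beta> A $ i $ j = (\<Sum>n. xi_coeff \<beta> i j n * (A $ i $ j) ^ n)"
proof -
  let ?f = "\<lambda>p. real p *\<^sub>R (outer (\<beta> p) (\<beta> p) * A ^ (p - 1))"
  let ?s = "\<lambda>i j. \<Sum>n. xi_coeff \<beta> i j n * (A $ i $ j) ^ n"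
  have "((\<lambda>p. ?f p $ i $ j) has_sum ?s i j) {2..}" for i j
  proof -
    have s: "summable (\<lambda>n. norm (xi_coeff \<beta> i j n * (A $ i $ j) ^ n))"
      by (rule powser_insidea[OF summable_xi_coeff[OF assms(1)]]) (use A[of i j] in simp)
    have U: "((\<lambda>n. xi_coeff \<beta> i j n * (A $ i $ j) ^ n) has_sum ?s i j) UNIV"
      by (rule norm_summable_imp_has_sum[OF s summable_sums[OF summable_norm_cancel[OF s]]])
    have "((\<lambda>n. xi_coeff \<beta> i j n * (A $ i $ j) ^ n) has_sum ?s i j) {1..}"
      by (rule has_sum_cong_neutral[THEN iffD1, OF _ _ _ U]) (auto simp: xi_coeff_def not_le)
    moreover have "xi_coeff \<beta> i j n * (A $ i $ j) ^ n = ?f (Suc n) $ i $ j" if "n \<in> {1..}" for n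
      using that by (simp add: xi_coeff_def outer_def hadamard_power_component)
    ultimately have "((\<lambda>n. ?f (Suc n) $ i $ j) has_sum ?s i j) {1..}"
      using has_sum_cong[of "{1..}" "\<lambda>n. xi_coeff \<beta> i j n * (A $ i $ j) ^ n" "\<lambda>n. ?f (Suc n) $ i $ j"]
      by blast
    then have "((\<lambda>p. ?f p $ i $ j) has_sum ?s i j) (Suc ` {1..})"
      by (subst has_sum_reindex) (auto simp: o_def)
    moreover have "Suc ` {1..} = {2..}"
    proof (intro set_eqI iffI)
      show "p \<in> Suc ` {1..}" if "p \<in> {2..}" for p
        using that by (intro image_eqI[of _ _ "p - 1"]) auto
    qed auto
    ultimately show ?thesis by simp
  qed
  then have "(?f has_sum (\<chi> i j. ?s i j)) {2..}"
    by (intro has_sum_vec) simp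
  then have "xi_deriv \<beta> A = (\<chi> i j. ?s i j)"
    unfolding xi_deriv_def by (rule infsumI)
  then show ?thesis by simp
qed

lemma power_series_C1:
  fixes c :: "nat \<Rightarrow> real"
  assumes c: "summable (\<lambda>n. c n * (3/2) ^ n)" and u: "u \<in> {-1..1}"
  shows "((\<lambda>u. \<Sum>n. c n * u ^ n) has_real_derivative (\<Sum>n. diffs c n * u ^ n)) (at u)"
    and "isCont (\<lambda>u. \<Sum>n. diffs c n * u ^ n) u"
proof -
  show "((\<lambda>u. \<Sum>n. c n * u ^ n) has_real_derivative (\<Sum>n. diffs c n * u ^ n)) (at u)"
    by (rule termdiffs_strong[OF c]) (use u in auto)
  \<comment> \<open>Termwise differentiation is justified only inside the disc, so the point moves
    from 3/2 to 5/4, which still exceeds 1.\<close>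
  have "summable (\<lambda>n. diffs c n * (5/4) ^ n)"
    by (rule termdiff_converges[of _ "3/2"]) (auto intro: powser_inside[OF c])
  then show "isCont (\<lambda>u. \<Sum>n. diffs c n * u ^ n) u"
    by (rule isCont_powser) (use u in auto)
qed

text \<open>Hadamard's lemma: the divided difference is the average of the derivative over the
  segment, hence continuous across the diagonal. It lets e be factored out of \<xi>'(\<Psi> + e
  \<Delta>) - \<xi>'(\<Psi>) with a quotient that is continuous down to e = 0.\<close>

lemma divided_difference:
  fixes f f' :: "real \<Rightarrow> real"
  assumes f: "\<And>u. u \<in> {-1..1} \<Longrightarrow> (f has_real_derivative f' u) (at u)"
    and f': "\<And>u. u \<in> {-1..1} \<Longrightarrow> isCont f' u"
  obtains d where "continuous_on ({-1..1} \<times> {-1..1}) (\<lambda>(u, v). d u v)"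
    "\<And>u v. u \<in> {-1..1} \<Longrightarrow> v \<in> {-1..1} \<Longrightarrow> f v - f u = (v - u) * d u v"
    "\<And>u. d u u = f' u"
proof
  define d where "d u v = integral {0..1} (\<lambda>s. f' (u + s * (v - u)))" for u v
  have seg: "u + s * (v - u) \<in> {-1..1}" if "u \<in> {-1..1}" "v \<in> {-1..1}" "s \<in> {0..1}" for u v s :: real
    using convexD_alt[OF convex_real_interval(5)[of "-1" 1], of u v s] that
    by (simp add: algebra_simps)
  have cont: "continuous_on {-1..1} f'"
    using f' by (intro continuous_at_imp_continuous_on) auto
  have "continuous_on ({-1..1} \<times> {-1..1}) (\<lambda>z. integral (cbox 0 1) (\<lambda>s. f' (fst z + s * (snd z - fst z))))"
    by (rule integral_continuous_on_param)
       (auto simp: case_prod_unfold intro!: continuous_on_compose2[OF cont] continuous_intros seg)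
  then show "continuous_on ({-1..1} \<times> {-1..1}) (\<lambda>(u, v). d u v)"
    by (simp add: d_def case_prod_unfold)
  show "d u u = f' u" for u by (simp add: d_def)
  show "f v - f u = (v - u) * d u v" if uv: "u \<in> {-1..1}" "v \<in> {-1..1}" for u v
  proof -
    have "((\<lambda>s. (v - u) * f' (u + s * (v - u))) has_integral
        (f (u + 1 * (v - u)) - f (u + 0 * (v - u)))) {0..1}"
    proof (rule fundamental_theorem_of_calculus)
      fix s :: real assume s: "s \<in> {0..1}"
      have "((\<lambda>s. f (u + s * (v - u))) has_real_derivative f' (u + s * (v - u)) * (v - u)) (at s)"
        by (rule DERIV_chain2[where f = f and g = "\<lambda>s. u + s * (v - u)", OF f[OF seg[OF uv s]]]) (auto intro!: derivative_eq_intros)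
      then show "((\<lambda>s. f (u + s * (v - u))) has_vector_derivative (v - u) * f' (u + s * (v - u)))
          (at s within {0..1})"
        by (simp add: has_real_derivative_iff_has_vector_derivative mult.commute
            has_vector_derivative_at_within)
    qed simp
    then show ?thesis by (simp add: d_def has_integral_iff)
  qed
qed

subsection \<open>Order measures and changes of time\<close>

text \<open>Names the function inside \<open>order_measure\<close>. Its constant values outside the
  interval allow the support to be tested with neighbourhoods that stick out of it.\<close>

definition ext_cdf :: "real \<Rightarrow> (real \<Rightarrow> real) \<Rightarrow> real \<Rightarrow> real" where
  "ext_cdf T x t = (if t < 0 then 0 else if t \<le> T then x t else 1)"

lemma order_cdf_range:
  assumes "order_cdf T x" "0 \<le> t" "t \<le> T"
  shows "0 \<le> x t" "x t \<le> 1"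
  using assms by (auto simp: order_cdf_def Pi_iff)

lemma ext_cdf_mono:
  assumes "order_cdf T x" "a \<le> b"
  shows "ext_cdf T x a \<le> ext_cdf T x b"
  using assms order_cdf_range[OF assms(1), of a] order_cdf_range[OF assms(1), of b]
  by (auto simp: order_cdf_def ext_cdf_def mono_on_def)

lemma ext_cdf_right_continuous:
  assumes x: "order_cdf T x" and "0 \<le> T"
  shows "continuous (at_right a) (ext_cdf T x)"
proof -
  have "(ext_cdf T x \<longlongrightarrow> ext_cdf T x a) (at_right a)"
  proof (cases "0 \<le> a \<and> a < T")
    case True
    then have "(x \<longlongrightarrow> x a) (at_right a)"
      using x by (auto simp: order_cdf_def continuous_within)
    moreover have "\<forall>\<^sub>F s in at_right a. x s = ext_cdf T x s"
      using True by (auto simp: eventually_at_right_field ext_cdf_def intro!: exI[of _ T])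
    ultimately show ?thesis
      using True by (auto simp: ext_cdf_def intro: Lim_transform_eventually)
  next
    case False
    have "\<forall>\<^sub>F s in at_right a. ext_cdf T x s = ext_cdf T x a"
    proof (cases "a < 0")
      case True
      then show ?thesis
        by (auto simp: eventually_at_right_field ext_cdf_def intro!: exI[of _ 0])
    next
      case False
      then show ?thesis
        using \<open>\<not> (0 \<le> a \<and> a < T)\<close> x
        by (auto simp: eventually_at_right_field ext_cdf_def order_cdf_def intro!: exI[of _ "a + 1"])
    qed
    then show ?thesis by (rule tendsto_eventually)
  qed
  then show ?thesis by (simp add: continuous_within)
qed

lemma emeasure_order_measure_Ioc:
  assumes "order_cdf T x" "0 \<le> T" "a \<le> b"
  shows "emeasure (order_measure T x) {a<..b} = ennreal (ext_cdf T x b - ext_cdf T x a)"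
  using emeasure_interval_measure_Ioc_eq[of "ext_cdf T x" a b]
    ext_cdf_mono[OF assms(1)] ext_cdf_right_continuous[OF assms(1,2)] assms(3)
  by (simp add: order_measure_def ext_cdf_def[abs_def] fun_eq_iff)

text \<open>Replaces measures of open sets by strict increase of the distribution function, a
  property that is easy to carry through a change of time.\<close>

lemma msupport_order_measure_iff:
  assumes x: "order_cdf T x" "0 \<le> T"
  shows "p \<in> msupport (order_measure T x) \<longleftrightarrow>
    (\<forall>a b. a < p \<longrightarrow> p < b \<longrightarrow> ext_cdf T x a < ext_cdf T x b)"
proof
  assume p: "p \<in> msupport (order_measure T x)"
  show "\<forall>a b. a < p \<longrightarrow> p < b \<longrightarrow> ext_cdf T x a < ext_cdf T x b"
  proof (intro allI impI)
    fix a b assume ab: "a < p" "p < b"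
    have "0 < emeasure (order_measure T x) {a<..<b}"
      using p ab by (auto simp: msupport_def)
    also have "\<dots> \<le> emeasure (order_measure T x) {a<..b}"
      by (rule emeasure_mono) (auto simp: order_measure_def)
    finally show "ext_cdf T x a < ext_cdf T x b"
      using ab by (simp add: emeasure_order_measure_Ioc[OF x])
  qed
next
  assume incr: "\<forall>a b. a < p \<longrightarrow> p < b \<longrightarrow> ext_cdf T x a < ext_cdf T x b"
  show "p \<in> msupport (order_measure T x)"
    unfolding msupport_def
  proof (intro CollectI allI impI)
    fix U :: "real set" assume U: "open U" "p \<in> U"
    then obtain e where e: "0 < e" "cball p e \<subseteq> U"
      using open_contains_cball by blast
    have "0 < ennreal (ext_cdf T x (p + e) - ext_cdf T x (p - e))"
      using incr e(1) by simp
    also have "\<dots> = emeasure (order_measure T x) {p - e<..p + e}"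
      using e(1) by (simp add: emeasure_order_measure_Ioc[OF x])
    also have "\<dots> \<le> emeasure (order_measure T x) U"
      by (rule emeasure_mono) (use e(2) U in \<open>auto simp: order_measure_def dist_real_def subset_iff\<close>)
    finally show "0 < emeasure (order_measure T x) U" .
  qed
qed

lemma order_cdf_compose:
  assumes x: "order_cdf T x" and R: "strict_mono_on {0..T} R" "continuous_on {0..T} R"
    and R0: "R 0 = 0" and RT: "R T = T" and "0 < T"
  shows "order_cdf T (x \<circ> R)"
proof -
  have le: "R s \<le> R t" if "0 \<le> s" "s \<le> t" "t \<le> T" for s t
    using strict_mono_on_leD[OF R(1), of s t] that by auto
  have img: "0 \<le> R t" "R t \<le> T" if "0 \<le> t" "t \<le> T" for t
    using le[of 0 t] le[of t T] that R0 RT by auto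
  have "continuous (at_right t) (x \<circ> R)" if t: "0 \<le> t" "t < T" for t
  proof -
    have Rt: "R t < T" using strict_mono_onD[OF R(1), of t T] t RT by auto
    have "(R \<longlongrightarrow> R t) (at t within {0..T})"
      using R(2) t by (auto simp: continuous_on_def)
    then have lim: "(R \<longlongrightarrow> R t) (at_right t)"
      using tendsto_within_subset[of R _ t "{0..T}" "{t..T}"] at_within_Icc_at_right[of t T] t
      by auto
    have "filterlim R (at_right (R t)) (at_right t)"
      unfolding filterlim_at
    proof (intro conjI lim)
      show "\<forall>\<^sub>F s in at_right t. R s \<in> {R t<..} \<and> R s \<noteq> R t"
        unfolding eventually_at_right_field
      proof (intro exI[of _ T] conjI allI impI)
        show "R s \<in> {R t<..}" if "t < s" "s < T" for s
          using strict_mono_onD[OF R(1), of t s] t that by auto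
        then show "R s \<noteq> R t" if "t < s" "s < T" for s
          using that by fastforce
      qed (use t in auto)
    qed
    moreover have "(x \<longlongrightarrow> x (R t)) (at_right (R t))"
      using x img(1)[of t] Rt t by (auto simp: order_cdf_def continuous_within)
    ultimately show ?thesis
      by (auto simp: continuous_within o_def intro: filterlim_compose)
  qed
  then show ?thesis
    using x img le RT by (auto simp: order_cdf_def mono_on_def Pi_iff)
qed

text \<open>Serves the trace condition after a change of time: at a point \<open>p\<close> of the
  new support the trace of the old path is known at \<open>R p\<close>.\<close>

lemma msupport_order_measure_compose:
  assumes x: "order_cdf T x" and R: "strict_mono_on {0..T} R" "continuous_on {0..T} R"
    and R0: "R 0 = 0" and RT: "R T = T" and "0 < T"
    and p: "p \<in> msupport (order_measure T (x \<circ> R))"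
  shows "p \<in> {0..T}" "R p \<in> msupport (order_measure T x)"
proof -
  have cdf: "order_cdf T (x \<circ> R)" by (rule order_cdf_compose) fact+
  have incr: "ext_cdf T (x \<circ> R) a < ext_cdf T (x \<circ> R) b" if "a < p" "p < b" for a b
    using p that \<open>0 < T\<close> by (simp add: msupport_order_measure_iff[OF cdf])
  show pT: "p \<in> {0..T}"
  proof (rule ccontr)
    assume "p \<notin> {0..T}"
    then consider "p < 0" | "T < p" by force
    then show False
    proof cases
      case 1
      then show False using incr[of "p - 1" "p / 2"] by (simp add: ext_cdf_def)
    next
      case 2
      then show False using incr[of "(p + T) / 2" "p + 1"] \<open>0 < T\<close> by (simp add: ext_cdf_def)
    qed
  qed
  have surj: "\<exists>s\<in>{0..T}. R s = r" if "r \<in> {0..T}" for r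
    using IVT'[of R 0 r T] that R0 RT R(2) \<open>0 < T\<close> by auto
  have iff: "R s < R t \<longleftrightarrow> s < t" if "s \<in> {0..T}" "t \<in> {0..T}" for s t
    using strict_mono_on_less[OF R(1)] that by blast
  have Rp: "R p \<in> {0..T}"
    using strict_mono_on_leD[OF R(1), of 0 p] strict_mono_on_leD[OF R(1), of p T] pT R0 RT by auto
  have "ext_cdf T x a < ext_cdf T x b" if ab: "a < R p" "R p < b" for a b
  proof -
    \<comment> \<open>A boundary point of the neighbourhood outside the interval has no preimage
      under \<open>R\<close>; the points -1 and T + 1, where the extended function has the same
      constant value, stand in for it.\<close>
    have "\<exists>a'<p. ext_cdf T (x \<circ> R) a' = ext_cdf T x a"
    proof (cases "0 \<le> a")
      case True
      with surj[of a] ab Rp obtain s where s: "s \<in> {0..T}" "R s = a" by auto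
      then show ?thesis using iff[of s p] pT ab True Rp by (intro exI[of _ s]) (auto simp: ext_cdf_def)
    next
      case False
      then show ?thesis using pT by (intro exI[of _ "- 1"]) (auto simp: ext_cdf_def)
    qed
    moreover have "\<exists>b'>p. ext_cdf T (x \<circ> R) b' = ext_cdf T x b"
    proof (cases "b \<le> T")
      case True
      with surj[of b] ab Rp obtain s where s: "s \<in> {0..T}" "R s = b" by auto
      then show ?thesis using iff[of p s] pT ab True Rp by (intro exI[of _ s]) (auto simp: ext_cdf_def)
    next
      case False
      then show ?thesis using pT \<open>0 < T\<close> by (intro exI[of _ "T + 1"]) (auto simp: ext_cdf_def)
    qed
    ultimately show ?thesis using incr by metis
  qed
  then show "R p \<in> msupport (order_measure T x)"
    using \<open>0 < T\<close> by (simp add: msupport_order_measure_iff[OF x])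
qed

text \<open>The bound 1/2 is what the smallness of the perturbation in \<open>competitor\<close>
  leaves of the derivative 1 of the identity, and it gives the Lipschitz constant 2. The derivative
  formula includes the two endpoints, where it is one-sided.\<close>

lemma inverse_reparametrization:
  fixes \<theta> \<theta>' :: "real \<Rightarrow> real"
  assumes "0 < T" and \<theta>: "\<And>t. t \<in> {0..T} \<Longrightarrow> (\<theta> has_real_derivative \<theta>' t) (at t within {0..T})"
    and half: "\<And>t. t \<in> {0..T} \<Longrightarrow> 1/2 \<le> \<theta>' t" and \<theta>0: "\<theta> 0 = 0" and \<theta>T: "\<theta> T = T"
  obtains R where "\<And>t. t \<in> {0..T} \<Longrightarrow> R t \<in> {0..T}" "\<And>t. t \<in> {0..T} \<Longrightarrow> \<theta> (R t) = t"
    "\<And>t. t \<in> {0..T} \<Longrightarrow> R (\<theta> t) = t" "strict_mono_on {0..T} R" "2-lipschitz_on {0..T} R"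
    "\<And>t. t \<in> {0..T} \<Longrightarrow> (R has_real_derivative 1 / \<theta>' (R t)) (at t within {0..T})"
proof -
  have expand: "(t - s) / 2 \<le> \<theta> t - \<theta> s" if st: "0 \<le> s" "s \<le> t" "t \<le> T" for s t
  proof (cases "s = t")
    case False
    have "\<exists>z\<in>{s..t}. \<theta> t - \<theta> s = (\<lambda>y. y * \<theta>' z) (t - s)"
    proof (rule mvt_very_simple[where f' = "\<lambda>z y. y * \<theta>' z"])
      fix z assume "s \<le> z" "z \<le> t"
      then show "(\<theta> has_derivative (\<lambda>y. y * \<theta>' z)) (at z within {s..t})"
        using DERIV_subset[OF \<theta>[of z], of "{s..t}"] st
        by (simp add: has_field_derivative_def mult.commute[of _ "\<theta>' z"])
    qed (use st in auto)
    then obtain z where z: "z \<in> {s..t}" "\<theta> t - \<theta> s = (t - s) * \<theta>' z" by auto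
    have "(t - s) * (1/2) \<le> (t - s) * \<theta>' z"
      using half[of z] z st by (intro mult_left_mono) auto
    then show ?thesis using z by simp
  qed simp
  have mono: "strict_mono_on {0..T} \<theta>"
    using expand by (intro strict_mono_onI) (smt (verit) atLeastAtMost_iff divide_pos_pos)
  have cont: "continuous_on {0..T} \<theta>"
    using \<theta> by (meson DERIV_continuous_on)
  have in_range: "\<theta> t \<in> {0..T}" if "t \<in> {0..T}" for t
    using strict_mono_on_leD[OF mono, of 0 t] strict_mono_on_leD[OF mono, of t T] that \<theta>0 \<theta>T by auto
  have surj: "\<theta> ` {0..T} = {0..T}"
  proof
    show "\<theta> ` {0..T} \<subseteq> {0..T}" using in_range by auto
    show "{0..T} \<subseteq> \<theta> ` {0..T}"
      using IVT'[of \<theta> 0 _ T] \<theta>0 \<theta>T cont \<open>0 < T\<close> by force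
  qed
  have inj: "inj_on \<theta> {0..T}" by (rule strict_mono_on_imp_inj_on[OF mono])
  define R where "R = the_inv_into {0..T} \<theta>"
  have R_in: "R t \<in> {0..T}" and \<theta>R: "\<theta> (R t) = t" if "t \<in> {0..T}" for t
    using the_inv_into_into[OF inj, of t "{0..T}"] f_the_inv_into_f[OF inj, of t] that surj
    by (auto simp: R_def)
  have R\<theta>: "R (\<theta> t) = t" if "t \<in> {0..T}" for t
    using the_inv_into_f_f[OF inj that] by (simp add: R_def)
  have R_mono: "strict_mono_on {0..T} R"
    using strict_mono_on_less[OF mono] R_in \<theta>R by (intro strict_mono_onI) metis
  have R_lip: "2-lipschitz_on {0..T} R"
  proof (rule lipschitz_on_leI)
    fix s t assume st: "s \<in> {0..T}" "t \<in> {0..T}" "s \<le> t"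
    have "R s \<le> R t" using strict_mono_on_leD[OF R_mono] st by auto
    then show "dist (R s) (R t) \<le> 2 * dist s t"
      using expand[of "R s" "R t"] R_in[of s] R_in[of t] \<theta>R st by (auto simp: dist_real_def)
  qed simp
  have "(R has_real_derivative 1 / \<theta>' (R t)) (at t within {0..T})" if t: "t \<in> {0..T}" for t
    unfolding has_field_derivative_iff
  proof -
    have R_cont: "(R \<longlongrightarrow> R t) (at t within {0..T})"
      using lipschitz_on_continuous_on[OF R_lip] t by (auto simp: continuous_on_def)
    have ne: "R y \<noteq> R t" if "y \<in> {0..T}" "y \<noteq> t" for y
      using \<theta>R that t by metis
    \<comment> \<open>Injectivity keeps \<open>R y\<close> away from \<open>R t\<close>, so the
      difference quotient of \<theta> may be evaluated along \<open>R\<close> and then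
      inverted.\<close>
    have "filterlim R (at (R t) within {0..T}) (at t within {0..T})"
      unfolding filterlim_at
      using R_cont R_in ne by (auto simp: eventually_at_filter)
    then have "((\<lambda>y. (\<theta> (R y) - \<theta> (R t)) / (R y - R t)) \<longlongrightarrow> \<theta>' (R t)) (at t within {0..T})"
      using \<theta>[OF R_in[OF t]] unfolding has_field_derivative_iff by (rule filterlim_compose[rotated])
    then have "((\<lambda>y. 1 / ((\<theta> (R y) - \<theta> (R t)) / (R y - R t))) \<longlongrightarrow> 1 / \<theta>' (R t)) (at t within {0..T})"
      using half[OF R_in[OF t]] by (intro tendsto_divide) auto
    moreover have "\<forall>\<^sub>F y in at t within {0..T}.
        1 / ((\<theta> (R y) - \<theta> (R t)) / (R y - R t)) = (R y - R t) / (y - t)"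
      using \<theta>R t by (auto simp: eventually_at_filter)
    ultimately show "((\<lambda>y. (R y - R t) / (y - t)) \<longlongrightarrow> 1 / \<theta>' (R t)) (at t within {0..T})"
      by (rule Lim_transform_eventually)
  qed
  with R_in \<theta>R R\<theta> R_mono R_lip show ?thesis by (rule that)
qed

lemma lipschitz_on_scaleR_compact:
  fixes f :: "real \<Rightarrow> real" and g :: "real \<Rightarrow> 'a::real_normed_vector"
  assumes f: "L-lipschitz_on {a..b} f" and g: "M-lipschitz_on {a..b} g"
  shows "\<exists>K. K-lipschitz_on {a..b} (\<lambda>t. f t *\<^sub>R g t)"
proof -
  have "bounded (f ` {a..b})" "bounded (g ` {a..b})"
    using lipschitz_on_continuous_on[OF f] lipschitz_on_continuous_on[OF g]
    by (auto intro!: compact_imp_bounded compact_continuous_image)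
  then obtain F G where FG: "\<And>t. t \<in> {a..b} \<Longrightarrow> norm (f t) \<le> F" "\<And>t. t \<in> {a..b} \<Longrightarrow> norm (g t) \<le> G"
    "0 < F" "0 < G"
    unfolding bounded_pos by blast
  have "(F * M + L * G)-lipschitz_on {a..b} (\<lambda>t. f t *\<^sub>R g t)"
  proof (rule lipschitz_onI)
    show "0 \<le> F * M + L * G"
      using FG lipschitz_on_nonneg[OF f] lipschitz_on_nonneg[OF g] by auto
    fix s t assume st: "s \<in> {a..b}" "t \<in> {a..b}"
    have "f s *\<^sub>R g s - f t *\<^sub>R g t = f s *\<^sub>R (g s - g t) + (f s - f t) *\<^sub>R g t"
      by (simp add: algebra_simps)
    also have "norm \<dots> \<le> \<bar>f s\<bar> * norm (g s - g t) + \<bar>f s - f t\<bar> * norm (g t)"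
      by (rule norm_triangle_le) simp
    also have "\<dots> \<le> F * (M * dist s t) + (L * dist s t) * G"
      using FG(1)[OF st(1)] FG(2)[OF st(2)] lipschitz_onD[OF f st] lipschitz_onD[OF g st] FG(3,4)
        lipschitz_on_nonneg[OF f]
      by (intro add_mono mult_mono) (auto simp: dist_norm)
    finally show "dist (f s *\<^sub>R g s) (f t *\<^sub>R g t) \<le> (F * M + L * G) * dist s t"
      by (simp add: dist_norm algebra_simps)
  qed
  then show ?thesis ..
qed

lemma lipschitz_on_inverse_ge_half:
  fixes f :: "real \<Rightarrow> real"
  assumes f: "L-lipschitz_on S f" and half: "\<And>t. t \<in> S \<Longrightarrow> 1/2 \<le> f t"
  shows "(4 * L)-lipschitz_on S (\<lambda>t. 1 / f t)"
proof (rule lipschitz_onI)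
  show "0 \<le> 4 * L" using lipschitz_on_nonneg[OF f] by simp
  fix s t assume st: "s \<in> S" "t \<in> S"
  have p: "1/4 \<le> f s * f t"
    using mult_mono[of "1/2" "f s" "1/2" "f t"] half[OF st(1)] half[OF st(2)] by simp
  have "1 / f s - 1 / f t = (f t - f s) / (f s * f t)"
    using half[OF st(1)] half[OF st(2)] by (simp add: field_simps)
  then have "\<bar>1 / f s - 1 / f t\<bar> = \<bar>f t - f s\<bar> / (f s * f t)"
    using p by simp
  also have "\<dots> \<le> \<bar>f t - f s\<bar> / (1/4)"
    using p by (intro divide_left_mono) auto
  also have "\<dots> \<le> 4 * (L * dist s t)"
    using lipschitz_onD[OF f st] by (simp add: dist_real_def abs_minus_commute)
  finally show "dist (1 / f s) (1 / f t) \<le> 4 * L * dist s t"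
    by (simp add: dist_real_def)
qed

subsection \<open>The functional along a path\<close>

lemma C1_monotone_path_deriv:
  fixes \<Psi> :: "real \<Rightarrow> real^'n^'n"
  assumes "C1_monotone_path Q \<Psi>" and t: "t \<in> {0..real CARD('n)}"
  shows "(\<Psi> has_vector_derivative path_deriv \<Psi> t) (at t within {0..real CARD('n)})"
  using assms unfolding C1_monotone_path_def path_deriv_def
  by (simp add: vector_derivative_works[symmetric])

text \<open>The forms of a monotone path have nonnegative difference quotients, and this passes to
  the limit; symmetry follows from the uniqueness of the derivative of the transposed path.\<close>

lemma psd_path_deriv:
  fixes \<Psi> :: "real \<Rightarrow> real^'n^'n"
  assumes \<Psi>: "C1_monotone_path Q \<Psi>" and t: "t \<in> {0..real CARD('n)}"
  shows "psd (path_deriv \<Psi> t)"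
proof -
  let ?I = "{0..real CARD('n)}"
  note d = C1_monotone_path_deriv[OF assms]
  have nontriv: "at t within ?I \<noteq> bot"
    using t by (auto simp: trivial_limit_within islimpt_Icc)
  have psd_diff: "psd (\<Psi> s' - \<Psi> s)" if "s \<in> ?I" "s' \<in> ?I" "s \<le> s'" for s s'
    using \<Psi> that by (auto simp: C1_monotone_path_def)
  have "transpose (\<Psi> s) = \<Psi> s" if "s \<in> ?I" for s
    using \<Psi> that by (auto simp: C1_monotone_path_def psd_def)
  then have "(\<Psi> has_vector_derivative transpose (path_deriv \<Psi> t)) (at t within ?I)"
    by (intro has_vector_derivative_transform[OF t _
          bounded_linear.has_vector_derivative[OF bounded_linear_transpose d]]) simp
  then have "transpose (path_deriv \<Psi> t) = path_deriv \<Psi> t"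
    using vector_derivative_unique_within[OF nontriv _ d] by blast
  moreover have "0 \<le> v \<bullet> (path_deriv \<Psi> t *v v)" for v
  proof -
    let ?g = "\<lambda>s. v \<bullet> (\<Psi> s *v v)"
    have mono: "?g s \<le> ?g s'" if "s \<in> ?I" "s' \<in> ?I" "s \<le> s'" for s s'
      using psd_quadratic_form[OF psd_diff[OF that], of v]
      by (simp add: matrix_vector_mult_diff_rdistrib inner_diff_right)
    have "(?g has_real_derivative v \<bullet> (path_deriv \<Psi> t *v v)) (at t within ?I)"
      using bounded_linear.has_vector_derivative[OF bounded_linear_quadratic_form d]
      by (simp add: has_real_derivative_iff_has_vector_derivative)
    then have lim: "((\<lambda>s. (?g s - ?g t) / (s - t)) \<longlongrightarrow> v \<bullet> (path_deriv \<Psi> t *v v)) (at t within ?I)"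
      by (simp add: has_field_derivative_iff)
    have "0 \<le> (?g s - ?g t) / (s - t)" if "s \<in> ?I" "s \<noteq> t" for s
      using mono[of s t] mono[of t s] that t by (cases "s < t") (auto simp: divide_nonpos_neg)
    then have "\<forall>\<^sub>F s in at t within ?I. 0 \<le> (?g s - ?g t) / (s - t)"
      by (auto simp: eventually_at_filter)
    then show ?thesis using tendsto_lowerbound[OF lim _ nontriv] by blast
  qed
  ultimately show ?thesis by (simp add: psd_def)
qed

text \<open>Integration turns conditions on the velocity into all conditions on the path, so
  competitors can be described by their velocities alone.\<close>

lemma C1_monotone_pathI:
  fixes \<Psi> V :: "real \<Rightarrow> real^'n^'n"
  assumes deriv: "\<And>t. t \<in> {0..real CARD('n)} \<Longrightarrow>
      (\<Psi> has_vector_derivative V t) (at t within {0..real CARD('n)})"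
    and psd: "\<And>t. t \<in> {0..real CARD('n)} \<Longrightarrow> psd (V t)"
    and lip: "L-lipschitz_on {0..real CARD('n)} V"
    and ends: "\<Psi> 0 = 0" "\<Psi> (real CARD('n)) = Q"
  shows "C1_monotone_path Q \<Psi>" and "\<And>t. t \<in> {0..real CARD('n)} \<Longrightarrow> path_deriv \<Psi> t = V t"
proof -
  let ?I = "{0..real CARD('n)}"
  have pos: "0 < real CARD('n)" by simp
  show pd: "path_deriv \<Psi> t = V t" if "t \<in> ?I" for t
    unfolding path_deriv_def
    using vector_derivative_within_closed_interval[OF pos that deriv[OF that]] .
  have cont: "continuous_on ?I V" using lip by (rule lipschitz_on_continuous_on)
  have int: "(V has_integral (\<Psi> t - \<Psi> s)) {s..t}" if "0 \<le> s" "s \<le> t" "t \<le> real CARD('n)" for s t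
    using that by (intro fundamental_theorem_of_calculus)
      (auto intro: has_vector_derivative_within_subset[OF deriv])
  have mono: "psd (\<Psi> t - \<Psi> s)" if "0 \<le> s" "s \<le> t" "t \<le> real CARD('n)" for s t
    using psd_integral[of V "{s..t}"] int[OF that] psd that by (auto simp: has_integral_iff)
  obtain B where B: "\<And>t. t \<in> ?I \<Longrightarrow> norm (V t) \<le> B"
    using compact_imp_bounded[OF compact_continuous_image[OF cont compact_Icc]]
    unfolding bounded_iff by blast
  have "B-lipschitz_on ?I \<Psi>"
  proof (rule lipschitz_on_leI)
    show "0 \<le> B" using order_trans[OF norm_ge_zero B[of 0]] by simp
    fix s t assume st: "s \<in> ?I" "t \<in> ?I" "s \<le> t"
    then have "norm (\<Psi> t - \<Psi> s) \<le> B * (t - s)"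
      using norm_integral_le_const[of s t V B] int[of s t] B by (auto simp: has_integral_iff)
    then show "dist (\<Psi> s) (\<Psi> t) \<le> B * dist s t"
      using st by (simp add: dist_norm norm_minus_commute)
  qed
  moreover have "psd (\<Psi> t)" if "t \<in> ?I" for t
    using mono[of 0 t] that ends(1) by simp
  moreover have "\<Psi> differentiable (at t within ?I)" if "t \<in> ?I" for t
    using deriv[OF that] by (auto simp: has_vector_derivative_def differentiable_def)
  moreover have "continuous_on ?I (path_deriv \<Psi>)"
    using cont by (rule continuous_on_eq) (simp add: pd)
  moreover have "L-lipschitz_on ?I (path_deriv \<Psi>)"
    using lip by (rule lipschitz_on_transform) (simp add: pd)
  ultimately show "C1_monotone_path Q \<Psi>"
    using mono ends unfolding C1_monotone_path_def by blast
qed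

text \<open>The trace condition is left out so that a varied path, which in general violates it
  until time is changed, is again an instance. The cutoff is a parameter for a similar reason: one
  value has to serve the whole family of varied paths.\<close>

locale cs_path =
  fixes \<beta> :: "nat \<Rightarrow> real^'n" and h :: "real^'n" and Q :: "real^'n^'n" and x :: "real \<Rightarrow> real"
    and \<Psi> :: "real \<Rightarrow> real^'n^'n" and T :: real
  assumes beta_summable: "\<And>j. (\<lambda>p. 2 ^ p * (\<beta> p $ j)\<^sup>2) summable_on {2..}"
    and Q_diag: "\<And>i. Q $ i $ i = 1"
    and cdf: "order_cdf (real CARD('n)) x"
    and path: "C1_monotone_path Q \<Psi>"
    and T: "t_top (real CARD('n)) x < T" "T < real CARD('n)" "0 < T"
    and det_T: "det (Q - \<Psi> T) > 0"
begin

abbreviation (input) V :: "real \<Rightarrow> real^'n^'n" where "V \<equiv> path_deriv \<Psi>"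

lemma path_ends: "\<Psi> 0 = 0" "\<Psi> (real CARD('n)) = Q"
  using path by (auto simp: C1_monotone_path_def)

lemma deriv: "t \<in> {0..real CARD('n)} \<Longrightarrow> (\<Psi> has_vector_derivative V t) (at t within {0..real CARD('n)})"
  by (rule C1_monotone_path_deriv[OF path])

lemma psd_V: "t \<in> {0..real CARD('n)} \<Longrightarrow> psd (V t)"
  by (rule psd_path_deriv[OF path])

lemma psd_increment: "0 \<le> s \<Longrightarrow> s \<le> t \<Longrightarrow> t \<le> real CARD('n) \<Longrightarrow> psd (\<Psi> t - \<Psi> s)"
  using path by (auto simp: C1_monotone_path_def)

lemma continuous_V: "continuous_on {0..real CARD('n)} V"
  using path by (auto simp: C1_monotone_path_def)

lemma continuous_path: "continuous_on {0..real CARD('n)} \<Psi>"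
  using deriv by (intro continuous_on_vector_derivative) auto

lemma mono_x: "mono_on {0..real CARD('n)} x"
  using cdf by (simp add: order_cdf_def)

lemma x_range: "t \<in> {0..real CARD('n)} \<Longrightarrow> 0 \<le> x t \<and> x t \<le> 1"
  using order_cdf_range[OF cdf] by auto

lemma x_eq_1: "t \<in> {T..real CARD('n)} \<Longrightarrow> x t = 1"
proof -
  assume t: "t \<in> {T..real CARD('n)}"
  have "real CARD('n) \<in> {t \<in> {0..real CARD('n)}. x t = 1}"
    using cdf by (simp add: order_cdf_def)
  then have "\<exists>s\<in>{t \<in> {0..real CARD('n)}. x t = 1}. s < T"
    using T(1) unfolding t_top_def by (intro cInf_lessD) auto
  then obtain s where s: "0 \<le> s" "s < T" "x s = 1" by auto
  then have "1 \<le> x t" using monotone_onD[OF mono_x, of s t] t by auto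
  then show "x t = 1" using x_range[of t] t T by auto
qed

text \<open>In the Loewner order \<open>\<Psi> t\<close> lies between 0 and Q, so its diagonal
  entries are at most 1, and these control the others.\<close>

lemma entry_bound:
  assumes t: "t \<in> {0..real CARD('n)}"
  shows "\<bar>\<Psi> t $ i $ j\<bar> \<le> 1"
proof -
  have psd_t: "psd (\<Psi> t)" using psd_increment[of 0 t] t path_ends by simp
  have "\<Psi> t $ i $ i \<le> 1" for i
  proof -
    have "\<bar>(Q - \<Psi> t) $ i $ i\<bar> \<le> ((Q - \<Psi> t) $ i $ i + (Q - \<Psi> t) $ i $ i) / 2"
      using psd_increment[of t "real CARD('n)"] t path_ends by (intro psd_entry_bound) simp
    from order_trans[OF abs_ge_zero this] show ?thesis using Q_diag by simp
  qed
  then have "(\<Psi> t $ i $ i + \<Psi> t $ j $ j) / 2 \<le> 1"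
    using add_mono[of "\<Psi> t $ i $ i" 1 "\<Psi> t $ j $ j" 1] by simp
  with psd_entry_bound[OF psd_t] show ?thesis by (rule order_trans)
qed

lemma continuous_xi_deriv: "continuous_on {0..real CARD('n)} (\<lambda>t. xi_deriv \<beta> (\<Psi> t))"
proof -
  have "continuous_on {-1..1} (\<lambda>u. \<Sum>n. xi_coeff \<beta> i j n * u ^ n)" for i j
    using power_series_C1(1)[OF summable_xi_coeff[OF beta_summable]]
    by (intro continuous_at_imp_continuous_on ballI DERIV_isCont)
  then have "continuous_on {0..real CARD('n)} (\<lambda>t. \<Sum>n. xi_coeff \<beta> i j n * (\<Psi> t $ i $ j) ^ n)" for i j
    by (rule continuous_on_compose2) (use entry_bound in \<open>auto simp: abs_le_iff minus_le_iff intro!: continuous_intros continuous_path\<close>)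
  then have "continuous_on {0..real CARD('n)} (\<lambda>t. \<chi> i j. \<Sum>n. xi_coeff \<beta> i j n * (\<Psi> t $ i $ j) ^ n)"
    by (intro continuous_on_vec_lambda)
  then show ?thesis
    by (rule continuous_on_eq) (simp add: vec_eq_iff xi_deriv_component[OF beta_summable entry_bound])
qed

lemma external_integrand:
  "(\<lambda>t. x t * trace_prod (xi_deriv \<beta> (\<Psi> t) + outer h h) (V t)) absolutely_integrable_on {0..real CARD('n)}"
  using mono_on_times_continuous_absolutely_integrable[OF mono_x,
      of "\<lambda>t. trace_prod (xi_deriv \<beta> (\<Psi> t) + outer h h) (V t)"]
  by (simp add: continuous_intros continuous_xi_deriv continuous_V)

lemma integrable_xV: "(\<lambda>t. x t *\<^sub>R V t) absolutely_integrable_on {0..real CARD('n)}"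
  by (rule mono_on_times_continuous_absolutely_integrable[OF mono_x continuous_V])

lemma integrable_xV_sub: "0 \<le> s \<Longrightarrow> t \<le> real CARD('n) \<Longrightarrow> (\<lambda>t. x t *\<^sub>R V t) integrable_on {s..t}"
  using integrable_subinterval_real[OF absolutely_integrable_on_def[THEN iffD1, THEN conjunct1, OF integrable_xV], of s t]
  by auto

lemma hat_diff:
  assumes "0 \<le> s" "s \<le> t" "t \<le> real CARD('n)"
  shows "hat_path x \<Psi> s - hat_path x \<Psi> t = integral {s..t} (\<lambda>u. x u *\<^sub>R V u)"
proof -
  have "integral {s..t} (\<lambda>u. x u *\<^sub>R V u) + hat_path x \<Psi> t = hat_path x \<Psi> s"
    unfolding hat_path_def
    by (intro Henstock_Kurzweil_Integration.integral_combine integrable_xV_sub) (use assms in auto)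
  then show ?thesis by (simp add: algebra_simps)
qed

lemma continuous_hat: "continuous_on {0..real CARD('n)} (hat_path x \<Psi>)"
proof -
  have "continuous_on {0..real CARD('n)} (\<lambda>t. hat_path x \<Psi> 0 - integral {0..t} (\<lambda>u. x u *\<^sub>R V u))"
    by (intro continuous_intros indefinite_integral_continuous_1 integrable_xV_sub) auto
  then show ?thesis
  proof (rule continuous_on_eq)
    show "hat_path x \<Psi> 0 - integral {0..t} (\<lambda>u. x u *\<^sub>R V u) = hat_path x \<Psi> t"
      if "t \<in> {0..real CARD('n)}" for t
      using hat_diff[of 0 t] that by (simp add: algebra_simps)
  qed
qed

lemma hat_T: "hat_path x \<Psi> T = Q - \<Psi> T"
proof -
  have "hat_path x \<Psi> T = integral {T..real CARD('n)} V"
    unfolding hat_path_def by (rule integral_cong) (simp add: x_eq_1)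
  also have "\<dots> = \<Psi> (real CARD('n)) - \<Psi> T"
    using T by (intro integral_unique fundamental_theorem_of_calculus)
      (auto intro: has_vector_derivative_within_subset[OF deriv])
  finally show ?thesis by (simp add: path_ends)
qed

text \<open>Up to the cutoff the hat path dominates its value there, the nonsingular psd matrix
  \<open>Q - \<Psi> T\<close>. To the right of the cutoff it shrinks to 0, which is why inverses are
  taken on [0, T] only.\<close>

lemma det_hat:
  assumes t: "t \<in> {0..T}"
  shows "det (hat_path x \<Psi> t) \<noteq> 0"
proof (rule det_nonzero_if_ge_psd)
  show "psd (Q - \<Psi> T)" using psd_increment[of T "real CARD('n)"] T path_ends by simp
  show "det (Q - \<Psi> T) \<noteq> 0" using det_T by simp
  have "psd (integral {t..T} (\<lambda>u. x u *\<^sub>R V u))"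
    using t T x_range by (intro psd_integral integrable_xV_sub psd_scaleR psd_V) auto
  then show "psd (hat_path x \<Psi> t - (Q - \<Psi> T))"
    using hat_diff[of t T] t T by (simp flip: hat_T)
qed

lemma continuous_inv_hat: "continuous_on {0..T} (\<lambda>t. matrix_inv (hat_path x \<Psi> t))"
  by (intro continuous_on_matrix_inv continuous_on_subset[OF continuous_hat] det_hat) (use T in auto)

lemma internal_integrand:
  "(\<lambda>t. trace_prod (matrix_inv (hat_path x \<Psi> t)) (V t)) absolutely_integrable_on {0..T}"
  by (intro absolutely_integrable_continuous_real continuous_intros continuous_inv_hat
      continuous_on_subset[OF continuous_V]) (use T in auto)

text \<open>Every integrand is linear in the velocity, while \<open>x\<close>, the path and the hat
  path are merely composed with \<open>R\<close>, so each integral is a substitution. As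
  \<open>R\<close> fixes \<open>T\<close> and the right end, the cutoff and the log-determinant keep
  their values.\<close>

lemma reparametrize:
  fixes R R' :: "real \<Rightarrow> real" and L :: real
  assumes R: "\<And>t. t \<in> {0..real CARD('n)} \<Longrightarrow> (R has_real_derivative R' t) (at t within {0..real CARD('n)})"
    and R'_pos: "\<And>t. t \<in> {0..real CARD('n)} \<Longrightarrow> 0 \<le> R' t"
    and mono: "strict_mono_on {0..real CARD('n)} R"
    and R0: "R 0 = 0" and RT: "R T = T" and Rm: "R (real CARD('n)) = real CARD('n)"
    and lip: "L-lipschitz_on {0..real CARD('n)} (\<lambda>t. R' t *\<^sub>R V (R t))"
  shows "C1_monotone_path Q (\<Psi> \<circ> R)"
    and "crisanti_sommers_at \<beta> h T (x \<circ> R) (\<Psi> \<circ> R) = crisanti_sommers_at \<beta> h T x \<Psi>"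
proof -
  let ?m = "real CARD('n)"
  have cont: "continuous_on {0..?m} R" using R by (meson DERIV_continuous_on)
  have R_le: "R s \<le> R t" if "0 \<le> s" "s \<le> t" "t \<le> ?m" for s t
    using strict_mono_on_leD[OF mono, of s t] that by auto
  have R_in: "R t \<in> {0..?m}" if "t \<in> {0..?m}" for t
    using R_le[of 0 t] R_le[of t ?m] that R0 Rm by auto
  have img: "R ` {s..t} = {R s..R t}" if st: "0 \<le> s" "s \<le> t" "t \<le> ?m" for s t
  proof
    show "R ` {s..t} \<subseteq> {R s..R t}" using R_le st by auto
    show "{R s..R t} \<subseteq> R ` {s..t}"
    proof
      fix r assume "r \<in> {R s..R t}"
      then show "r \<in> R ` {s..t}"
        using IVT'[of R s r t] continuous_on_subset[OF cont, of "{s..t}"] st by force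
    qed
  qed
  have inj: "inj_on R {0..?m}" by (rule strict_mono_on_imp_inj_on[OF mono])
  have sub_matrix: "integral {s..t} (\<lambda>u. R' u *\<^sub>R f (R u)) = integral {R s..R t} f"
    if "0 \<le> s" "s \<le> t" "t \<le> ?m" "f absolutely_integrable_on {R s..R t}" for s t
      and f :: "real \<Rightarrow> real^'n^'n"
    by (rule integral_reparametrize)
       (use that img[OF that(1-3)] R'_pos in \<open>auto intro: DERIV_subset[OF R] inj_on_subset[OF inj]\<close>)
  have sub_real: "integral {s..t} (\<lambda>u. R' u *\<^sub>R f (R u)) = integral {R s..R t} f"
    if "0 \<le> s" "s \<le> t" "t \<le> ?m" "f absolutely_integrable_on {R s..R t}" for s t
      and f :: "real \<Rightarrow> real"
    by (rule integral_reparametrize)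
       (use that img[OF that(1-3)] R'_pos in \<open>auto intro: DERIV_subset[OF R] inj_on_subset[OF inj]\<close>)
  have deriv': "(\<Psi> \<circ> R has_vector_derivative R' t *\<^sub>R V (R t)) (at t within {0..?m})"
    if t: "t \<in> {0..?m}" for t
  proof (rule vector_diff_chain_within)
    show "(R has_vector_derivative R' t) (at t within {0..?m})"
      using R[OF t] by (simp add: has_real_derivative_iff_has_vector_derivative)
    show "(\<Psi> has_vector_derivative V (R t)) (at (R t) within R ` {0..?m})"
      using deriv[OF R_in[OF t]] by (rule has_vector_derivative_within_subset) (use R_in in auto)
  qed
  have psd': "psd (R' t *\<^sub>R V (R t))" if "t \<in> {0..?m}" for t
    using that R'_pos R_in by (intro psd_scaleR psd_V) auto
  have ends: "(\<Psi> \<circ> R) 0 = 0" "(\<Psi> \<circ> R) ?m = Q" using R0 Rm path_ends by auto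
  show C1: "C1_monotone_path Q (\<Psi> \<circ> R)" by (rule C1_monotone_pathI(1)[OF deriv' psd' lip ends])
  have pd: "path_deriv (\<Psi> \<circ> R) t = R' t *\<^sub>R V (R t)" if "t \<in> {0..?m}" for t
    by (rule C1_monotone_pathI(2)[OF deriv' psd' lip ends that])
  have hat: "hat_path (x \<circ> R) (\<Psi> \<circ> R) t = hat_path x \<Psi> (R t)" if t: "t \<in> {0..?m}" for t
  proof -
    have "hat_path (x \<circ> R) (\<Psi> \<circ> R) t = integral {t..?m} (\<lambda>u. R' u *\<^sub>R (x (R u) *\<^sub>R V (R u)))"
      unfolding hat_path_def by (rule integral_cong) (use t in \<open>simp add: pd mult.commute\<close>)
    also have "\<dots> = integral {R t..R ?m} (\<lambda>u. x u *\<^sub>R V u)"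
    proof (rule sub_matrix[where f = "\<lambda>u. x u *\<^sub>R V u"])
      show "(\<lambda>u. x u *\<^sub>R V u) absolutely_integrable_on {R t..R ?m}"
        by (rule absolutely_integrable_on_subinterval[OF integrable_xV]) (use R_in[OF t] Rm in auto)
    qed (use t in auto)
    finally show ?thesis by (simp add: hat_path_def Rm)
  qed
  have trS: "trace_prod A (c *\<^sub>R B) = c * trace_prod A B" for A B :: "real^'n^'n" and c
    by (simp add: bounded_bilinear.scaleR_right[OF bounded_bilinear_trace_prod])
  have "integral {0..?m} (\<lambda>t. (x \<circ> R) t * trace_prod (xi_deriv \<beta> ((\<Psi> \<circ> R) t) + outer h h) (path_deriv (\<Psi> \<circ> R) t))
      = integral {0..?m} (\<lambda>t. R' t *\<^sub>R (x (R t) * trace_prod (xi_deriv \<beta> (\<Psi> (R t)) + outer h h) (V (R t))))"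
    by (rule integral_cong) (simp add: pd trS mult_ac)
  also have "\<dots> = integral {R 0..R ?m} (\<lambda>t. x t * trace_prod (xi_deriv \<beta> (\<Psi> t) + outer h h) (V t))"
    by (rule sub_real[where f = "\<lambda>t. x t * trace_prod (xi_deriv \<beta> (\<Psi> t) + outer h h) (V t)"])
       (use external_integrand R0 Rm in auto)
  finally have ext: "integral {0..?m} (\<lambda>t. (x \<circ> R) t * trace_prod (xi_deriv \<beta> ((\<Psi> \<circ> R) t) + outer h h) (path_deriv (\<Psi> \<circ> R) t))
      = integral {0..?m} (\<lambda>t. x t * trace_prod (xi_deriv \<beta> (\<Psi> t) + outer h h) (V t))"
    by (simp add: R0 Rm)
  have "integral {0..T} (\<lambda>t. trace_prod (matrix_inv (hat_path (x \<circ> R) (\<Psi> \<circ> R) t)) (path_deriv (\<Psi> \<circ> R) t))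
      = integral {0..T} (\<lambda>t. R' t *\<^sub>R trace_prod (matrix_inv (hat_path x \<Psi> (R t))) (V (R t)))"
    by (rule integral_cong) (use T in \<open>simp add: pd hat trS\<close>)
  also have "\<dots> = integral {R 0..R T} (\<lambda>t. trace_prod (matrix_inv (hat_path x \<Psi> t)) (V t))"
    by (rule sub_real[where f = "\<lambda>t. trace_prod (matrix_inv (hat_path x \<Psi> t)) (V t)"])
       (use internal_integrand R0 RT T in auto)
  finally show "crisanti_sommers_at \<beta> h T (x \<circ> R) (\<Psi> \<circ> R) = crisanti_sommers_at \<beta> h T x \<Psi>"
    using ext by (simp add: crisanti_sommers_at_def R0 RT Rm)
qed

end

section \<open>The gradient along the path and its derivative in time\<close>

lemma has_vector_derivative_matrix:
  fixes f :: "real \<Rightarrow> real^'n^'n"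
  assumes "\<And>i j. ((\<lambda>s. f s $ i $ j) has_real_derivative D $ i $ j) (at t within S)"
  shows "(f has_vector_derivative D) (at t within S)"
  unfolding has_vector_derivative_def
proof (subst has_derivative_componentwise_within, rule ballI)
  fix b :: "real^'n^'n" assume "b \<in> Basis"
  then obtain i j where b: "b = axis i (axis j 1)" by (auto simp: Basis_vec_def)
  show "((\<lambda>s. f s \<bullet> b) has_derivative (\<lambda>s. (s *\<^sub>R D) \<bullet> b)) (at t within S)"
    using assms[of i j] by (simp add: b inner_axis has_field_derivative_def mult.commute[of _ "D $ i $ j"])
qed

lemma continuous_on_Icc_norm_bound:
  fixes f :: "real \<Rightarrow> 'a::real_normed_vector"
  assumes "continuous_on {a..b} f"
  obtains B where "0 < B" "\<And>t. t \<in> {a..b} \<Longrightarrow> norm (f t) \<le> B"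
proof -
  have "bounded (f ` {a..b})"
    using assms by (intro compact_imp_bounded compact_continuous_image) auto
  then obtain B where "0 < B" "\<forall>y\<in>f ` {a..b}. norm y \<le> B"
    unfolding bounded_pos by blast
  then show ?thesis using that by simp
qed

lemma continuous_on_snd_param:
  assumes "continuous_on B g"
  shows "continuous_on (A \<times> B) (\<lambda>z. g (snd z))"
  by (rule continuous_on_compose2[OF assms]) (auto intro!: continuous_intros)

context cs_path
begin

definition inv_hat :: "real \<Rightarrow> real^'n^'n" where
  "inv_hat t = matrix_inv (hat_path x \<Psi> t)"

text \<open>The entrywise chain rule for \<xi>'(\<Psi> t); \<open>diffs\<close> produces the second
  derivative of the covariance series.\<close>

definition A' :: "real \<Rightarrow> real^'n^'n" where
  "A' t = (\<chi> i j. (\<Sum>n. diffs (xi_coeff \<beta> i j) n * (\<Psi> t $ i $ j) ^ n) * V t $ i $ j)"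

text \<open>The weight \<open>x\<close> is absent here: the increments of \<open>inv_hat\<close> are
  the integrals of \<open>x t *\<^sub>R P' t\<close>, as \<open>inv_hat_increment\<close>
  shows.\<close>

definition P' :: "real \<Rightarrow> real^'n^'n" where
  "P' t = inv_hat t ** V t ** inv_hat t"

definition P :: "real \<Rightarrow> real^'n^'n" where
  "P t = integral {0..t} P'"

text \<open>The value \<open>F t\<close> is the gradient of the functional at \<open>\<Psi> t\<close>, up to the factor \<open>- 1/2\<close> and the mass at \<open>t\<close>.\<close>

definition F :: "real \<Rightarrow> real^'n^'n" where
  "F t = xi_deriv \<beta> (\<Psi> t) + outer h h - P t"

definition F' :: "real \<Rightarrow> real^'n^'n" where
  "F' t = A' t - P' t"

lemma continuous_inv_hat': "continuous_on {0..T} inv_hat"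
  unfolding inv_hat_def[abs_def] by (rule continuous_inv_hat)

lemma continuous_P': "continuous_on {0..T} P'"
  unfolding P'_def[abs_def]
  by (intro continuous_intros continuous_inv_hat' continuous_on_subset[OF continuous_V]) (use T in auto)

lemma P_deriv: "t \<in> {0..T} \<Longrightarrow> (P has_vector_derivative P' t) (at t within {0..T})"
  unfolding P_def[abs_def] by (rule integral_has_vector_derivative[OF continuous_P'])

lemma continuous_xi_deriv2:
  "continuous_on {0..real CARD('n)} (\<lambda>t. \<Sum>n. diffs (xi_coeff \<beta> i j) n * (\<Psi> t $ i $ j) ^ n)"
proof -
  have "continuous_on {-1..1} (\<lambda>u. \<Sum>n. diffs (xi_coeff \<beta> i j) n * u ^ n)"
    using power_series_C1(2)[OF summable_xi_coeff[OF beta_summable]]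
    by (intro continuous_at_imp_continuous_on ballI)
  then show ?thesis
    by (rule continuous_on_compose2)
       (use entry_bound in \<open>auto simp: abs_le_iff minus_le_iff intro!: continuous_intros continuous_path\<close>)
qed

lemma continuous_A': "continuous_on {0..real CARD('n)} A'"
  unfolding A'_def[abs_def]
  by (intro continuous_intros continuous_on_vec_lambda continuous_xi_deriv2 continuous_V)

lemma A_deriv:
  assumes t: "t \<in> {0..real CARD('n)}"
  shows "((\<lambda>t. xi_deriv \<beta> (\<Psi> t) + outer h h) has_vector_derivative A' t) (at t within {0..real CARD('n)})"
proof (rule has_vector_derivative_matrix)
  fix i j
  have entry: "((\<lambda>t. \<Psi> t $ i $ j) has_real_derivative V t $ i $ j) (at t within {0..real CARD('n)})"
    using bounded_linear.has_vector_derivative[OF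
        bounded_linear_compose[OF bounded_linear_vec_nth bounded_linear_vec_nth] deriv[OF t], of i j]
    by (simp add: has_real_derivative_iff_has_vector_derivative)
  have "((\<lambda>t. \<Sum>n. xi_coeff \<beta> i j n * (\<Psi> t $ i $ j) ^ n) has_real_derivative A' t $ i $ j)
      (at t within {0..real CARD('n)})"
    unfolding A'_def vec_lambda_beta
    by (rule DERIV_chain2[where f = "\<lambda>u. \<Sum>n. xi_coeff \<beta> i j n * u ^ n",
          OF power_series_C1(1)[OF summable_xi_coeff[OF beta_summable]] entry])
       (use entry_bound[OF t, of i j] in \<open>auto simp: abs_le_iff\<close>)
  then have "((\<lambda>t. (\<Sum>n. xi_coeff \<beta> i j n * (\<Psi> t $ i $ j) ^ n) + outer h h $ i $ j) has_real_derivative A' t $ i $ j)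
      (at t within {0..real CARD('n)})"
    by (auto intro: derivative_eq_intros)
  then show "((\<lambda>t. (xi_deriv \<beta> (\<Psi> t) + outer h h) $ i $ j) has_real_derivative A' t $ i $ j)
      (at t within {0..real CARD('n)})"
    by (rule has_field_derivative_transform_within[OF _ zero_less_one t])
       (simp add: xi_deriv_component[OF beta_summable entry_bound])
qed

lemma F_deriv: "t \<in> {0..T} \<Longrightarrow> (F has_vector_derivative F' t) (at t within {0..T})"
  unfolding F_def[abs_def] F'_def
  by (intro has_vector_derivative_diff P_deriv has_vector_derivative_within_subset[OF A_deriv])
     (use T in auto)

lemma continuous_F': "continuous_on {0..T} F'"
  unfolding F'_def[abs_def]
  by (intro continuous_intros continuous_P' continuous_on_subset[OF continuous_A']) (use T in auto)

lemma continuous_F: "continuous_on {0..T} F"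
  using F_deriv by (intro continuous_on_vector_derivative) auto

lemma F_0: "F 0 = outer h h"
  using path_ends
  by (simp add: F_def P_def vec_eq_iff xi_deriv_component[OF beta_summable] xi_coeff_def)

lemma F'_0: "trace_prod (F' 0) (V 0) = 2 * trace_prod (outer (\<beta> 2) (\<beta> 2)) (V 0 ^ 2) -
    trace_prod (inv_hat 0 ** V 0) (inv_hat 0 ** V 0)"
proof -
  have sym: "V 0 $ j $ i = V 0 $ i $ j" for i j
    using psd_V[of 0] by (simp add: psd_def transpose_def vec_eq_iff)
  \<comment> \<open>Since \<open>\<Psi> 0 = 0\<close>, only the constant term of the differentiated
    series is left, that is, the linear coefficient of \<xi>', which belongs to p = 2.\<close>
  have "A' 0 $ i $ j = 2 * (\<beta> 2 $ i * \<beta> 2 $ j) * V 0 $ i $ j" for i j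
    using powser_zero[of "diffs (xi_coeff \<beta> i j)"]
    by (simp add: A'_def path_ends diffs_def xi_coeff_def numeral_2_eq_2)
  then have "trace_prod (A' 0) (V 0) = 2 * trace_prod (outer (\<beta> 2) (\<beta> 2)) (V 0 ^ 2)"
    by (simp add: trace_prod_sum outer_def sum_distrib_left hadamard_power_component sym
        power2_eq_square mult.assoc)
  moreover have "trace_prod (P' 0) (V 0) = trace_prod (inv_hat 0 ** V 0) (inv_hat 0 ** V 0)"
    by (simp add: P'_def trace_prod_assoc)
  ultimately show ?thesis
    by (simp add: F'_def bounded_bilinear.diff_left[OF bounded_bilinear_trace_prod])
qed

text \<open>By the resolvent identity an increment of \<open>inv_hat\<close> is exactly the integral
  of \<open>x u *\<^sub>R V u\<close> between \<open>inv_hat t\<close> and \<open>inv_hat s\<close>.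
  Replacing these two outer factors by their values at \<open>u\<close> costs a Lipschitz variation
  times the length of the interval, so the error is quadratic and jumps of \<open>x\<close> do no
  harm.\<close>

lemma inv_hat_increment:
  assumes "0 \<le> a" "a \<le> b" "b \<le> T"
  shows "integral {a..b} (\<lambda>t. x t *\<^sub>R P' t) = inv_hat b - inv_hat a"
proof -
  note mm = bounded_bilinear_matrix_mult[where 'n = 'n]
  obtain K where K: "0 < K" "\<And>A B. norm (A ** (B :: real^'n^'n) :: real^'n^'n) \<le> norm A * norm B * K"
    using bounded_bilinear.pos_bounded[OF mm] by blast
  obtain B where B: "0 < B" "\<And>t. t \<in> {0..T} \<Longrightarrow> norm (inv_hat t) \<le> B"
    by (rule continuous_on_Icc_norm_bound[OF continuous_inv_hat']) (rule that)
  obtain C where C: "0 < C" "\<And>t. t \<in> {0..real CARD('n)} \<Longrightarrow> norm (V t) \<le> C"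
    by (rule continuous_on_Icc_norm_bound[OF continuous_V]) (rule that)
  have xV: "norm (x t *\<^sub>R V t) \<le> C" if "t \<in> {0..T}" for t
    using mult_mono[of "\<bar>x t\<bar>" 1 "norm (V t)" C] x_range[of t] C(2)[of t] C(1) that T by simp
  have norm3: "norm (X ** Y ** Z) \<le> norm X * norm Y * norm Z * K\<^sup>2" for X Y Z :: "real^'n^'n"
  proof -
    have "norm (X ** Y ** Z) \<le> norm (X ** Y) * norm Z * K" by (rule K(2))
    also have "\<dots> \<le> (norm X * norm Y * K) * norm Z * K"
      using K(1) by (intro mult_right_mono K(2)) auto
    finally show ?thesis by (simp add: power2_eq_square mult_ac)
  qed
  have diff: "inv_hat t - inv_hat s = inv_hat t ** integral {s..t} (\<lambda>u. x u *\<^sub>R V u) ** inv_hat s"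
    if "0 \<le> s" "s \<le> t" "t \<le> T" for s t
  proof -
    have "hat_path x \<Psi> s - hat_path x \<Psi> t = integral {s..t} (\<lambda>u. x u *\<^sub>R V u)"
      using that T by (intro hat_diff) auto
    then have hd: "hat_path x \<Psi> t - hat_path x \<Psi> s = - integral {s..t} (\<lambda>u. x u *\<^sub>R V u)"
      by (simp only: minus_diff_eq flip: \<open>hat_path x \<Psi> s - hat_path x \<Psi> t = _\<close>)
    have "det (hat_path x \<Psi> s) \<noteq> 0" "det (hat_path x \<Psi> t) \<noteq> 0"
      using that by (auto intro!: det_hat)
    from matrix_inv_diff[OF this] show ?thesis
      by (simp only: inv_hat_def hd bounded_bilinear.minus_left[OF mm] bounded_bilinear.minus_right[OF mm] minus_minus)
  qed
  have lip: "norm (inv_hat t - inv_hat s) \<le> B * B * C * K\<^sup>2 * (t - s)" if st: "0 \<le> s" "s \<le> t" "t \<le> T" for s t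
  proof -
    have "norm (integral {s..t} (\<lambda>u. x u *\<^sub>R V u)) \<le> C * (t - s)"
      using st T by (intro norm_integral_le_const integrable_xV_sub xV) auto
    then have "norm (inv_hat t) * norm (integral {s..t} (\<lambda>u. x u *\<^sub>R V u)) * norm (inv_hat s) * K\<^sup>2
        \<le> B * (C * (t - s)) * B * K\<^sup>2"
      using B st C(1) by (intro mult_right_mono mult_mono) auto
    then show ?thesis
      unfolding diff[OF st] using norm3[of "inv_hat t" "integral {s..t} (\<lambda>u. x u *\<^sub>R V u)" "inv_hat s"]
      by (simp add: mult_ac)
  qed
  have int: "(\<lambda>t. x t *\<^sub>R P' t) integrable_on {s..t}" if "0 \<le> s" "t \<le> T" for s t
    using that T by (intro mono_on_times_continuous_integrable mono_on_subset[OF mono_x]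
        continuous_on_subset[OF continuous_P']) auto
  \<comment> \<open>\<open>B * B * C * K\<^sup>2\<close> is the Lipschitz constant of
    \<open>inv_hat\<close>; the bracket bounds the other two factors of the triple product. The
    factor 2 below counts the two outer factors.\<close>
  define M where "M = B * B * C * K\<^sup>2 * (C * B * K\<^sup>2)"
  show ?thesis
  proof (rule integral_eq_diff_if_quadratic_error[OF assms(2) int, where C = "2 * M"])
    fix s t assume st: "a \<le> s" "s \<le> t" "t \<le> b"
    then have st': "0 \<le> s" "s \<le> t" "t \<le> T" using assms by auto
    have "((\<lambda>u. inv_hat t ** (x u *\<^sub>R V u) ** inv_hat s) has_integral (inv_hat t - inv_hat s)) {s..t}"
      using has_integral_linear[OF integrable_integral[OF integrable_xV_sub, of s t]
          bounded_linear_compose[OF bounded_bilinear.bounded_linear_left[OF mm, of "inv_hat s"] bounded_bilinear.bounded_linear_right[OF mm, of "inv_hat t"]]]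
        st' T by (simp add: o_def diff)
    from has_integral_diff[OF this integrable_integral[OF int[of s t]]] st'
    have e: "((\<lambda>u. inv_hat t ** (x u *\<^sub>R V u) ** inv_hat s - x u *\<^sub>R P' u) has_integral
        (inv_hat t - inv_hat s - integral {s..t} (\<lambda>t. x t *\<^sub>R P' t))) {s..t}"
      by simp
    have "norm (inv_hat t ** (x u *\<^sub>R V u) ** inv_hat s - x u *\<^sub>R P' u) \<le> 2 * M * (t - s)"
      if u: "u \<in> {s..t}" for u
    proof -
      have u': "u \<in> {0..T}" using u st' by auto
      have "inv_hat t ** (x u *\<^sub>R V u) ** inv_hat s - x u *\<^sub>R P' u =
          (inv_hat t - inv_hat u) ** (x u *\<^sub>R V u) ** inv_hat s -
          inv_hat u ** (x u *\<^sub>R V u) ** (inv_hat u - inv_hat s)"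
        by (simp add: algebra_simps P'_def bounded_bilinear.diff_left[OF mm] bounded_bilinear.diff_right[OF mm] bounded_bilinear.scaleR_left[OF mm] bounded_bilinear.scaleR_right[OF mm])
      moreover have "norm ((inv_hat t - inv_hat u) ** (x u *\<^sub>R V u) ** inv_hat s) \<le> M * (t - s)"
      proof -
        have "norm (inv_hat t - inv_hat u) \<le> B * B * C * K\<^sup>2 * (t - s)"
          using order_trans[OF lip[of u t] mult_left_mono[of "t - u" "t - s" "B * B * C * K\<^sup>2"]] u st' B C
          by auto
        then have "norm (inv_hat t - inv_hat u) * norm (x u *\<^sub>R V u) * norm (inv_hat s) * K\<^sup>2
            \<le> (B * B * C * K\<^sup>2 * (t - s)) * C * B * K\<^sup>2"
          using B(2)[of s] xV[OF u'] st' B(1) C(1) by (intro mult_right_mono mult_mono) auto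
        then show ?thesis
          using norm3[of "inv_hat t - inv_hat u" "x u *\<^sub>R V u" "inv_hat s"] by (simp add: M_def mult_ac)
      qed
      moreover have "norm (inv_hat u ** (x u *\<^sub>R V u) ** (inv_hat u - inv_hat s)) \<le> M * (t - s)"
      proof -
        have "norm (inv_hat u - inv_hat s) \<le> B * B * C * K\<^sup>2 * (t - s)"
          using order_trans[OF lip[of s u] mult_left_mono[of "u - s" "t - s" "B * B * C * K\<^sup>2"]] u st' B C
          by auto
        then have "norm (inv_hat u) * norm (x u *\<^sub>R V u) * norm (inv_hat u - inv_hat s) * K\<^sup>2
            \<le> B * C * (B * B * C * K\<^sup>2 * (t - s)) * K\<^sup>2"
          using B(2)[of u] xV[OF u'] u' B(1) C(1) by (intro mult_right_mono mult_mono) auto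
        then show ?thesis
          using norm3[of "inv_hat u" "x u *\<^sub>R V u" "inv_hat u - inv_hat s"] by (simp add: M_def mult_ac)
      qed
      ultimately show ?thesis
        using norm_triangle_ineq4[of "(inv_hat t - inv_hat u) ** (x u *\<^sub>R V u) ** inv_hat s"
            "inv_hat u ** (x u *\<^sub>R V u) ** (inv_hat u - inv_hat s)"] by simp
    qed
    from norm_integral_le_const[OF st'(2) has_integral_integrable[OF e] this]
    show "norm (inv_hat t - inv_hat s - integral {s..t} (\<lambda>t. x t *\<^sub>R P' t)) \<le> 2 * M * (t - s)\<^sup>2"
      by (simp add: integral_unique[OF e] power2_eq_square mult_ac)
  qed (use assms in auto)
qed

end

subsection \<open>The first variation\<close>

lemma integral_Icc_eq_if_zero:
  fixes f :: "real \<Rightarrow> real"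
  assumes "T \<le> m" and zero: "\<And>t. T < t \<Longrightarrow> t \<le> m \<Longrightarrow> f t = 0"
  shows "integral {0..m} f = integral {0..T} f"
proof -
  have "integral {0..m} f = integral {0..m} (\<lambda>t. if t \<in> {0..T} then f t else 0)"
    by (rule integral_cong) (use zero in auto)
  also have "\<dots> = integral ({0..T} \<inter> {0..m}) f"
    by (rule Henstock_Kurzweil_Integration.integral_restrict_Int)
  also have "{0..T} \<inter> {0..m} = {0..T}" using \<open>T \<le> m\<close> by auto
  finally show ?thesis .
qed

text \<open>\<open>W\<close> is the velocity of the direction. Since its integral is 0 and it
  vanishes from \<open>c\<close> on, the direction vanishes there too, so the right end, the cutoff
  and the log-determinant do not move. Positivity is asked for on the side e \<ge> 0 only, because
  removing and reinserting increments is not reversible in general.\<close>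

locale cs_variation = cs_path \<beta> h Q x \<Psi> T
  for \<beta> :: "nat \<Rightarrow> real^'n" and h Q x \<Psi> T +
  fixes W :: "real \<Rightarrow> real^'n^'n" and c M :: real
  assumes W_lipschitz: "M-lipschitz_on {0..real CARD('n)} W"
    and W_zero: "\<And>t. t \<in> {c..real CARD('n)} \<Longrightarrow> W t = 0"
    and c: "0 \<le> c" "c \<le> T"
    and W_integral: "integral {0..c} W = 0"
    and psd_VW: "\<And>e t. e \<in> {0..1} \<Longrightarrow> t \<in> {0..real CARD('n)} \<Longrightarrow> psd (path_deriv \<Psi> t + e *\<^sub>R W t)"
begin

definition \<Delta> :: "real \<Rightarrow> real^'n^'n" where
  "\<Delta> t = integral {0..t} W"

text \<open>The derivative of the hat path in the direction; as the hat path is linear in the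
  velocity, \<open>hat_varied\<close> holds without remainder.\<close>

definition K :: "real \<Rightarrow> real^'n^'n" where
  "K t = integral {t..real CARD('n)} (\<lambda>u. x u *\<^sub>R W u)"

definition varied :: "real \<Rightarrow> real \<Rightarrow> real^'n^'n" where
  "varied e t = \<Psi> t + e *\<^sub>R \<Delta> t"

lemma continuous_W: "continuous_on {0..real CARD('n)} W"
  using W_lipschitz by (rule lipschitz_on_continuous_on)

lemma \<Delta>_deriv: "t \<in> {0..real CARD('n)} \<Longrightarrow> (\<Delta> has_vector_derivative W t) (at t within {0..real CARD('n)})"
  unfolding \<Delta>_def[abs_def] by (rule integral_has_vector_derivative[OF continuous_W])

lemma continuous_\<Delta>: "continuous_on {0..real CARD('n)} \<Delta>"
  using \<Delta>_deriv by (intro continuous_on_vector_derivative) auto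

lemma \<Delta>_0: "\<Delta> 0 = 0"
  by (simp add: \<Delta>_def)

lemma \<Delta>_zero:
  assumes t: "t \<in> {c..real CARD('n)}"
  shows "\<Delta> t = 0"
proof -
  have "W integrable_on {0..t}"
    using t by (intro integrable_continuous_real continuous_on_subset[OF continuous_W]) auto
  then have "integral {0..c} W + integral {c..t} W = \<Delta> t"
    unfolding \<Delta>_def using t c by (intro Henstock_Kurzweil_Integration.integral_combine) auto
  moreover have "integral {c..t} W = integral {c..t} (\<lambda>_. 0)"
    by (rule integral_cong) (use t W_zero in auto)
  ultimately show ?thesis by (simp add: W_integral)
qed

lemma symmetric_W: "t \<in> {0..real CARD('n)} \<Longrightarrow> transpose (W t) = W t"
  using psd_VW[of 1 t] psd_V[of t]
  by (simp add: psd_def linear_add[OF bounded_linear.linear[OF bounded_linear_transpose]])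

lemma symmetric_\<Delta>:
  assumes t: "t \<in> {0..real CARD('n)}"
  shows "transpose (\<Delta> t) = \<Delta> t"
proof -
  have "W integrable_on {0..t}"
    using t by (intro integrable_continuous_real continuous_on_subset[OF continuous_W]) auto
  from integral_linear[OF this bounded_linear_transpose]
  have "transpose (\<Delta> t) = integral {0..t} (\<lambda>u. transpose (W u))"
    by (simp add: \<Delta>_def o_def)
  also have "\<dots> = \<Delta> t"
    unfolding \<Delta>_def by (rule integral_cong) (use t in \<open>auto simp: symmetric_W\<close>)
  finally show ?thesis .
qed

lemma integrable_xW: "0 \<le> s \<Longrightarrow> t \<le> real CARD('n) \<Longrightarrow> (\<lambda>t. x t *\<^sub>R W t) integrable_on {s..t}"
  by (intro mono_on_times_continuous_integrable mono_on_subset[OF mono_x]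
      continuous_on_subset[OF continuous_W]) auto

lemma K_diff:
  assumes "0 \<le> s" "s \<le> t" "t \<le> real CARD('n)"
  shows "K s - K t = integral {s..t} (\<lambda>u. x u *\<^sub>R W u)"
proof -
  have "integral {s..t} (\<lambda>u. x u *\<^sub>R W u) + K t = K s"
    unfolding K_def
    by (intro Henstock_Kurzweil_Integration.integral_combine integrable_xW) (use assms in auto)
  then show ?thesis by (simp add: algebra_simps)
qed

lemma K_T: "K T = 0"
proof -
  have "K T = integral {T..real CARD('n)} (\<lambda>_. 0)"
    unfolding K_def by (rule integral_cong) (use W_zero c in auto)
  then show ?thesis by simp
qed

lemma continuous_K: "continuous_on {0..real CARD('n)} K"
proof -
  have "continuous_on {0..real CARD('n)} (\<lambda>t. K 0 - integral {0..t} (\<lambda>u. x u *\<^sub>R W u))"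
    by (intro continuous_intros indefinite_integral_continuous_1 integrable_xW) auto
  then show ?thesis
  proof (rule continuous_on_eq)
    show "K 0 - integral {0..t} (\<lambda>u. x u *\<^sub>R W u) = K t" if "t \<in> {0..real CARD('n)}" for t
      using K_diff[of 0 t] that by (simp add: algebra_simps)
  qed
qed

lemma varied_deriv:
  "t \<in> {0..real CARD('n)} \<Longrightarrow>
    (varied e has_vector_derivative V t + e *\<^sub>R W t) (at t within {0..real CARD('n)})"
  unfolding varied_def[abs_def]
  by (intro has_vector_derivative_add deriv bounded_linear.has_vector_derivative[OF bounded_linear_scaleR_right] \<Delta>_deriv)

lemma varied_lipschitz: "\<exists>L. L-lipschitz_on {0..real CARD('n)} (\<lambda>t. V t + e *\<^sub>R W t)"
proof -
  obtain L where "L-lipschitz_on {0..real CARD('n)} V"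
    using path by (auto simp: C1_monotone_path_def)
  from lipschitz_on_add[OF this lipschitz_on_cmult[OF W_lipschitz, of e]] show ?thesis by blast
qed

lemma varied_ends: "varied e 0 = 0" "varied e (real CARD('n)) = Q"
  using path_ends c T by (simp_all add: varied_def \<Delta>_0 \<Delta>_zero)

lemma varied_path:
  assumes "e \<in> {0..1}"
  shows "C1_monotone_path Q (varied e)"
    and "\<And>t. t \<in> {0..real CARD('n)} \<Longrightarrow> path_deriv (varied e) t = V t + e *\<^sub>R W t"
proof -
  obtain L where L: "L-lipschitz_on {0..real CARD('n)} (\<lambda>t. V t + e *\<^sub>R W t)"
    using varied_lipschitz by blast
  show "C1_monotone_path Q (varied e)"
    by (rule C1_monotone_pathI(1)[OF varied_deriv psd_VW[OF assms] L varied_ends])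
  show "path_deriv (varied e) t = V t + e *\<^sub>R W t" if "t \<in> {0..real CARD('n)}" for t
    by (rule C1_monotone_pathI(2)[OF varied_deriv psd_VW[OF assms] L varied_ends that])
qed

lemma varied_eq: "t \<in> {c..real CARD('n)} \<Longrightarrow> varied e t = \<Psi> t"
  by (simp add: varied_def \<Delta>_zero)

lemma cs_path_varied:
  assumes "e \<in> {0..1}"
  shows "cs_path \<beta> Q x (varied e) T"
  using beta_summable Q_diag cdf varied_path(1)[OF assms] T det_T varied_eq[of T e] c
  by unfold_locales auto

lemma hat_varied:
  assumes e: "e \<in> {0..1}" and t: "t \<in> {0..real CARD('n)}"
  shows "hat_path x (varied e) t = hat_path x \<Psi> t + e *\<^sub>R K t"
proof -
  have "hat_path x (varied e) t = integral {t..real CARD('n)} (\<lambda>u. x u *\<^sub>R V u + e *\<^sub>R (x u *\<^sub>R W u))"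
    unfolding hat_path_def
    by (rule integral_cong) (use t in \<open>simp add: varied_path(2)[OF e] scaleR_add_right mult.commute\<close>)
  also have "\<dots> = hat_path x \<Psi> t + e *\<^sub>R K t"
    unfolding hat_path_def K_def
    using t integrable_xV_sub[of t "real CARD('n)"] integrable_xW[of t "real CARD('n)"]
    by (simp only: integral_add integrable_cmul integral_cmul atLeastAtMost_iff order_refl)
  finally show ?thesis .
qed

text \<open>The first variation becomes half the integral of \<open>x t * w' t\<close>, which
  encodes the Stieltjes integral of \<open>-w\<close> against \<open>x\<close> without any measure.
  As \<open>w\<close> vanishes at 0 and from \<open>c\<close> on, neither boundary terms nor an atom
  at 0 contribute.\<close>

definition w :: "real \<Rightarrow> real" where
  "w t = trace_prod (F t) (\<Delta> t)"

definition w' :: "real \<Rightarrow> real" where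
  "w' t = trace_prod (F' t) (\<Delta> t) + trace_prod (F t) (W t)"

lemma w_deriv:
  assumes t: "t \<in> {0..T}"
  shows "(w has_real_derivative w' t) (at t within {0..T})"
proof -
  have "(\<Delta> has_vector_derivative W t) (at t within {0..T})"
    by (rule has_vector_derivative_within_subset[OF \<Delta>_deriv]) (use t T in auto)
  from bounded_bilinear.has_vector_derivative[OF bounded_bilinear_trace_prod F_deriv[OF t] this]
  show ?thesis
    unfolding w_def[abs_def] w'_def has_real_derivative_iff_has_vector_derivative
    by (simp add: add.commute)
qed

text \<open>The left side is the derivative of the integral with the inverse hat path. One
  integration by parts uses the increments of \<open>inv_hat\<close>, the other those of
  \<open>K\<close>, which are integrals of \<open>- (x t *\<^sub>R W t)\<close>. The boundary terms
  drop out because \<Delta> vanishes at 0 and T, \<open>K\<close> at T and \<open>P\<close> at 0.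
  The result has the weight \<open>x\<close> in front, like the other part of the
  functional.\<close>

lemma integral_by_parts_inv_hat:
  "integral {0..T} (\<lambda>t. trace_prod (inv_hat t) (W t) - trace_prod (K t) (P' t)) =
    - integral {0..T} (\<lambda>t. x t * (trace_prod (P' t) (\<Delta> t) + trace_prod (P t) (W t)))"
proof -
  note tp = bounded_bilinear_trace_prod[where 'n = 'n]
  have sub: "{0..T} \<subseteq> {0..real CARD('n)}" using T by auto
  note contW = continuous_on_subset[OF continuous_W sub]
  note cont\<Delta> = continuous_on_subset[OF continuous_\<Delta> sub]
  note monoT = mono_on_subset[OF mono_x sub]
  have contP: "continuous_on {0..T} P" using P_deriv by (intro continuous_on_vector_derivative) auto
  obtain B where B: "\<And>t. t \<in> {0..T} \<Longrightarrow> norm (P' t) \<le> B"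
    by (rule continuous_on_Icc_norm_bound[OF continuous_P']) (rule that)
  obtain C where C: "\<And>t. t \<in> {0..T} \<Longrightarrow> norm (W t) \<le> C"
    by (rule continuous_on_Icc_norm_bound[OF contW]) (rule that)
  have xle: "norm (x t *\<^sub>R Z) \<le> b" if "t \<in> {0..T}" "norm Z \<le> b" for t b and Z :: "real^'n^'n"
    using mult_right_mono[of "\<bar>x t\<bar>" 1 "norm Z"] x_range[of t] that T by auto
  have i1: "(\<lambda>t. x t * trace_prod (P' t) (\<Delta> t)) integrable_on {0..T}"
    using mono_on_times_continuous_integrable[OF monoT, of "\<lambda>t. trace_prod (P' t) (\<Delta> t)"]
    by (simp add: continuous_intros continuous_P' cont\<Delta>)
  have i2: "(\<lambda>t. x t * trace_prod (W t) (P t)) integrable_on {0..T}"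
    using mono_on_times_continuous_integrable[OF monoT, of "\<lambda>t. trace_prod (W t) (P t)"]
    by (simp add: continuous_intros contP contW)
  have i3: "(\<lambda>t. trace_prod (inv_hat t) (W t)) integrable_on {0..T}"
    by (intro integrable_continuous_real continuous_intros continuous_inv_hat' contW)
  have i4: "(\<lambda>t. trace_prod (K t) (P' t)) integrable_on {0..T}"
    by (intro integrable_continuous_real continuous_intros continuous_P' continuous_on_subset[OF continuous_K sub])
  have "integral {0..T} (\<lambda>t. trace_prod (x t *\<^sub>R P' t) (\<Delta> t) + trace_prod (inv_hat t) (W t)) =
      trace_prod (inv_hat T) (\<Delta> T) - trace_prod (inv_hat 0) (\<Delta> 0)"
  proof (rule integral_by_parts_bilinear[OF tp])
    show "(\<lambda>t. x t *\<^sub>R P' t) integrable_on {0..T}"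
      by (rule mono_on_times_continuous_integrable[OF monoT continuous_P'])
    show "norm (x t *\<^sub>R P' t) \<le> B" if "t \<in> {0..T}" for t by (rule xle[OF that B[OF that]])
    show "(\<Delta> has_vector_derivative W t) (at t within {0..T})" if "t \<in> {0..T}" for t
      by (rule has_vector_derivative_within_subset[OF \<Delta>_deriv sub]) (use that sub in auto)
    show "(\<lambda>t. trace_prod (x t *\<^sub>R P' t) (\<Delta> t)) integrable_on {0..T}"
      using i1 by (simp add: bounded_bilinear.scaleR_left[OF tp])
  qed (use T inv_hat_increment contW in auto)
  also have "\<dots> = 0"
    using c T \<Delta>_zero[of T] by (simp add: \<Delta>_0 bounded_bilinear.zero_right[OF tp])
  finally have "integral {0..T} (\<lambda>t. x t * trace_prod (P' t) (\<Delta> t) + trace_prod (inv_hat t) (W t)) = 0"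
    by (simp add: bounded_bilinear.scaleR_left[OF tp])
  then have e1: "integral {0..T} (\<lambda>t. x t * trace_prod (P' t) (\<Delta> t)) +
      integral {0..T} (\<lambda>t. trace_prod (inv_hat t) (W t)) = 0"
    by (simp add: integral_add[OF i1 i3])
  have "integral {0..T} (\<lambda>t. trace_prod (- (x t *\<^sub>R W t)) (P t) + trace_prod (K t) (P' t)) =
      trace_prod (K T) (P T) - trace_prod (K 0) (P 0)"
  proof (rule integral_by_parts_bilinear[OF tp])
    show "(\<lambda>t. - (x t *\<^sub>R W t)) integrable_on {0..T}"
      using mono_on_times_continuous_integrable[OF monoT contW] by (rule integrable_neg)
    show "norm (- (x t *\<^sub>R W t)) \<le> C" if "t \<in> {0..T}" for t
      using xle[OF that C[OF that]] by simp
    show "integral {s..t} (\<lambda>t. - (x t *\<^sub>R W t)) = K t - K s" if "0 \<le> s" "s \<le> t" "t \<le> T" for s t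
      using K_diff[of s t] that T by (simp flip: minus_diff_eq[of "K s" "K t"])
    show "(\<lambda>t. trace_prod (- (x t *\<^sub>R W t)) (P t)) integrable_on {0..T}"
      using integrable_neg[OF i2]
      by (simp add: bounded_bilinear.scaleR_left[OF tp] bounded_bilinear.minus_left[OF tp])
  qed (use T P_deriv continuous_P' in auto)
  also have "\<dots> = 0"
    by (simp add: K_T P_def bounded_bilinear.zero_left[OF tp] bounded_bilinear.zero_right[OF tp])
  finally have "integral {0..T} (\<lambda>t. - (x t * trace_prod (W t) (P t)) + trace_prod (K t) (P' t)) = 0"
    by (simp add: bounded_bilinear.scaleR_left[OF tp] bounded_bilinear.minus_left[OF tp])
  then have e2: "integral {0..T} (\<lambda>t. trace_prod (K t) (P' t)) =
      integral {0..T} (\<lambda>t. x t * trace_prod (W t) (P t))"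
    using integral_diff[OF i4 i2] by (simp add: algebra_simps)
  have "integral {0..T} (\<lambda>t. x t * (trace_prod (P' t) (\<Delta> t) + trace_prod (P t) (W t))) =
      integral {0..T} (\<lambda>t. x t * trace_prod (P' t) (\<Delta> t)) + integral {0..T} (\<lambda>t. x t * trace_prod (W t) (P t))"
    by (simp add: distrib_left trace_prod_commute[of "P _"] integral_add[OF i1 i2])
  moreover have "integral {0..T} (\<lambda>t. trace_prod (inv_hat t) (W t) - trace_prod (K t) (P' t)) =
      integral {0..T} (\<lambda>t. trace_prod (inv_hat t) (W t)) - integral {0..T} (\<lambda>t. trace_prod (K t) (P' t))"
    by (rule integral_diff[OF i3 i4])
  ultimately show ?thesis using e1 e2 by simp
qed

lemma continuous_on_inv_hat_varied:
  "continuous_on ({0..1} \<times> {0..T}) (\<lambda>z. matrix_inv (hat_path x \<Psi> (snd z) + fst z *\<^sub>R K (snd z)))"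
proof (rule continuous_on_matrix_inv)
  show "continuous_on ({0..1} \<times> {0..T}) (\<lambda>z. hat_path x \<Psi> (snd z) + fst z *\<^sub>R K (snd z))"
    using T by (intro continuous_intros continuous_on_snd_param
        continuous_on_subset[OF continuous_hat] continuous_on_subset[OF continuous_K]) auto
  fix z :: "real \<times> real" assume z: "z \<in> {0..1} \<times> {0..T}"
  \<comment> \<open>The varied path is again an instance of the locale, so nonsingularity holds for
    every e in [0, 1], not only for small e.\<close>
  interpret v: cs_path \<beta> h Q x "varied (fst z)" T
    using z by (intro cs_path_varied) auto
  have "det (hat_path x (varied (fst z)) (snd z)) \<noteq> 0" using z by (intro v.det_hat) auto
  then show "det (hat_path x \<Psi> (snd z) + fst z *\<^sub>R K (snd z)) \<noteq> 0"
    using z T by (subst hat_varied[symmetric]) auto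
qed

text \<open>The resolvent identity gives the factor e exactly. The cofactor \<phi> is continuous up
  to e = 0, so its value there is the one-sided derivative.\<close>

lemma internal_variation:
  obtains \<phi> where "continuous_on {0..1} \<phi>"
    "\<And>e. e \<in> {0..1} \<Longrightarrow>
      integral {0..T} (\<lambda>t. trace_prod (matrix_inv (hat_path x (varied e) t)) (path_deriv (varied e) t)) -
      integral {0..T} (\<lambda>t. trace_prod (inv_hat t) (V t)) = e * \<phi> e"
    "\<phi> 0 = integral {0..T} (\<lambda>t. trace_prod (inv_hat t) (W t) - trace_prod (K t) (P' t))"
proof
  note tp = bounded_bilinear_trace_prod[where 'n = 'n]
  note mm = bounded_bilinear_matrix_mult[where 'n = 'n]
  define N where "N e t = matrix_inv (hat_path x \<Psi> t + e *\<^sub>R K t)" for e t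
  define r where "r e t = trace_prod (N e t) (W t) - trace_prod (N e t ** K t ** inv_hat t) (V t)" for e t
  have sub: "{0..T} \<subseteq> {0..real CARD('n)}" using T by auto
  have contN: "continuous_on ({0..1} \<times> {0..T}) (\<lambda>z. N (fst z) (snd z))"
    unfolding N_def by (rule continuous_on_inv_hat_varied)
  have contr: "continuous_on ({0..1} \<times> cbox 0 T) (\<lambda>(e, t). r e t)"
    unfolding r_def case_prod_unfold cbox_interval
    by (intro continuous_intros contN continuous_on_snd_param continuous_inv_hat'
        continuous_on_subset[OF continuous_W sub] continuous_on_subset[OF continuous_V sub]
        continuous_on_subset[OF continuous_K sub])
  show "continuous_on {0..1} (\<lambda>e. integral {0..T} (r e))"
    using integral_continuous_on_param[OF contr] by simp
  show "integral {0..T} (r 0) = integral {0..T} (\<lambda>t. trace_prod (inv_hat t) (W t) - trace_prod (K t) (P' t))"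
  proof (rule integral_cong)
    fix t
    have "trace_prod (inv_hat t ** K t ** inv_hat t) (V t) = trace_prod (K t) (P' t)"
      using trace_prod_rotate[of "inv_hat t" "K t ** inv_hat t" "V t"]
        trace_prod_assoc[of "K t" "inv_hat t" "V t ** inv_hat t"]
      by (simp add: P'_def matrix_mul_assoc)
    then show "r 0 t = trace_prod (inv_hat t) (W t) - trace_prod (K t) (P' t)"
      by (simp add: r_def N_def inv_hat_def)
  qed
  fix e :: real assume e: "e \<in> {0..1}"
  interpret v: cs_path \<beta> h Q x "varied e" T by (rule cs_path_varied[OF e])
  have i1: "(\<lambda>t. trace_prod (N e t) (V t + e *\<^sub>R W t)) integrable_on {0..T}"
  proof (intro integrable_continuous_real continuous_intros
      continuous_on_subset[OF continuous_W sub] continuous_on_subset[OF continuous_V sub])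
    have "continuous_on {0..T} (\<lambda>t. (\<lambda>z. N (fst z) (snd z)) (e, t))"
      by (rule continuous_on_compose2[OF contN]) (use e in \<open>auto intro!: continuous_intros\<close>)
    then show "continuous_on {0..T} (N e)" by simp
  qed
  have i0: "(\<lambda>t. trace_prod (inv_hat t) (V t)) integrable_on {0..T}"
    by (intro integrable_continuous_real continuous_intros continuous_inv_hat' continuous_on_subset[OF continuous_V sub])
  have "integral {0..T} (\<lambda>t. trace_prod (matrix_inv (hat_path x (varied e) t)) (path_deriv (varied e) t))
      = integral {0..T} (\<lambda>t. trace_prod (N e t) (V t + e *\<^sub>R W t))"
    by (rule integral_cong) (use sub in \<open>auto simp: N_def hat_varied[OF e] varied_path(2)[OF e] subset_iff\<close>)
  then have "integral {0..T} (\<lambda>t. trace_prod (matrix_inv (hat_path x (varied e) t)) (path_deriv (varied e) t)) -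
      integral {0..T} (\<lambda>t. trace_prod (inv_hat t) (V t)) =
      integral {0..T} (\<lambda>t. trace_prod (N e t) (V t + e *\<^sub>R W t) - trace_prod (inv_hat t) (V t))"
    by (simp add: integral_diff[OF i1 i0])
  also have "\<dots> = integral {0..T} (\<lambda>t. e * r e t)"
  proof (rule integral_cong)
    fix t assume t: "t \<in> {0..T}"
    have "det (hat_path x \<Psi> t + e *\<^sub>R K t) \<noteq> 0"
      using v.det_hat[OF t] hat_varied[OF e, of t] t sub by auto
    from matrix_inv_diff[OF det_hat[OF t] this]
    have "N e t - inv_hat t = - e *\<^sub>R (N e t ** K t ** inv_hat t)"
      by (simp add: N_def inv_hat_def bounded_bilinear.scaleR_left[OF mm] bounded_bilinear.scaleR_right[OF mm])
    then have "trace_prod (N e t) (V t) - trace_prod (inv_hat t) (V t) =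
        - e * trace_prod (N e t ** K t ** inv_hat t) (V t)"
      by (simp add: bounded_bilinear.scaleR_left[OF tp] bounded_bilinear.minus_left[OF tp]
          flip: bounded_bilinear.diff_left[OF tp])
    then show "trace_prod (N e t) (V t + e *\<^sub>R W t) - trace_prod (inv_hat t) (V t) = e * r e t"
      by (simp add: r_def bounded_bilinear.add_right[OF tp] bounded_bilinear.scaleR_right[OF tp] algebra_simps)
  qed
  also have "\<dots> = e * integral {0..T} (r e)" by simp
  finally show "integral {0..T} (\<lambda>t. trace_prod (matrix_inv (hat_path x (varied e) t)) (path_deriv (varied e) t)) -
      integral {0..T} (\<lambda>t. trace_prod (inv_hat t) (V t)) = e * integral {0..T} (r e)" .
qed

text \<open>The same factorization, with divided differences of the entries of \<xi>' in the place
  of the resolvent identity.\<close>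

lemma external_variation:
  obtains \<phi> where "continuous_on {0..1} \<phi>"
    "\<And>e. e \<in> {0..1} \<Longrightarrow>
      integral {0..real CARD('n)} (\<lambda>t. x t * trace_prod (xi_deriv \<beta> (varied e t) + outer h h) (path_deriv (varied e) t)) -
      integral {0..real CARD('n)} (\<lambda>t. x t * trace_prod (xi_deriv \<beta> (\<Psi> t) + outer h h) (V t)) = e * \<phi> e"
    "\<phi> 0 = integral {0..T} (\<lambda>t. x t * (trace_prod (A' t) (\<Delta> t) +
      trace_prod (xi_deriv \<beta> (\<Psi> t) + outer h h) (W t)))"
proof -
  note tp = bounded_bilinear_trace_prod[where 'n = 'n]
  let ?m = "real CARD('n)"
  let ?f = "\<lambda>i j u. \<Sum>n. xi_coeff \<beta> i j n * u ^ n"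
  let ?f' = "\<lambda>i j u. \<Sum>n. diffs (xi_coeff \<beta> i j) n * u ^ n"
  \<comment> \<open>The properties are bundled into one predicate so that a divided difference can
    be chosen for each entry.\<close>
  define D where "D i j d \<longleftrightarrow> continuous_on ({-1..1} \<times> {-1..1}) (\<lambda>(u, v). d u v) \<and>
      (\<forall>u\<in>{-1..1}. \<forall>v\<in>{-1..1}. ?f i j v - ?f i j u = (v - u) * d u v) \<and> (\<forall>u. d u u = ?f' i j u)"
    for i j and d :: "real \<Rightarrow> real \<Rightarrow> real"
  have D_ex: "\<exists>d. D i j d" for i j
  proof (rule divided_difference[of "?f i j" "?f' i j"])
    show "(?f i j has_real_derivative ?f' i j u) (at u)" "isCont (?f' i j) u" if "u \<in> {-1..1}" for u
      by (rule power_series_C1[OF summable_xi_coeff[OF beta_summable] that])+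
  qed (auto simp: D_def)
  define d where "d i j = (SOME d. D i j d)" for i j
  have d: "D i j (d i j)" for i j
    unfolding d_def by (rule someI_ex[OF D_ex])
  have d_cont: "continuous_on ({-1..1} \<times> {-1..1}) (\<lambda>(u, v). d i j u v)"
    and d_diff: "u \<in> {-1..1} \<Longrightarrow> v \<in> {-1..1} \<Longrightarrow> ?f i j v - ?f i j u = (v - u) * d i j u v"
    and d_diag: "d i j u u = ?f' i j u" for i j u v
    using d[of i j] unfolding D_def by simp_all
  define E where "E e t = (\<chi> i j. \<Delta> t $ i $ j * d i j (\<Psi> t $ i $ j) (varied e t $ i $ j))" for e t
  define \<rho> where "\<rho> e t = trace_prod (E e t) (V t + e *\<^sub>R W t) +
      trace_prod (xi_deriv \<beta> (\<Psi> t) + outer h h) (W t)" for e t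
  have entry: "\<Psi> t $ i $ j \<in> {-1..1}" if "t \<in> {0..?m}" for t i j
    using entry_bound[OF that, of i j] by (simp add: abs_le_iff)
  have entry_v: "varied e t $ i $ j \<in> {-1..1}" if "t \<in> {0..?m}" "e \<in> {0..1}" for e t i j
  proof -
    interpret v: cs_path \<beta> h Q x "varied e" T by (rule cs_path_varied[OF that(2)])
    show ?thesis using v.entry_bound[OF that(1), of i j] by (simp add: abs_le_iff)
  qed
  have contE: "continuous_on ({0..1} \<times> {0..?m}) (\<lambda>z. E (fst z) (snd z))"
    unfolding E_def
  proof (intro continuous_on_vec_lambda continuous_on_mult)
    fix i j
    show "continuous_on ({0..1} \<times> {0..?m}) (\<lambda>z. \<Delta> (snd z) $ i $ j)"
      by (intro continuous_intros continuous_on_snd_param continuous_\<Delta>)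
    have "continuous_on ({0..1} \<times> {0..?m}) (\<lambda>z. (\<Psi> (snd z) $ i $ j, varied (fst z) (snd z) $ i $ j))"
      unfolding varied_def
      by (intro continuous_intros continuous_on_snd_param continuous_\<Delta> continuous_path)
    from continuous_on_compose2[OF d_cont[of i j] this]
    show "continuous_on ({0..1} \<times> {0..?m}) (\<lambda>z. d i j (\<Psi> (snd z) $ i $ j) (varied (fst z) (snd z) $ i $ j))"
      using entry entry_v by (fastforce simp: image_subset_iff)
  qed
  have cont\<rho>: "continuous_on ({0..1} \<times> {0..?m}) (\<lambda>(e, t). \<rho> e t)"
    unfolding \<rho>_def case_prod_unfold
    by (intro continuous_intros contE continuous_on_snd_param continuous_W continuous_V continuous_xi_deriv)
  show thesis
  proof (rule that)
    show "continuous_on {0..1} (\<lambda>e. integral {0..?m} (\<lambda>t. x t * \<rho> e t))"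
      by (rule mono_weighted_integral_continuous_on_param[OF mono_x _ _ cont\<rho>]) (use x_range in auto)
    have "\<rho> 0 t = trace_prod (A' t) (\<Delta> t) + trace_prod (xi_deriv \<beta> (\<Psi> t) + outer h h) (W t)"
      if t: "t \<in> {0..?m}" for t
    proof -
      \<comment> \<open>\<open>trace_prod\<close> pairs the entry (i, j) with (j, i); the symmetry
        of both matrices is what allows them to exchange their roles.\<close>
      have "\<Delta> t $ j $ i = \<Delta> t $ i $ j" "V t $ j $ i = V t $ i $ j" for i j
        using symmetric_\<Delta>[OF t] psd_V[OF t] by (auto simp: psd_def transpose_def vec_eq_iff)
      then have "trace_prod (E 0 t) (V t) = trace_prod (A' t) (\<Delta> t)"
        by (simp add: trace_prod_sum E_def A'_def varied_def d_diag mult_ac)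
      then show ?thesis by (simp add: \<rho>_def)
    qed
    then have "integral {0..?m} (\<lambda>t. x t * \<rho> 0 t) = integral {0..?m} (\<lambda>t. x t * (trace_prod (A' t) (\<Delta> t) +
        trace_prod (xi_deriv \<beta> (\<Psi> t) + outer h h) (W t)))"
      by (intro integral_cong) auto
    also have "\<dots> = integral {0..T} (\<lambda>t. x t * (trace_prod (A' t) (\<Delta> t) +
        trace_prod (xi_deriv \<beta> (\<Psi> t) + outer h h) (W t)))"
      by (rule integral_Icc_eq_if_zero) (use c T W_zero \<Delta>_zero in \<open>auto simp: bounded_bilinear.zero_right[OF tp]\<close>)
    finally show "integral {0..?m} (\<lambda>t. x t * \<rho> 0 t) = integral {0..T} (\<lambda>t. x t * (trace_prod (A' t) (\<Delta> t) +
      trace_prod (xi_deriv \<beta> (\<Psi> t) + outer h h) (W t)))" .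
    fix e :: real assume e: "e \<in> {0..1}"
    interpret v: cs_path \<beta> h Q x "varied e" T by (rule cs_path_varied[OF e])
    have "integral {0..?m} (\<lambda>t. x t * trace_prod (xi_deriv \<beta> (varied e t) + outer h h) (path_deriv (varied e) t)) -
        integral {0..?m} (\<lambda>t. x t * trace_prod (xi_deriv \<beta> (\<Psi> t) + outer h h) (V t)) =
        integral {0..?m} (\<lambda>t. x t * trace_prod (xi_deriv \<beta> (varied e t) + outer h h) (path_deriv (varied e) t) -
          x t * trace_prod (xi_deriv \<beta> (\<Psi> t) + outer h h) (V t))"
      using v.external_integrand external_integrand
      by (intro integral_diff[symmetric]) (auto simp: absolutely_integrable_on_def)
    also have "\<dots> = integral {0..?m} (\<lambda>t. e * (x t * \<rho> e t))"
    proof (rule integral_cong)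
      fix t assume t: "t \<in> {0..?m}"
      have "xi_deriv \<beta> (varied e t) = xi_deriv \<beta> (\<Psi> t) + e *\<^sub>R E e t"
      proof -
        have "?f i j (varied e t $ i $ j) - ?f i j (\<Psi> t $ i $ j) = e * E e t $ i $ j" for i j
          using d_diff[OF entry[OF t] entry_v[OF t e], of i j i j] by (simp add: E_def varied_def)
        then show ?thesis
          by (simp add: vec_eq_iff xi_deriv_component[OF beta_summable entry_bound[OF t]]
              xi_deriv_component[OF beta_summable v.entry_bound[OF t]] algebra_simps)
      qed
      then show "x t * trace_prod (xi_deriv \<beta> (varied e t) + outer h h) (path_deriv (varied e) t) -
          x t * trace_prod (xi_deriv \<beta> (\<Psi> t) + outer h h) (V t) = e * (x t * \<rho> e t)"
        by (simp add: \<rho>_def varied_path(2)[OF e t] bounded_bilinear.add_right[OF tp]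
            bounded_bilinear.add_left[OF tp] bounded_bilinear.scaleR_right[OF tp]
            bounded_bilinear.scaleR_left[OF tp] algebra_simps)
    qed
    also have "\<dots> = e * integral {0..?m} (\<lambda>t. x t * \<rho> e t)" by simp
    finally show "integral {0..?m} (\<lambda>t. x t * trace_prod (xi_deriv \<beta> (varied e t) + outer h h) (path_deriv (varied e) t)) -
        integral {0..?m} (\<lambda>t. x t * trace_prod (xi_deriv \<beta> (\<Psi> t) + outer h h) (V t)) =
        e * integral {0..?m} (\<lambda>t. x t * \<rho> e t)" .
  qed
qed

end

lemma not_below_t_top:
  assumes "t \<in> {0..T}" "t < t_top T x"
  shows "x t \<noteq> 1"
proof
  assume "x t = 1"
  then have "t_top T x \<le> t"
    unfolding t_top_def using assms by (intro cInf_lower) (auto intro!: bdd_belowI[of _ 0])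
  then show False using assms by simp
qed

context cs_variation
begin

text \<open>The log-determinant is constant along the family. The two variations add up to
  \<open>x\<close> times the time derivative of the pairing of \<open>F\<close> with \<Delta>, since
  \<open>F\<close> is the external gradient minus \<open>P\<close>.\<close>

lemma first_variation:
  obtains \<phi> where "continuous_on {0..1} \<phi>"
    "\<And>e. e \<in> {0..1} \<Longrightarrow>
      crisanti_sommers_at \<beta> h T x (varied e) - crisanti_sommers_at \<beta> h T x \<Psi> = e * \<phi> e"
    "\<phi> 0 = 1/2 * integral {0..T} (\<lambda>t. x t * w' t)"
proof -
  note tp = bounded_bilinear_trace_prod[where 'n = 'n]
  obtain \<phi>1 where \<phi>1: "continuous_on {0..1} \<phi>1"
    "\<And>e. e \<in> {0..1} \<Longrightarrow>
      integral {0..T} (\<lambda>t. trace_prod (matrix_inv (hat_path x (varied e) t)) (path_deriv (varied e) t)) -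
      integral {0..T} (\<lambda>t. trace_prod (inv_hat t) (V t)) = e * \<phi>1 e"
    "\<phi>1 0 = integral {0..T} (\<lambda>t. trace_prod (inv_hat t) (W t) - trace_prod (K t) (P' t))"
    by (rule internal_variation) (rule that)
  obtain \<phi>2 where \<phi>2: "continuous_on {0..1} \<phi>2"
    "\<And>e. e \<in> {0..1} \<Longrightarrow>
      integral {0..real CARD('n)} (\<lambda>t. x t * trace_prod (xi_deriv \<beta> (varied e t) + outer h h) (path_deriv (varied e) t)) -
      integral {0..real CARD('n)} (\<lambda>t. x t * trace_prod (xi_deriv \<beta> (\<Psi> t) + outer h h) (V t)) = e * \<phi>2 e"
    "\<phi>2 0 = integral {0..T} (\<lambda>t. x t * (trace_prod (A' t) (\<Delta> t) +
      trace_prod (xi_deriv \<beta> (\<Psi> t) + outer h h) (W t)))"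
    by (rule external_variation) (rule that)
  have sub: "{0..T} \<subseteq> {0..real CARD('n)}" using T by auto
  note contW = continuous_on_subset[OF continuous_W sub]
  note cont\<Delta> = continuous_on_subset[OF continuous_\<Delta> sub]
  note monoT = mono_on_subset[OF mono_x sub]
  have contP: "continuous_on {0..T} P" using P_deriv by (intro continuous_on_vector_derivative) auto
  have i1: "(\<lambda>t. x t * (trace_prod (A' t) (\<Delta> t) +
      trace_prod (xi_deriv \<beta> (\<Psi> t) + outer h h) (W t))) integrable_on {0..T}"
    using mono_on_times_continuous_integrable[OF monoT, of "\<lambda>t. trace_prod (A' t) (\<Delta> t) +
      trace_prod (xi_deriv \<beta> (\<Psi> t) + outer h h) (W t)"]
    by (simp add: continuous_intros continuous_on_subset[OF continuous_A' sub] cont\<Delta> contW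
        continuous_on_subset[OF continuous_xi_deriv sub])
  have i2: "(\<lambda>t. x t * (trace_prod (P' t) (\<Delta> t) + trace_prod (P t) (W t))) integrable_on {0..T}"
    using mono_on_times_continuous_integrable[OF monoT, of "\<lambda>t. trace_prod (P' t) (\<Delta> t) + trace_prod (P t) (W t)"]
    by (simp add: continuous_intros continuous_P' cont\<Delta> contP contW)
  have "\<phi>1 0 + \<phi>2 0 = integral {0..T} (\<lambda>t. x t * (trace_prod (A' t) (\<Delta> t) +
      trace_prod (xi_deriv \<beta> (\<Psi> t) + outer h h) (W t)) -
      x t * (trace_prod (P' t) (\<Delta> t) + trace_prod (P t) (W t)))"
    unfolding \<phi>1(3) \<phi>2(3) integral_by_parts_inv_hat by (simp add: integral_diff[OF i1 i2])
  also have "\<dots> = integral {0..T} (\<lambda>t. x t * w' t)"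
    by (rule integral_cong)
       (simp add: w'_def F'_def F_def bounded_bilinear.diff_left[OF tp] algebra_simps)
  finally have zero: "\<phi>1 0 + \<phi>2 0 = integral {0..T} (\<lambda>t. x t * w' t)" .
  show thesis
  proof (rule that)
    show "continuous_on {0..1} (\<lambda>e. 1/2 * (\<phi>1 e + \<phi>2 e))"
      by (intro continuous_intros \<phi>1(1) \<phi>2(1))
    show "1/2 * (\<phi>1 0 + \<phi>2 0) = 1/2 * integral {0..T} (\<lambda>t. x t * w' t)" using zero by simp
    fix e :: real assume e: "e \<in> {0..1}"
    have eq: "varied e (real CARD('n)) - varied e T = \<Psi> (real CARD('n)) - \<Psi> T"
      using c T by (simp add: varied_eq)
    show "crisanti_sommers_at \<beta> h T x (varied e) - crisanti_sommers_at \<beta> h T x \<Psi> =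
        e * (1/2 * (\<phi>1 e + \<phi>2 e))"
      using \<phi>1(2)[OF e] \<phi>2(2)[OF e] unfolding crisanti_sommers_at_def eq
      by (simp add: inv_hat_def algebra_simps)
  qed
qed

section \<open>Admissible competitors and the variational inequality\<close>

lemma trace_\<Delta>_deriv:
  assumes "t \<in> {0..real CARD('n)}"
  shows "((\<lambda>t. trace (\<Delta> t)) has_real_derivative trace (W t)) (at t within {0..real CARD('n)})"
  using bounded_linear.has_vector_derivative[OF bounded_linear_trace \<Delta>_deriv[OF assms]]
  by (simp add: has_real_derivative_iff_has_vector_derivative)

text \<open>
  On the support of the order measure \<open>trace (\<Psi> t) = t\<close>, so there the trace of the varied path is
  \<open>\<theta> t = t + e * trace (\<Delta> t)\<close>.  Running both \<open>x\<close> and the varied path along the inverse of \<open>\<theta>\<close>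
  yields an admissible pair.
\<close>

lemma competitor:
  assumes adm: "admissible Q x \<Psi>" and e: "e \<in> {0..1}"
    and small: "\<And>t. t \<in> {0..real CARD('n)} \<Longrightarrow> \<bar>e * trace (W t)\<bar> \<le> 1/2"
    and c_top: "c \<le> t_top (real CARD('n)) x"
    and T_some: "T = (SOME T. T \<in> {t_top (real CARD('n)) x<..<real CARD('n)} \<and> det (Q - \<Psi> T) > 0)"
  obtains y \<Psi>' where "admissible Q y \<Psi>'"
    "crisanti_sommers \<beta> h Q y \<Psi>' = crisanti_sommers_at \<beta> h T x (varied e)"
proof -
  let ?m = "real CARD('n)"
  interpret v: cs_path \<beta> h Q x "varied e" T by (rule cs_path_varied[OF e])
  define \<theta> where "\<theta> t = t + e * trace (\<Delta> t)" for t
  define \<theta>' where "\<theta>' t = 1 + e * trace (W t)" for t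
  have \<theta>_deriv: "(\<theta> has_real_derivative \<theta>' t) (at t within {0..?m})" if "t \<in> {0..?m}" for t
    unfolding \<theta>_def[abs_def] \<theta>'_def
    by (intro DERIV_add DERIV_ident DERIV_cmult trace_\<Delta>_deriv that)
  have half: "1/2 \<le> \<theta>' t" if "t \<in> {0..?m}" for t
    using small[OF that] by (simp add: \<theta>'_def abs_le_iff)
  have \<theta>_id: "\<theta> t = t" if "t \<in> {c..?m}" for t
    using \<Delta>_zero[OF that] by (simp add: \<theta>_def trace_0[unfolded mat_0] trace_def)
  have \<theta>_0: "\<theta> 0 = 0" by (simp add: \<theta>_def \<Delta>_0 trace_def)
  have c_m: "c \<le> ?m" using c T by simp
  obtain R where R: "\<And>t. t \<in> {0..?m} \<Longrightarrow> R t \<in> {0..?m}" "\<And>t. t \<in> {0..?m} \<Longrightarrow> \<theta> (R t) = t"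
    "\<And>t. t \<in> {0..?m} \<Longrightarrow> R (\<theta> t) = t" "strict_mono_on {0..?m} R" "2-lipschitz_on {0..?m} R"
    "\<And>t. t \<in> {0..?m} \<Longrightarrow> (R has_real_derivative 1 / \<theta>' (R t)) (at t within {0..?m})"
    using inverse_reparametrization[of ?m \<theta> \<theta>', OF _ \<theta>_deriv half \<theta>_0 \<theta>_id] c_m
    by (metis atLeastAtMost_iff of_nat_0_less_iff order_refl zero_less_card_finite)
  have R_id: "R t = t" if "t \<in> {c..?m}" for t
    using R(3)[of t] \<theta>_id[OF that] that c by auto
  have R_0: "R 0 = 0" using R(3)[of 0] \<theta>_0 by simp
  have R_cont: "continuous_on {0..?m} R" by (rule lipschitz_on_continuous_on[OF R(5)])
  have \<theta>'_lip: "\<exists>L. L-lipschitz_on {0..?m} \<theta>'"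
  proof -
    obtain B where B: "0 < B" "\<And>Z :: real^'n^'n. norm (trace Z) \<le> norm Z * B"
      using bounded_linear.pos_bounded[OF bounded_linear_trace[where 'n = 'n]] by blast
    have "B-lipschitz_on (W ` {0..?m}) trace"
    proof (rule lipschitz_onI)
      fix Y Z :: "real^'n^'n"
      have "trace Y - trace Z = trace (Y - Z)"
        by (simp add: linear_diff[OF bounded_linear.linear[OF bounded_linear_trace]])
      then show "dist (trace Y) (trace Z) \<le> B * dist Y Z"
        using B(2)[of "Y - Z"] by (simp add: dist_norm mult.commute)
    qed (use B in simp)
    from lipschitz_on_compose2[OF W_lipschitz this]
    have "(B * M)-lipschitz_on {0..?m} (\<lambda>t. trace (W t))" .
    from lipschitz_on_add[OF lipschitz_on_constant lipschitz_on_cmult_real[OF this, of e]]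
    show ?thesis unfolding \<theta>'_def[abs_def] by blast
  qed
  have "\<exists>L. L-lipschitz_on {0..?m} (\<lambda>t. (1 / \<theta>' (R t)) *\<^sub>R path_deriv (varied e) (R t))"
  proof -
    obtain L1 where L1: "L1-lipschitz_on {0..?m} \<theta>'" using \<theta>'_lip by blast
    obtain L2 where L2: "L2-lipschitz_on {0..?m} (path_deriv (varied e))"
      using v.path by (auto simp: C1_monotone_path_def)
    obtain L3 where "L3-lipschitz_on {0..?m} (\<lambda>t. (1 / \<theta>' t) *\<^sub>R path_deriv (varied e) t)"
      using lipschitz_on_scaleR_compact[OF lipschitz_on_inverse_ge_half[OF L1 half] L2] by blast
    then have "L3-lipschitz_on (R ` {0..?m}) (\<lambda>t. (1 / \<theta>' t) *\<^sub>R path_deriv (varied e) t)"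
      by (rule lipschitz_on_subset) (use R(1) in auto)
    from lipschitz_on_compose2[OF R(5) this] show ?thesis by blast
  qed
  then obtain L where L: "L-lipschitz_on {0..?m} (\<lambda>t. (1 / \<theta>' (R t)) *\<^sub>R path_deriv (varied e) (R t))"
    by blast
  have ends: "R T = T" "R ?m = ?m" using R_id c T by auto
  have pos: "0 \<le> 1 / \<theta>' (R t)" if "t \<in> {0..?m}" for t
    using half[OF R(1)[OF that]] by simp
  note rep = v.reparametrize[OF R(6) pos R(4) R_0 ends L]
  let ?y = "x \<circ> R" and ?\<Psi> = "varied e \<circ> R"
  have cdf': "order_cdf ?m ?y"
    by (rule order_cdf_compose[OF cdf R(4) R_cont R_0 ends(2)]) simp
  have \<Psi>'_eq: "?\<Psi> t = \<Psi> t" if "t \<in> {c..?m}" for t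
    using that by (simp add: R_id varied_eq)
  \<comment> \<open>\<open>R\<close> fixes every time from \<open>c\<close> on and maps [0, c) into
    itself, where \<open>x\<close> differs from 1 because \<open>c\<close> does not exceed
    \<open>t_top\<close>.\<close>
  have top: "t_top ?m ?y = t_top ?m x"
  proof -
    have "x (R t) = 1 \<longleftrightarrow> x t = 1" if t: "t \<in> {0..?m}" for t
    proof (cases "c \<le> t")
      case True
      then show ?thesis using R_id t by simp
    next
      case False
      then have "R t < R c" using strict_mono_onD[OF R(4), of t c] t c_m by auto
      then have "R t < c" using R_id c_m by simp
      then show ?thesis
        using not_below_t_top[of t ?m x] not_below_t_top[of "R t" ?m x] R(1)[OF t] t False c_top by auto
    qed
    then have "{t \<in> {0..?m}. ?y t = 1} = {t \<in> {0..?m}. x t = 1}" by auto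
    then show ?thesis by (simp only: t_top_def)
  qed
  have top_in: "t_top ?m x \<in> {c..?m}" using c_top T by auto
  have adm': "admissible Q ?y ?\<Psi>"
    unfolding admissible_def
  proof (intro conjI ballI)
    show "order_cdf ?m ?y" by (rule cdf')
    show "C1_monotone_path Q ?\<Psi>" by (rule rep(1))
    show "0 < det (Q - ?\<Psi> (t_top ?m ?y))"
      using adm top \<Psi>'_eq[OF top_in] by (simp add: admissible_def)
    fix t assume t: "t \<in> msupport (order_measure ?m ?y)"
    have "t \<in> {0..?m}" "R t \<in> msupport (order_measure ?m x)"
      using msupport_order_measure_compose[OF cdf R(4) R_cont R_0 ends(2) _ t] by auto
    then have "trace (\<Psi> (R t)) = R t" "\<theta> (R t) = t"
      using adm R(2) by (auto simp: admissible_def)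
    then show "trace (?\<Psi> t) = t"
      by (simp add: varied_def \<theta>_def linear_add[OF bounded_linear.linear[OF bounded_linear_trace]]
          linear_cmul[OF bounded_linear.linear[OF bounded_linear_trace]])
  qed
  \<comment> \<open>The value of the functional depends on a cutoff picked by \<open>SOME\<close>.
    Since the two predicates are equal, the same cutoff is picked for the competitor.\<close>
  have "(\<lambda>T. T \<in> {t_top ?m ?y<..<?m} \<and> det (Q - ?\<Psi> T) > 0) =
      (\<lambda>T. T \<in> {t_top ?m x<..<?m} \<and> det (Q - \<Psi> T) > 0)"
    using top \<Psi>'_eq c_top by (intro ext) auto
  then have "crisanti_sommers \<beta> h Q ?y ?\<Psi> = crisanti_sommers_at \<beta> h T x (varied e)"
    using rep(2) T_some by (simp only: crisanti_sommers_def)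
  with adm' show thesis by (rule that)
qed

lemma minimizer_first_variation_nonneg:
  assumes min: "cs_minimizer \<beta> h Q x \<Psi>"
    and c_top: "c \<le> t_top (real CARD('n)) x"
    and T_some: "T = (SOME T. T \<in> {t_top (real CARD('n)) x<..<real CARD('n)} \<and> det (Q - \<Psi> T) > 0)"
  shows "0 \<le> integral {0..T} (\<lambda>t. x t * w' t)"
proof (rule ccontr)
  assume neg: "\<not> 0 \<le> integral {0..T} (\<lambda>t. x t * w' t)"
  obtain \<phi> where \<phi>: "continuous_on {0..1} \<phi>"
    "\<And>e. e \<in> {0..1} \<Longrightarrow>
      crisanti_sommers_at \<beta> h T x (varied e) - crisanti_sommers_at \<beta> h T x \<Psi> = e * \<phi> e"
    "\<phi> 0 = 1/2 * integral {0..T} (\<lambda>t. x t * w' t)"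
    by (rule first_variation) (rule that)
  have "\<phi> 0 < 0" using neg \<phi>(3) by simp
  then obtain d where d: "0 < d" "\<And>e. e \<in> {0..1} \<Longrightarrow> dist e 0 < d \<Longrightarrow> dist (\<phi> e) (\<phi> 0) < - \<phi> 0"
    using \<phi>(1)[unfolded continuous_on_iff, rule_format, of 0 "- \<phi> 0"] by auto
  have "continuous_on {0..real CARD('n)} (\<lambda>t. trace (W t))"
    by (rule bounded_linear.continuous_on[OF bounded_linear_trace continuous_W])
  then obtain B where B: "0 < B" "\<And>t. t \<in> {0..real CARD('n)} \<Longrightarrow> norm (trace (W t)) \<le> B"
    by (rule continuous_on_Icc_norm_bound) (rule that)
  \<comment> \<open>The bound 1 keeps the varied path monotone, d / 2 keeps \<phi> negative, and 1 /
    (2 * B) keeps the derivative of the time change at least 1/2.\<close>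
  define e where "e = min (min 1 (d / 2)) (1 / (2 * B))"
  have e: "0 < e" "e \<le> 1" "e < d" "e \<le> 1 / (2 * B)" using d(1) B(1) by (auto simp: e_def)
  have small: "\<bar>e * trace (W t)\<bar> \<le> 1/2" if "t \<in> {0..real CARD('n)}" for t
  proof -
    have "\<bar>e * trace (W t)\<bar> \<le> 1 / (2 * B) * B"
      unfolding abs_mult using e B(2)[OF that] by (intro mult_mono) auto
    then show ?thesis using B(1) by simp
  qed
  obtain y \<Psi>' where y: "admissible Q y \<Psi>'"
    "crisanti_sommers \<beta> h Q y \<Psi>' = crisanti_sommers_at \<beta> h T x (varied e)"
    using e by (rule_tac competitor[OF _ _ small c_top T_some]) (use min in \<open>auto simp: cs_minimizer_def\<close>)
  have "crisanti_sommers \<beta> h Q x \<Psi> \<le> crisanti_sommers \<beta> h Q y \<Psi>'"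
    using min y(1) by (simp add: cs_minimizer_def)
  moreover have "crisanti_sommers \<beta> h Q x \<Psi> = crisanti_sommers_at \<beta> h T x \<Psi>"
    by (simp only: crisanti_sommers_def flip: T_some)
  ultimately have "0 \<le> e * \<phi> e" using \<phi>(2)[of e] y(2) e by simp
  then have "0 \<le> \<phi> e" using e by (simp add: zero_le_mult_iff)
  moreover have "\<phi> e < 0" using d(2)[of e] e by (auto simp: dist_real_def)
  ultimately show False by simp
qed

end

subsection \<open>Transport of increments\<close>

text \<open>A Lipschitz bump instead of an indicator, because the velocity of an admissible path has
  to be Lipschitz. Left unnormalized, it is at most 1 on short intervals and so can serve as the
  fraction of the velocity that is removed.\<close>

definition tent :: "real \<Rightarrow> real \<Rightarrow> real \<Rightarrow> real" where
  "tent a b u = max 0 (min (u - a) (b - u))"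

lemma tent_nonneg: "0 \<le> tent a b u"
  by (simp add: tent_def)

lemma tent_le_1: "b - a \<le> 2 \<Longrightarrow> tent a b u \<le> 1"
  by (auto simp: tent_def min_def)

lemma tent_pos_iff: "0 < tent a b u \<longleftrightarrow> a < u \<and> u < b"
  by (auto simp: tent_def max_def min_def)

lemma tent_zero: "u \<le> a \<or> b \<le> u \<Longrightarrow> tent a b u = 0"
  by (auto simp: tent_def max_def min_def)

lemma tent_lipschitz: "1-lipschitz_on S (tent a b)"
  by (rule lipschitz_onI) (auto simp: tent_def dist_real_def max_def min_def)

lemma continuous_on_tent: "continuous_on S (tent a b)"
  using tent_lipschitz by (rule lipschitz_on_continuous_on)

lemma integral_tent_pos:
  assumes "0 \<le> a" "a < b" "b \<le> c" and f: "continuous_on {0..c} f"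
    and nonneg: "\<And>u. u \<in> {a..b} \<Longrightarrow> 0 \<le> f u" and pos: "\<And>u. u \<in> {a<..<b} \<Longrightarrow> 0 < f u"
  shows "0 < integral {0..c} (\<lambda>u. tent a b u * f u)"
proof -
  have cont: "continuous_on {0..c} (\<lambda>u. tent a b u * f u)"
    by (intro continuous_intros continuous_on_tent f)
  have nn: "0 \<le> tent a b u * f u" if "u \<in> {0..c}" for u
    using nonneg[of u] tent_nonneg[of a b u] tent_zero[of u a b] by (cases "u \<in> {a..b}") auto
  have mid: "(a + b) / 2 \<in> {0..c}" "0 < tent a b ((a + b) / 2) * f ((a + b) / 2)"
    using assms by (auto simp: tent_pos_iff intro!: mult_pos_pos pos)
  have "integral {0..c} (\<lambda>u. tent a b u * f u) \<noteq> 0"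
    using integral_eq_0_iff[OF cont _ nn] mid assms by fastforce
  moreover have "0 \<le> integral {0..c} (\<lambda>u. tent a b u * f u)"
    by (intro integral_nonneg integrable_continuous_real cont nn)
  ultimately show ?thesis by simp
qed

lemma integral_tent_below:
  assumes "t \<le> a"
  shows "integral {0..t} (\<lambda>u. tent a b u * f u) = 0"
proof -
  have "integral {0..t} (\<lambda>u. tent a b u * f u) = integral {0..t} (\<lambda>_. 0)"
    by (rule integral_cong) (use assms in \<open>simp add: tent_zero\<close>)
  then show ?thesis by simp
qed

lemma integral_tent_above:
  assumes "b \<le> t" "b \<le> c"
  shows "integral {0..t} (\<lambda>u. tent a b u * f u) = integral {0..c} (\<lambda>u. tent a b u * f u)"
  using integral_Icc_eq_if_zero[of b t "\<lambda>u. tent a b u * f u"]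
    integral_Icc_eq_if_zero[of b c "\<lambda>u. tent a b u * f u"] assms by (simp add: tent_zero)

text \<open>The ratio is the fraction of the removed increments that has been given back by time
  \<open>t\<close>.\<close>

lemma tent_ratio:
  assumes "0 \<le> a'" "a' < b'" "b' \<le> c"
  shows "0 \<le> t \<Longrightarrow> t \<le> c \<Longrightarrow> 0 \<le> integral {0..t} (tent a' b') / integral {0..c} (tent a' b')"
    and "0 \<le> t \<Longrightarrow> t \<le> c \<Longrightarrow> integral {0..t} (tent a' b') / integral {0..c} (tent a' b') \<le> 1"
    and "t \<le> a' \<Longrightarrow> integral {0..t} (tent a' b') / integral {0..c} (tent a' b') = 0"
    and "b' \<le> t \<Longrightarrow> integral {0..t} (tent a' b') / integral {0..c} (tent a' b') = 1"
proof -
  have Z: "0 < integral {0..c} (tent a' b')" using integral_tent_pos[OF assms, of "\<lambda>_. 1"] by simp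
  have int: "tent a' b' integrable_on S" if "S = {s..t}" for S s t
    unfolding that by (intro integrable_continuous_real continuous_on_tent)
  show "0 \<le> integral {0..t} (tent a' b') / integral {0..c} (tent a' b')"
    using Z int by (intro divide_nonneg_pos integral_nonneg) (auto simp: tent_nonneg)
  show "integral {0..t} (tent a' b') / integral {0..c} (tent a' b') \<le> 1" if "0 \<le> t" "t \<le> c"
  proof -
    have "integral {0..t} (tent a' b') \<le> integral {0..c} (tent a' b')"
      using that by (intro integral_subset_le int) (auto simp: tent_nonneg)
    then show ?thesis using Z by simp
  qed
  show "integral {0..t} (tent a' b') / integral {0..c} (tent a' b') = 0" if "t \<le> a'"
    using integral_tent_below[OF that, of b' "\<lambda>_. 1"] by simp
  show "integral {0..t} (tent a' b') / integral {0..c} (tent a' b') = 1" if "b' \<le> t"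
    using integral_tent_above[OF that assms(3), of a' "\<lambda>_. 1"] Z by simp
qed

context cs_path
begin

lemma continuous_F_V:
  assumes "t \<in> {0..T}" "c \<le> real CARD('n)"
  shows "continuous_on {0..c} (\<lambda>u. trace_prod (F t) (V u))"
  by (intro continuous_intros continuous_on_subset[OF continuous_V]) (use assms in auto)

text \<open>
  Increments of the path are removed around the times in \<open>[a, b]\<close> and reinserted around the times
  in \<open>[a', b']\<close>.
\<close>

lemma transport_variation:
  fixes a b a' b' c :: real
  assumes ab: "0 \<le> a" "a < b" "b \<le> c" and ab': "0 \<le> a'" "a' < b'" "b' \<le> c"
    and c: "c \<le> 1" "c \<le> t_top (real CARD('n)) x" and min: "cs_minimizer \<beta> h Q x \<Psi>"
    and T_some: "T = (SOME T. T \<in> {t_top (real CARD('n)) x<..<real CARD('n)} \<and> det (Q - \<Psi> T) > 0)"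
    and pq: "0 \<le> p" "p \<le> q" "q \<le> T" and jump: "x p < x q"
    and k: "\<And>t. k t = integral {0..t} (tent a' b') / integral {0..c} (tent a' b')"
    and w: "\<And>t. w t = k t * integral {0..c} (\<lambda>u. tent a b u * trace_prod (F t) (V u)) -
      integral {0..t} (\<lambda>u. tent a b u * trace_prod (F t) (V u))"
    and w_nonneg: "\<And>t. t \<in> {0..c} \<Longrightarrow> 0 \<le> w t"
    and w_pos: "\<And>t. t \<in> {p..q} \<Longrightarrow> 0 < w t"
  shows False
proof -
  note tp = bounded_bilinear_trace_prod[where 'n = 'n]
  let ?m = "real CARD('n)"
  have cT: "0 \<le> c" "c \<le> T" "c \<le> ?m" using ab c T by auto
  define Z where "Z = integral {0..c} (tent a' b')"
  have "0 < Z" using integral_tent_pos[OF ab', of "\<lambda>_. 1"] by (simp add: Z_def)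
  define E where "E = integral {0..c} (\<lambda>u. tent a b u *\<^sub>R V u)"
  \<comment> \<open>\<open>E\<close> is the total of what is removed. It is given back as one psd
    matrix with the profile \<open>tent a' b' / Z\<close> of integral 1, so the integral of
    \<open>W\<close> over [0, c] is 0.\<close>
  define W where "W t = (tent a' b' t / Z) *\<^sub>R E - tent a b t *\<^sub>R V t" for t
  have int_tV: "(\<lambda>u. tent a b u *\<^sub>R V u) integrable_on {0..t}" if "t \<le> ?m" for t
    by (intro integrable_continuous_real continuous_intros continuous_on_tent
        continuous_on_subset[OF continuous_V]) (use that in auto)
  have int_t: "tent a' b' integrable_on {0..t}" for t
    by (intro integrable_continuous_real continuous_on_tent)
  have int_W: "integral {0..t} W = k t *\<^sub>R E - integral {0..t} (\<lambda>u. tent a b u *\<^sub>R V u)" if "t \<le> ?m" for t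
  proof -
    have "((\<lambda>u. (tent a' b' u / Z) *\<^sub>R E) has_integral (integral {0..t} (tent a' b') / Z) *\<^sub>R E) {0..t}"
      by (intro has_integral_scaleR_left has_integral_divide integrable_integral int_t)
    from has_integral_diff[OF this integrable_integral[OF int_tV[OF that]]]
    show ?thesis unfolding W_def[abs_def] k Z_def by (rule integral_unique)
  qed
  obtain LV where LV: "LV-lipschitz_on {0..?m} V" using path by (auto simp: C1_monotone_path_def)
  obtain L1 where L1: "L1-lipschitz_on {0..?m} (\<lambda>t. tent a b t *\<^sub>R V t)"
    using lipschitz_on_scaleR_compact[OF tent_lipschitz LV] by blast
  obtain L2 where L2: "L2-lipschitz_on {0..?m} (\<lambda>t. tent a' b' t *\<^sub>R ((1 / Z) *\<^sub>R E))"
    using lipschitz_on_scaleR_compact[OF tent_lipschitz lipschitz_on_constant] by blast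
  have W_lip: "(L2 + L1)-lipschitz_on {0..?m} W"
    using lipschitz_on_diff[OF L2 L1] by (simp add: W_def[abs_def])
  have psd_E: "psd E"
    unfolding E_def using cT by (intro psd_integral int_tV psd_scaleR psd_V tent_nonneg) auto
  interpret var: cs_variation \<beta> h Q x \<Psi> T W c "L2 + L1"
  proof
    show "(L2 + L1)-lipschitz_on {0..?m} W" by (rule W_lip)
    show "W t = 0" if "t \<in> {c..?m}" for t
      using that ab ab' by (simp add: W_def tent_zero)
    show "0 \<le> c" "c \<le> T" by (rule cT)+
    show "integral {0..c} W = 0"
      using int_W[OF cT(3)] \<open>0 < Z\<close> by (simp add: k E_def[symmetric] Z_def[symmetric])
    fix e t :: real assume e: "e \<in> {0..1}" and t: "t \<in> {0..?m}"
    \<comment> \<open>As [a, b] lies in [0, 1] the tent is at most 1, so a nonnegative multiple of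
      \<open>V t\<close> remains after the removal.\<close>
    have "e * tent a b t \<le> 1"
      using mult_mono[of e 1 "tent a b t" 1] e tent_le_1[of b a t] tent_nonneg[of a b t] ab c by auto
    then have "psd ((1 - e * tent a b t) *\<^sub>R V t + (e * (tent a' b' t / Z)) *\<^sub>R E)"
      using e \<open>0 < Z\<close> tent_nonneg[of a' b' t] by (intro psd_add psd_scaleR psd_V[OF t] psd_E) auto
    then show "psd (V t + e *\<^sub>R W t)"
      by (simp add: W_def algebra_simps)
  qed
  have w_eq: "var.w t = w t" if t: "t \<in> {0..T}" for t
  proof -
    have lin: "bounded_linear (trace_prod (F t))" by (rule bounded_bilinear.bounded_linear_right[OF tp])
    have "trace_prod (F t) (integral {0..s} (\<lambda>u. tent a b u *\<^sub>R V u)) =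
        integral {0..s} (\<lambda>u. tent a b u * trace_prod (F t) (V u))" if "s \<le> ?m" for s
      using integral_linear[OF int_tV[OF that] lin]
      by (simp add: o_def bounded_bilinear.scaleR_right[OF tp])
    then show ?thesis
      using t T cT by (simp add: var.w_def var.\<Delta>_def int_W w E_def
          bounded_bilinear.diff_right[OF tp] bounded_bilinear.scaleR_right[OF tp])
  qed
  have "integral {0..T} (\<lambda>t. x t * var.w' t) < 0"
  proof (rule integral_mono_weight_deriv_neg[OF mono_on_subset[OF mono_x] var.w_deriv _ _ _ pq _ jump])
    show "var.w 0 = 0" by (simp add: var.w_def var.\<Delta>_0 bounded_bilinear.zero_right[OF tp])
    show "var.w T = 0"
      using cT T by (simp add: var.w_def var.\<Delta>_zero bounded_bilinear.zero_right[OF tp])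
    show "0 \<le> var.w t" if "t \<in> {0..T}" for t
    proof (cases "t \<le> c")
      case True
      then show ?thesis using w_eq[OF that] w_nonneg[of t] that by simp
    next
      case False
      then show ?thesis
        using that T by (simp add: var.w_def var.\<Delta>_zero bounded_bilinear.zero_right[OF tp])
    qed
    show "0 < var.w t" if "t \<in> {p..q}" for t using w_eq[of t] w_pos[OF that] that pq by auto
  qed (use T in auto)
  with var.minimizer_first_variation_nonneg[OF min c(2) T_some] show False by simp
qed

text \<open>Up to time \<open>a\<close> nothing has been removed, and the weight is a fraction of a
  nonnegative total. After \<open>a\<close> everything has been given back, and what is already
  removed cancels, so only u \<ge> t is left. This is why a sign is needed for t \<le> u only. On
  [p, q] the full total is present.\<close>

lemma no_earlier_transport:
  fixes a b c p q :: real
  assumes ab: "q \<le> a" "a < b" "b \<le> c" and c: "c \<le> 1" "c \<le> t_top (real CARD('n)) x"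
    and min: "cs_minimizer \<beta> h Q x \<Psi>"
    and T_some: "T = (SOME T. T \<in> {t_top (real CARD('n)) x<..<real CARD('n)} \<and> det (Q - \<Psi> T) > 0)"
    and pq: "0 < p" "p \<le> q" and jump: "x p < x q"
    and nonneg: "\<And>t u. u \<in> {a..b} \<Longrightarrow> t \<in> {0..u} \<Longrightarrow> 0 \<le> trace_prod (F t) (V u)"
    and pos: "\<And>t u. u \<in> {a<..<b} \<Longrightarrow> t \<in> {p..q} \<Longrightarrow> 0 < trace_prod (F t) (V u)"
  shows False
proof (rule transport_variation[where a = a and b = b and a' = 0 and b' = p and c = c and p = p and q = q])
  let ?k = "\<lambda>t. integral {0..t} (tent 0 p) / integral {0..c} (tent 0 p)"
  let ?g = "\<lambda>t u. tent a b u * trace_prod (F t) (V u)"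
  let ?w = "\<lambda>t. ?k t * integral {0..c} (?g t) - integral {0..t} (?g t)"
  have bounds: "0 \<le> a" "p \<le> c" "c \<le> T" "c \<le> real CARD('n)" using ab pq c T by auto
  note kr = tent_ratio[OF order_refl pq(1) bounds(2)]
  have cont: "continuous_on {0..c} (?g t)" if "t \<in> {0..c}" for t
    by (intro continuous_intros continuous_on_tent continuous_F_V) (use that bounds in auto)
  have g_nonneg: "0 \<le> ?g t u" if "0 \<le> t" "t \<le> u" for t u
    using nonneg[of u t] that tent_nonneg[of a b u] tent_zero[of u a b]
    by (cases "u \<in> {a..b}") auto
  show "0 \<le> ?w t" if t: "t \<in> {0..c}" for t
  proof (cases "t \<le> a")
    case True
    have "0 \<le> ?g t u" if "u \<in> {0..c}" for u
      using g_nonneg[of t u] t True tent_zero[of u a b] by (cases "t \<le> u") auto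
    then have "0 \<le> integral {0..c} (?g t)"
      by (intro integral_nonneg integrable_continuous_real cont t)
    then have "0 \<le> ?k t * integral {0..c} (?g t)"
      using t by (intro mult_nonneg_nonneg kr(1)) auto
    then show ?thesis by (simp only: integral_tent_below[OF True] diff_zero)
  next
    case False
    then have "?k t = 1" using ab pq by (intro kr(4)) auto
    have "integral {0..t} (?g t) + integral {t..c} (?g t) = integral {0..c} (?g t)"
      using t by (intro Henstock_Kurzweil_Integration.integral_combine integrable_continuous_real cont) auto
    moreover have "0 \<le> integral {t..c} (?g t)"
      using t g_nonneg[of t]
      by (intro integral_nonneg integrable_continuous_real continuous_on_subset[OF cont]) auto
    ultimately show ?thesis unfolding \<open>?k t = 1\<close> by linarith
  qed
  show "0 < ?w t" if t: "t \<in> {p..q}" for t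
  proof -
    have "0 < integral {0..c} (?g t)"
      using t ab pq bounds by (intro integral_tent_pos continuous_F_V nonneg pos) auto
    moreover have "?k t = 1" using t by (intro kr(4)) auto
    moreover have "integral {0..t} (?g t) = 0" using t ab by (intro integral_tent_below) auto
    ultimately show ?thesis by (simp only: mult_1 diff_zero)
  qed
qed (use assms T in \<open>auto intro: order_trans\<close>)

text \<open>The mirror image: up to \<open>q\<close> nothing is given back, and the weight is minus
  what has been removed so far; after \<open>q\<close> it is \<open>k t - 1\<close> times the
  negative total. Only times t \<ge> u matter. On [p, q] the weight is minus the total.\<close>

lemma no_later_transport:
  fixes a b c p q :: real
  assumes ab: "0 \<le> a" "a < b" "b \<le> p" and c: "c \<le> 1" "c \<le> t_top (real CARD('n)) x"
    and min: "cs_minimizer \<beta> h Q x \<Psi>"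
    and T_some: "T = (SOME T. T \<in> {t_top (real CARD('n)) x<..<real CARD('n)} \<and> det (Q - \<Psi> T) > 0)"
    and pq: "p \<le> q" "q < c" and jump: "x p < x q"
    and neg: "\<And>t u. u \<in> {a..b} \<Longrightarrow> t \<in> {u..c} \<Longrightarrow> trace_prod (F t) (V u) < 0"
  shows False
proof (rule transport_variation[where a = a and b = b and a' = q and b' = c and c = c and p = p and q = q])
  let ?k = "\<lambda>t. integral {0..t} (tent q c) / integral {0..c} (tent q c)"
  let ?g = "\<lambda>t u. tent a b u * trace_prod (F t) (V u)"
  let ?w = "\<lambda>t. ?k t * integral {0..c} (?g t) - integral {0..t} (?g t)"
  have bounds: "0 \<le> q" "b \<le> c" "c \<le> T" "c \<le> real CARD('n)" using ab pq c T by auto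
  note kr = tent_ratio[OF bounds(1) pq(2) order_refl]
  have cont: "continuous_on {0..c} (?g t)" if "t \<in> {0..c}" for t
    by (intro continuous_intros continuous_on_tent continuous_F_V) (use that bounds in auto)
  have g_nonpos: "?g t u \<le> 0" if "u \<le> t" "t \<le> c" for t u
    using neg[of u t] that tent_nonneg[of a b u] tent_zero[of u a b]
    by (cases "u \<in> {a..b}") (auto intro: mult_nonneg_nonpos)
  show "0 \<le> ?w t" if t: "t \<in> {0..c}" for t
  proof (cases "t \<le> q")
    case True
    have "integral {0..t} (?g t) \<le> integral {0..t} (\<lambda>_. 0)"
      using t g_nonpos[of _ t]
      by (intro integral_le integrable_continuous_real continuous_on_subset[OF cont]) auto
    then show ?thesis unfolding kr(3)[OF True] by simp
  next
    case False
    have "integral {0..c} (?g t) \<le> integral {0..c} (\<lambda>_. 0)"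
    proof (intro integral_le integrable_continuous_real cont t)
      show "?g t u \<le> 0" if "u \<in> {0..c}" for u
        using g_nonpos[of u t] tent_zero[of u a b] False ab pq t by (cases "u \<le> t") auto
    qed simp
    moreover have "integral {0..t} (?g t) = integral {0..c} (?g t)"
      using False ab pq bounds by (intro integral_tent_above) auto
    moreover have "?k t \<le> 1" using t by (intro kr(2)) auto
    ultimately show ?thesis
      using mult_nonneg_nonpos[of "1 - ?k t" "integral {0..c} (?g t)"]
      by (simp only: left_diff_distrib) simp
  qed
  show "0 < ?w t" if t: "t \<in> {p..q}" for t
  proof -
    have "0 < integral {0..c} (\<lambda>u. tent a b u * - trace_prod (F t) (V u))"
      using t ab pq bounds neg[of _ t]
      by (intro integral_tent_pos continuous_on_minus continuous_F_V) (auto intro: less_imp_le)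
    then have "integral {0..c} (?g t) < 0" by simp
    moreover have "integral {0..t} (?g t) = integral {0..c} (?g t)"
      using t ab bounds by (intro integral_tent_above) auto
    moreover have "?k t = 0" using t by (intro kr(3)) auto
    ultimately show ?thesis by (simp only: mult_zero_left diff_0 neg_0_less_iff_less)
  qed
qed (use assms T in auto)

end

section \<open>Signs and increases near time 0\<close>

lemma order_cdf_increase_near_0:
  assumes x: "order_cdf T x" and "0 < d" "d \<le> T"
    and incr: "\<forall>q. 0 < q \<longrightarrow> q \<le> T \<longrightarrow> x q \<noteq> x 0"
  obtains p q where "0 < p" "p < q" "q < d" "x p < x q"
proof -
  define q where "q = d / 2"
  have q: "0 < q" "q < d" "q \<le> T" using assms(2,3) by (auto simp: q_def)
  have "x 0 \<le> x q" using x q by (auto simp: order_cdf_def mono_on_def)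
  moreover have "x q \<noteq> x 0" using incr q by blast
  ultimately have "x 0 < x q" by linarith
  \<comment> \<open>An increase that starts at 0 is of no use, as the weights of the first variation
    vanish there. Right continuity moves its lower end to a positive time.\<close>
  moreover have "(x \<longlongrightarrow> x 0) (at_right 0)"
    using x assms(2,3) by (auto simp: order_cdf_def continuous_within)
  ultimately have "\<forall>\<^sub>F s in at_right 0. x s < x q" by (rule order_tendstoD(2)[rotated])
  then obtain b where b: "0 < b" "\<And>s. 0 < s \<Longrightarrow> s < b \<Longrightarrow> x s < x q"
    by (auto simp: eventually_at_right_field)
  show ?thesis
    by (rule that[of "min (b / 2) (q / 2)" q]) (use b q in \<open>auto intro!: b(2)\<close>)
qed

text \<open>Makes room for the transports, which have to take place before
  \<open>t_top\<close>.\<close>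

lemma t_top_pos:
  assumes x: "order_cdf T x" and "0 < T" and incr: "\<forall>q. 0 < q \<longrightarrow> q \<le> T \<longrightarrow> x q \<noteq> x 0"
  shows "0 < t_top T x"
proof (rule ccontr)
  assume neg: "\<not> 0 < t_top T x"
  obtain p q where pq: "0 < p" "p < q" "q < T" "x p < x q"
    by (rule order_cdf_increase_near_0[OF x \<open>0 < T\<close> order_refl incr]) (rule that)
  have "T \<in> {t \<in> {0..T}. x t = 1}" using x \<open>0 < T\<close> by (simp add: order_cdf_def)
  then have "\<exists>s\<in>{t \<in> {0..T}. x t = 1}. s < p"
    using neg pq(1) unfolding t_top_def by (intro cInf_lessD) auto
  then obtain s where s: "0 \<le> s" "s < p" "x s = 1" by auto
  then have "1 \<le> x p" using monotone_onD[of "{0..T}" "(\<le>)" "(\<le>)" x s p] x pq by (auto simp: order_cdf_def)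
  moreover have "x q \<le> 1" using order_cdf_range[OF x, of q] pq by simp
  ultimately show False using pq(4) by simp
qed

lemma admissible_cutoff:
  fixes \<Phi> :: "real \<Rightarrow> real^'n^'n"
  assumes adm: "admissible Q x \<Phi>"
  shows "\<exists>T. T \<in> {t_top (real CARD('n)) x<..<real CARD('n)} \<and> 0 < det (Q - \<Phi> T)"
    and "0 \<le> t_top (real CARD('n)) x"
proof -
  let ?m = "real CARD('n)" let ?t = "t_top ?m x"
  have x: "order_cdf ?m x" and path: "C1_monotone_path Q \<Phi>" and det: "0 < det (Q - \<Phi> ?t)"
    using adm by (auto simp: admissible_def)
  have m: "?m \<in> {t \<in> {0..?m}. x t = 1}" using x by (simp add: order_cdf_def)
  have "?t \<le> ?m"
    unfolding t_top_def by (rule cInf_lower[OF m]) (auto intro!: bdd_belowI[of _ 0])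
  show t0: "0 \<le> ?t" unfolding t_top_def using m by (intro cInf_greatest) auto
  have "?t \<noteq> ?m"
  proof
    assume "?t = ?m"
    then have "0 < det (0 :: real^'n^'n)" using det path by (simp add: C1_monotone_path_def)
    then show False by (simp add: det_0[unfolded mat_0])
  qed
  with \<open>?t \<le> ?m\<close> have t_lt: "?t < ?m" by simp
  have cont: "continuous_on {0..?m} (\<lambda>t. det (Q - \<Phi> t))"
    using C1_monotone_path_deriv[OF path]
    by (intro continuous_intros continuous_on_vector_derivative) auto
  then obtain d where d: "0 < d"
    "\<And>t. t \<in> {0..?m} \<Longrightarrow> dist t ?t < d \<Longrightarrow> dist (det (Q - \<Phi> t)) (det (Q - \<Phi> ?t)) < det (Q - \<Phi> ?t)"
    using det t0 t_lt unfolding continuous_on_iff by (metis atLeastAtMost_iff less_imp_le)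
  define T where "T = min (?t + d / 2) ((?t + ?m) / 2)"
  have T: "?t < T" "T < ?m" "dist T ?t < d"
    using d(1) t_lt by (auto simp: T_def dist_real_def min_def)
  then have "0 < det (Q - \<Phi> T)" using d(2)[of T] t0 by (auto simp: dist_real_def)
  with T show "\<exists>T. T \<in> {?t<..<?m} \<and> 0 < det (Q - \<Phi> T)" by auto
qed

context cs_path
begin

lemma F_V_deriv:
  assumes "t \<in> {0..T}"
  shows "((\<lambda>t. trace_prod (F t) (V u)) has_real_derivative trace_prod (F' t) (V u)) (at t within {0..T})"
  using bounded_linear.has_vector_derivative[OF
      bounded_bilinear.bounded_linear_left[OF bounded_bilinear_trace_prod, of "V u"] F_deriv[OF assms]]
  by (simp add: has_real_derivative_iff_has_vector_derivative)

lemma F_V_diff: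
  assumes "0 \<le> s" "s < t" "t \<le> T"
  obtains z where "s < z" "z < t"
    "trace_prod (F t) (V u) - trace_prod (F s) (V u) = (t - s) * trace_prod (F' z) (V u)"
proof -
  have cont: "continuous_on {s..t} (\<lambda>t. trace_prod (F t) (V u))"
    by (intro continuous_intros continuous_on_subset[OF continuous_F]) (use assms in auto)
  obtain z where z: "s < z" "z < t" "trace_prod (F t) (V u) - trace_prod (F s) (V u) =
      (\<lambda>y. y * trace_prod (F' z) (V u)) (t - s)"
  proof (rule mvt[OF assms(2) cont])
    fix z assume z: "s < z" "z < t"
    have "((\<lambda>t. trace_prod (F t) (V u)) has_real_derivative trace_prod (F' z) (V u)) (at z)"
      using F_V_deriv[of z u] z assms at_within_Icc_at[of 0 z T] by simp
    then show "((\<lambda>t. trace_prod (F t) (V u)) has_derivative (\<lambda>y. y * trace_prod (F' z) (V u))) (at z)"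
      by (simp add: has_field_derivative_def mult.commute[of _ "trace_prod (F' z) (V u)"])
  qed (rule that)
  then show ?thesis by (intro that) auto
qed

text \<open>Multiplying by the value at (0, 0) treats both signs at once: there the product is a
  nonzero square, and joint continuity keeps it positive nearby.\<close>

lemma F_V_slope_sign:
  assumes nz: "trace_prod (F' 0) (V 0) \<noteq> 0"
  obtains c where "0 < c" "\<And>t u. t \<in> {0..T} \<Longrightarrow> t < c \<Longrightarrow> u \<in> {0..real CARD('n)} \<Longrightarrow> u < c \<Longrightarrow>
    0 < trace_prod (F' 0) (V 0) * trace_prod (F' t) (V u)"
proof -
  let ?D = "trace_prod (F' 0) (V 0)"
  let ?S = "{0..T} \<times> {0..real CARD('n)}"
  have "continuous_on ?S (\<lambda>z. ?D * trace_prod (F' (fst z)) (V (snd z)))"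
    by (intro continuous_intros continuous_on_snd_param continuous_V
        continuous_on_compose2[OF continuous_F']) auto
  moreover have "(0, 0) \<in> ?S" using T by simp
  moreover have "0 < ?D * ?D" using nz by (metis not_real_square_gt_zero)
  ultimately obtain d where d: "0 < d" "\<And>z. z \<in> ?S \<Longrightarrow> dist z (0, 0) < d \<Longrightarrow>
      dist (?D * trace_prod (F' (fst z)) (V (snd z))) (?D * ?D) < ?D * ?D"
    unfolding continuous_on_iff by force
  show ?thesis
  proof (rule that[of "d / 2"])
    fix t u assume tu: "t \<in> {0..T}" "t < d / 2" "u \<in> {0..real CARD('n)}" "u < d / 2"
    have "dist (t, u) (0, 0) \<le> \<bar>t\<bar> + \<bar>u\<bar>"
      using real_sqrt_sum_squares_triangle_ineq[of t 0 0 u] by (simp add: dist_prod_def sqrt_sum_squares_le_sum_abs)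
    then have "dist (t, u) (0, 0) < d" using tu by simp
    with d(2)[of "(t, u)"] tu show "0 < ?D * trace_prod (F' t) (V u)"
      by (auto simp: dist_real_def)
  qed (use d(1) in simp)
qed

text \<open>The increments are removed inside the window [q1, p2]. It is placed between two
  increases of \<open>x\<close>: the one from \<open>p1\<close> to \<open>q1\<close> serves
  transports to earlier times, the one from \<open>p2\<close> to \<open>q2\<close> transports to
  later times, so the window can be fixed before it is known which is needed.\<close>

lemma minimizer_not_increasing_at_0:
  assumes min: "cs_minimizer \<beta> h Q x \<Psi>"
    and T_some: "T = (SOME T. T \<in> {t_top (real CARD('n)) x<..<real CARD('n)} \<and> det (Q - \<Psi> T) > 0)"
    and nz: "trace_prod (F' 0) (V 0) \<noteq> 0"
    and incr: "\<forall>q. 0 < q \<longrightarrow> q \<le> real CARD('n) \<longrightarrow> x q \<noteq> x 0"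
  shows False
proof -
  let ?m = "real CARD('n)" let ?D = "trace_prod (F' 0) (V 0)"
  let ?f = "\<lambda>t u. trace_prod (F t) (V u)"
  obtain c0 where c0: "0 < c0" "\<And>t u. t \<in> {0..T} \<Longrightarrow> t < c0 \<Longrightarrow> u \<in> {0..?m} \<Longrightarrow> u < c0 \<Longrightarrow>
      0 < ?D * trace_prod (F' t) (V u)"
    by (rule F_V_slope_sign[OF nz]) (rule that)
  \<comment> \<open>Below \<open>c0\<close> the slope has a fixed sign; the bound 1 controls the
    tents, and the bound \<open>t_top\<close> keeps the cutoff of the competitor.\<close>
  define c where "c = min (c0 / 2) (min 1 (t_top ?m x))"
  have top: "0 < t_top ?m x" by (rule t_top_pos[OF cdf _ incr]) simp
  have c: "0 < c" "c \<le> 1" "c \<le> t_top ?m x" "c < c0" "c \<le> ?m" "c \<le> T"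
    using c0(1) top T by (auto simp: c_def min_def)
  have slope: "0 < ?D * (?f t u - ?f s u)" if st: "0 \<le> s" "s < t" "t \<le> c" "0 \<le> u" "u \<le> c" for s t u
  proof -
    have "t \<le> T" using st c by simp
    obtain z where z: "s < z" "z < t" "?f t u - ?f s u = (t - s) * trace_prod (F' z) (V u)"
      by (rule F_V_diff[OF st(1,2) \<open>t \<le> T\<close>]) (rule that)
    have "0 < (t - s) * (?D * trace_prod (F' z) (V u))"
      using st z c by (intro mult_pos_pos c0(2)) auto
    then show ?thesis by (simp add: z(3) mult_ac)
  qed
  obtain p2 q2 where pq2: "0 < p2" "p2 < q2" "q2 < c" "x p2 < x q2"
    by (rule order_cdf_increase_near_0[OF cdf c(1,5) incr]) (rule that)
  have "p2 \<le> ?m" using pq2 c by simp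
  obtain p1 q1 where pq1: "0 < p1" "p1 < q1" "q1 < p2" "x p1 < x q1"
    by (rule order_cdf_increase_near_0[OF cdf pq2(1) \<open>p2 \<le> ?m\<close> incr]) (rule that)
  show False
  proof (cases "0 < ?D")
    case True
    have mono: "?f s u < ?f t u" if "0 \<le> s" "s < t" "t \<le> c" "0 \<le> u" "u \<le> c" for s t u
      using slope[OF that] True by (simp add: zero_less_mult_iff)
    have zero: "0 \<le> ?f 0 u" if "0 \<le> u" "u \<le> c" for u
      using psd_quadratic_form[OF psd_V, of u h] that c by (simp add: F_0 trace_prod_outer)
    show False
    proof (rule no_earlier_transport[of q1 q1 p2 c p1])
      show "0 \<le> ?f t u" if "u \<in> {q1..p2}" "t \<in> {0..u}" for t u
        using zero[of u] mono[of 0 t u] that pq1 pq2 by (cases "t = 0") auto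
      show "0 < ?f t u" if "u \<in> {q1<..<p2}" "t \<in> {p1..q1}" for t u
        using zero[of u] mono[of 0 t u] that pq1 pq2 by auto
    qed (use pq1 pq2 c min T_some in auto)
  next
    case False
    then have anti: "?f t u < ?f s u" if "0 \<le> s" "s < t" "t \<le> c" "0 \<le> u" "u \<le> c" for s t u
      using slope[OF that] by (simp add: zero_less_mult_iff)
    show False
    proof (cases "\<forall>u\<in>{q1..p2}. 0 \<le> ?f u u")
      case True
      show False
      proof (rule no_earlier_transport[of q1 q1 p2 c p1])
        show "0 \<le> ?f t u" if "u \<in> {q1..p2}" "t \<in> {0..u}" for t u
          using bspec[OF True, of u] anti[of t u u] that pq1 pq2 by (cases "t = u") auto
        show "0 < ?f t u" if "u \<in> {q1<..<p2}" "t \<in> {p1..q1}" for t u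
          using bspec[OF True, of u] anti[of t u u] that pq1 pq2 by auto
      qed (use pq1 pq2 c min T_some in auto)
    next
      case False
      then obtain u0 where u0: "u0 \<in> {q1..p2}" "?f u0 u0 < 0" by (auto simp: not_le)
      have cont: "continuous_on {q1..p2} (\<lambda>u. ?f u u)"
        by (intro continuous_intros continuous_on_subset[OF continuous_F] continuous_on_subset[OF continuous_V])
           (use pq1 pq2 c T in auto)
      obtain d where d: "0 < d" "\<And>u. u \<in> {q1..p2} \<Longrightarrow> dist u u0 < d \<Longrightarrow> dist (?f u u) (?f u0 u0) < - ?f u0 u0"
        using cont[unfolded continuous_on_iff, rule_format, OF u0(1), of "- ?f u0 u0"] u0(2) by auto
      \<comment> \<open>One time with a negative diagonal value spreads to a short interval by
        continuity. It is clipped to the window, since \<open>u0\<close> may be one of its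
        ends.\<close>
      define a b where "a = max q1 (u0 - d / 2)" and "b = min p2 (u0 + d / 2)"
      have ab: "q1 \<le> a" "a < b" "b \<le> p2" using u0(1) d(1) pq1 by (auto simp: a_def b_def)
      have neg: "?f u u < 0" if "u \<in> {a..b}" for u
      proof -
        have "dist u u0 < d" using that d(1) by (auto simp: a_def b_def dist_real_def abs_less_iff)
        then show ?thesis using d(2)[of u] that ab by (auto simp: dist_real_def)
      qed
      show False
      proof (rule no_later_transport[of a b p2 c q2])
        show "?f t u < 0" if "u \<in> {a..b}" "t \<in> {u..c}" for t u
          using neg[OF that(1)] anti[of u t u] that ab pq1 pq2 by (cases "t = u") auto
      qed (use pq1 pq2 c ab min T_some in auto)
    qed
  qed
qed

end

theorem proposition15:
  fixes \<beta> :: "nat \<Rightarrow> real^'n" and h :: "real^'n" and Q :: "real^'n^'n"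
    and x :: "real \<Rightarrow> real" and \<Phi> :: "real \<Rightarrow> real^'n^'n"
  assumes beta_odd: "\<And>p. p \<ge> 2 \<Longrightarrow> odd p \<Longrightarrow> \<beta> p = 0"
    and beta_summable: "\<And>j. (\<lambda>p. 2 ^ p * (\<beta> p $ j)\<^sup>2) summable_on {2..}"
    and Q_psd: "psd Q"
    and Q_entries: "\<And>i j. Q $ i $ j \<in> {-1..1}"
    and Q_diag: "\<And>i. Q $ i $ i = 1"
    and minimizer: "cs_minimizer \<beta> h Q x \<Phi>"
    and nondegenerate:
      "2 * trace_prod (outer (\<beta> 2) (\<beta> 2)) (path_deriv \<Phi> 0 ^ 2)
        \<noteq> trace_prod (matrix_inv (hat_path x \<Phi> 0) ** path_deriv \<Phi> 0)
                     (matrix_inv (hat_path x \<Phi> 0) ** path_deriv \<Phi> 0)"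
    and zero_supp: "0 \<in> msupport (order_measure (real CARD('n)) x)"
  shows "\<exists>q>0. measure (order_measure (real CARD('n)) x) {0..q}
             = measure (order_measure (real CARD('n)) x) {0}"
proof (rule ccontr)
  let ?m = "real CARD('n)"
  assume no_gap: "\<not> ?thesis"
  have adm: "admissible Q x \<Phi>" using minimizer by (simp add: cs_minimizer_def)
  then have x: "order_cdf ?m x" by (simp add: admissible_def)
  have measure_eq: "measure (order_measure ?m x) {0..t} = x t" if "0 \<le> t" "t \<le> ?m" for t
    using emeasure_order_measure[OF x that] order_cdf_range[OF x that] by (simp add: measure_def)
  \<comment> \<open>The failing conclusion is read through the distribution function; the singleton
    {0} enters as the interval from 0 to 0.\<close>
  have incr: "\<forall>q. 0 < q \<longrightarrow> q \<le> ?m \<longrightarrow> x q \<noteq> x 0"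
    using no_gap measure_eq measure_eq[of 0] by auto
  define T where "T = (SOME T. T \<in> {t_top ?m x<..<?m} \<and> det (Q - \<Phi> T) > 0)"
  have T: "T \<in> {t_top ?m x<..<?m} \<and> det (Q - \<Phi> T) > 0"
    unfolding T_def by (rule someI_ex[OF admissible_cutoff(1)[OF adm]])
  interpret cs_path \<beta> h Q x \<Phi> T
    using beta_summable Q_diag adm T admissible_cutoff(2)[OF adm]
    by unfold_locales (auto simp: admissible_def)
  have "trace_prod (F' 0) (path_deriv \<Phi> 0) \<noteq> 0"
    using nondegenerate by (simp add: F'_0 inv_hat_def)
  from minimizer_not_increasing_at_0[OF minimizer T_def this incr] show False .
qed

end
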